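(* Let $\Omega\subset\mathbb{C}$ be a graph Lipschitz domain, let $\Phi:\mathbb{R}^2_+\to\Omega$ be an associated conformal map (as described in the context), and let $f\in L^2(|\Phi'|^{-1})$ be real-valued. Then $$\int_{\mathbb{R}}(Hf)^2\,\operatorname{Re}\left(\frac1{\Phi'}\right)dx=\int_{\mathbb{R}}f^2\,\operatorname{Re}\left(\frac1{\Phi'}\right)dx-2\int_{\mathbb{R}}f\,Hf\,\operatorname{Im}\left(\frac1{\Phi'}\right)dx$$ and $$\int_{\mathbb{R}}(Hf)^2\,\operatorname{Im}\left(\frac1{\Phi'}\right)dx=\int_{\mathbb{R}}f^2\,\operatorname{Im}\left(\frac1{\Phi'}\right)dx+2\int_{\mathbb{R}}f\,Hf\,\operatorname{Re}\left(\frac1{\Phi'}\right)dx.$$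
   Context: $\mathbb{R}^2_+$ is the open upper half-plane, identified with a subset of $\mathbb{C}$. A graph Lipschitz domain is $\Omega=\{z_1+iz_2\in\mathbb{C}:z_2>\gamma(z_1)\}$ with $\gamma:\mathbb{R}\to\mathbb{R}$ Lipschitz. An associated conformal map is a conformal bijection $\Phi:\mathbb{R}^2_+\to\Omega$ with $\Phi(\infty)=\infty$ and $\Phi(i)=iy_0$ for some $y_0>\gamma(0)$. It is known that $\Phi$ extends to a homeomorphism $\overline{\mathbb{R}^2_+}\to\overline\Omega$, that $x\mapsto\Phi(x)$, $x\in\mathbb{R}$, is absolutely continuous on bounded intervals, that $\Phi'(x)$ exists and is non-zero for a.e. $x\in\mathbb{R}$ and is the non-tangential limit of $\Phi'(z)$ as $z\to x$ for a.e. $x$, and that $|\Phi'|$ (on $\mathbb{R}$) is in the Muckenhoupt class $A_2$. In integrals over $\mathbb{R}$, $\Phi'$ denotes this boundary function. $L^2(w)$ is the space of measurable $f$ with $\int_{\mathbb{R}}|f|^2w\,dx<\infty$. The Hilbert transform is $Hf(x)=\frac1\pi\lim_{\varepsilon\to0}\int_{|x-y|>\varepsilon}\frac{f(y)}{x-y}\,dy$. *)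

theory Defs
  imports "HOL-Analysis.Analysis"
begin

definition upper_half_plane :: "complex set" where
  "upper_half_plane = {z. Im z > 0}"

definition lipschitz_graph_function :: "(real \<Rightarrow> real) \<Rightarrow> bool" where
  "lipschitz_graph_function \<gamma> \<longleftrightarrow> (\<exists>L. L-lipschitz_on UNIV \<gamma>)"

definition graph_domain :: "(real \<Rightarrow> real) \<Rightarrow> complex set" where
  "graph_domain \<gamma> = {z. Im z > \<gamma> (Re z)}"

text \<open>
  Only the values of \<open>\<Phi>\<close> on the open half-plane are constrained.  The third conjunct says
  \<open>\<Phi>(\<infinity>) = \<infinity>\<close>, as a limit taken within the half-plane.
\<close>

definition associated_conformal_map :: "(real \<Rightarrow> real) \<Rightarrow> (complex \<Rightarrow> complex) \<Rightarrow> bool" where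
  "associated_conformal_map \<gamma> \<Phi> \<longleftrightarrow>
     \<Phi> holomorphic_on upper_half_plane \<and>
     bij_betw \<Phi> upper_half_plane (graph_domain \<gamma>) \<and>
     filterlim \<Phi> at_infinity (inf at_infinity (principal upper_half_plane)) \<and>
     (\<exists>y0 > \<gamma> 0. \<Phi> \<i> = \<i> * complex_of_real y0)"

text \<open>
  The continuous extension of \<open>\<Phi>\<close> to the real line, and the boundary function \<open>\<Phi>'\<close>, which is the
  derivative of that extension along the real line.  The latter has an arbitrary value on the null
  set where this derivative does not exist; integrals are therefore taken with respect to the
  complete measure \<open>lebesgue\<close>, for which such a change does not affect measurability.
\<close>

definition boundary_map :: "(complex \<Rightarrow> complex) \<Rightarrow> real \<Rightarrow> complex" where
  "boundary_map \<Phi> x = Lim (at (complex_of_real x) within upper_half_plane) \<Phi>"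

definition boundary_deriv :: "(complex \<Rightarrow> complex) \<Rightarrow> real \<Rightarrow> complex" where
  "boundary_deriv \<Phi> x = vector_derivative (boundary_map \<Phi>) (at x)"

definition in_weighted_L2 :: "(real \<Rightarrow> real) \<Rightarrow> (real \<Rightarrow> real) \<Rightarrow> bool" where
  "in_weighted_L2 w f \<longleftrightarrow>
     f \<in> borel_measurable lebesgue \<and> integrable lebesgue (\<lambda>x. \<bar>f x\<bar>\<^sup>2 * w x)"

definition truncated_hilbert :: "real \<Rightarrow> (real \<Rightarrow> real) \<Rightarrow> real \<Rightarrow> real" where
  "truncated_hilbert \<epsilon> f x = (LINT y:{y. \<bar>x - y\<bar> > \<epsilon>}|lebesgue. f y / (x - y))"

definition hilbert_transform :: "(real \<Rightarrow> real) \<Rightarrow> real \<Rightarrow> real" where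
  "hilbert_transform f x = (1 / pi) * Lim (at_right 0) (\<lambda>\<epsilon>. truncated_hilbert \<epsilon> f x)"

text \<open>
  Bochner integrals and \<open>Lim\<close> are total, so it has to be said separately that the principal value
  defining \<open>Hf(x)\<close> exists.
\<close>

definition hilbert_exists_at :: "(real \<Rightarrow> real) \<Rightarrow> real \<Rightarrow> bool" where
  "hilbert_exists_at f x \<longleftrightarrow>
     (\<forall>\<epsilon>>0. set_integrable lebesgue {y. \<bar>x - y\<bar> > \<epsilon>} (\<lambda>y. f y / (x - y))) \<and>
     (\<exists>l. ((\<lambda>\<epsilon>. truncated_hilbert \<epsilon> f x) \<longlongrightarrow> l) (at_right 0))"

end

theory Submission
  imports Defs "HOL-Complex_Analysis.Complex_Analysis" "HOL-Probability.Sinc_Integral" "HOL-Real_Asymp.Real_Asymp"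
begin

text \<open>
  If \<open>v\<close> lies in the cone \<open>Im v \<ge> L * \<bar>Re v\<bar>\<close>, then \<open>\<Omega> + v \<subseteq> \<Omega>\<close> and
  \<open>\<Phi>\<inverse> \<circ> (\<lambda>w. w + v) \<circ> \<Phi>\<close> is a holomorphic self-map of the half-plane which
  by Julia's lemma does not decrease \<open>Im\<close>.  Differentiating in \<open>v\<close> shows that \<open>S = 1 / \<Phi>'\<close> takes
  values in the sector \<open>\<bar>Im S\<bar> \<le> L * Re S\<close>.  Some power \<open>S\<^sup>p\<close> with \<open>p > 1\<close> therefore has positive
  real part, and the Poisson inequality for such functions bounds \<open>S\<close> and \<open>\<Phi>'\<close> in \<open>L\<^sup>p (dx / (1 + x\<^sup>2))\<close>
  on all horizontal lines; this yields the boundary values of \<open>\<Phi>\<close> and \<open>\<Phi>'\<close>.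

  Let \<open>F\<close> be the Cauchy transform of \<open>f\<close>, with boundary values \<open>f + \<i> * Hf\<close>.  If \<open>f\<close> is bounded with
  bounded support, then the integral of \<open>F\<^sup>2 * S\<close> over every horizontal line vanishes, and in the
  limit so does that of \<open>(f + \<i> * Hf)\<^sup>2 / \<Phi>'\<close>; its real and imaginary parts are the two identities.
  The real part on the horizontal lines, together with Jensen's inequality for the Poisson kernel,
  gives the weighted bound for \<open>H\<close> (without \<open>A\<^sub>2\<close> theory) that extends the identities to all \<open>f\<close>.
\<close>

section \<open>Lebesgue points and Poisson averages\<close>

text \<open>The obstacle is that \<open>\<Phi>\<close> is constrained only in the open half-plane:
  its extension to the real line, the absolute continuity there and the boundary function
  \<open>\<Phi>'\<close> all have to come out of the sector condition. Limits of integrals over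
  horizontal lines need uniform integrability, which an \<open>L\<^sup>1\<close> bound does not
  give; this is the purpose of the exponent \<open>p > 1\<close>, available because
  \<open>arctan L < pi / 2\<close> is strict.

  Julia's lemma is fed with the preimages of points high on the imaginary axis. These are so far
  from the boundary of \<open>\<Omega>\<close> that translation by a fixed \<open>v\<close> hardly
  moves them in the hyperbolic metric.

  Bounded \<open>f\<close> with bounded support is convenient twice: \<open>F\<close> decays like
  \<open>1 / \<bar>z\<bar>\<close>, so \<open>F\<^sup>2\<close> beats the growth of
  \<open>S\<close>; and \<open>Re F\<close> is bounded, so a factor
  \<open>exp (\<plusminus> \<i> \<kappa> F)\<close> does not lead out of a proper sector.

  The weighted bound rests on \<open>S\<close> and \<open>1 / S\<close> lying in the same sector.
  Poisson averages of the boundary values of \<open>1 / \<bar>S\<bar>\<close> are then at most a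
  multiple of \<open>Re (1 / S)\<close>, and \<open>Re (1 / S) * Re S \<le> 1\<close>. This is an
  \<open>A\<^sub>2\<close> condition with Poisson averages in place of averages over
  intervals.\<close>

abbreviation poisson :: "real \<Rightarrow> real \<Rightarrow> real \<Rightarrow> real" where
  "poisson x y t \<equiv> y / ((t - x)\<^sup>2 + y\<^sup>2)"

lemma borel_measurable_indicator_cball [measurable]:
  "(indicator (cball x r) :: real \<Rightarrow> ennreal) \<in> borel_measurable borel"
  by (intro borel_measurable_indicator borel_closed closed_cball)

text \<open>The measure with density \<open>g\<close> gives no mass to the zero set of
  \<open>g\<close>, so by outer regularity this set lies in an open set of small mass. Every bad
  point is the centre of a ball inside that open set with mass above \<open>c * r\<close>, and a
  disjoint Vitali subfamily of these balls must have small total length.\<close>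

lemma negligible_large_averages:
  fixes g :: "real \<Rightarrow> ennreal"
  assumes [measurable]: "g \<in> borel_measurable borel"
    and fin: "(\<integral>\<^sup>+t\<in>{-a<..<a}. g t \<partial>lborel) < \<infinity>" and c: "c > 0"
  shows "negligible {x\<in>{-a<..<a}. g x = 0 \<and>
           (\<forall>d>0. \<exists>r. 0 < r \<and> r < d \<and> (\<integral>\<^sup>+t\<in>cball x r. g t \<partial>lborel) > ennreal (c * r))}"
    (is "negligible ?E")
  unfolding negligible_outer_le
proof (intro allI impI)
  fix e :: real assume e: "e > 0"
  define \<nu> where "\<nu> = density lborel (\<lambda>t. g t * indicator {-a<..<a} t)"
  have sets\<nu>[simp, measurable_cong]: "sets \<nu> = sets borel" by (simp add: \<nu>_def)
  have sp: "space \<nu> = UNIV" by (simp add: \<nu>_def)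
  have em: "emeasure \<nu> X = (\<integral>\<^sup>+t\<in>X. g t * indicator {-a<..<a} t \<partial>lborel)" if "X \<in> sets borel" for X
    using that by (simp add: \<nu>_def emeasure_density)
  have fin\<nu>: "emeasure \<nu> (space \<nu>) \<noteq> \<infinity>"
    using fin by (simp add: sp em)
  define A where "A = {x\<in>{-a<..<a}. g x = 0}"
  have A[measurable]: "A \<in> sets borel" unfolding A_def by measurable
  have "emeasure \<nu> A = 0"
    unfolding em[OF A] by (subst nn_integral_0_iff_AE) (auto simp: A_def indicator_def)
  moreover have "emeasure \<nu> A = (INF U \<in> {U. A \<subseteq> U \<and> open U}. emeasure \<nu> U)"
    by (rule outer_regular) (use fin\<nu> in auto)
  \<comment> \<open>A ball enlarged five times has length \<open>10 * r\<close>, less than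
    \<open>10 / c\<close> times the mass of the original ball; total mass \<open>e * c / 10\<close>
    therefore gives total length at most \<open>e\<close>.\<close>
  ultimately have "(INF U \<in> {U. A \<subseteq> U \<and> open U}. emeasure \<nu> U) < ennreal (e * c / 10)"
    using e c by simp
  then obtain U0 where U0: "A \<subseteq> U0" "open U0" "emeasure \<nu> U0 < ennreal (e * c / 10)"
    unfolding INF_less_iff by auto
  define U where "U = U0 \<inter> {-a<..<a}"
  have Uo: "open U" and AU: "A \<subseteq> U" using U0 by (auto simp: U_def A_def)
  have \<nu>U: "emeasure \<nu> U \<le> ennreal (e * c / 10)"
    using U0 emeasure_mono[of U U0 \<nu>] by (auto simp: U_def intro: order.trans less_imp_le)
  \<comment> \<open>The bound \<open>r < 1\<close> serves the Vitali lemma, which asks for bounded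
    radii.\<close>
  have "\<exists>r. 0 < r \<and> r < 1 \<and> cball x r \<subseteq> U \<and> (\<integral>\<^sup>+t\<in>cball x r. g t \<partial>lborel) > ennreal (c * r)"
    if x: "x \<in> ?E" for x
  proof -
    have "x \<in> U" using x AU by (auto simp: A_def)
    then obtain d where d: "d > 0" "cball x d \<subseteq> U" using Uo open_contains_cball by blast
    then obtain r where "0 < r" "r < min d 1" "(\<integral>\<^sup>+t\<in>cball x r. g t \<partial>lborel) > ennreal (c * r)"
      using x[THEN CollectD, THEN conjunct2, THEN conjunct2, rule_format, of "min d 1"] by auto
    moreover have "cball x r \<subseteq> cball x d" using \<open>r < min d 1\<close> by (intro subset_cball) auto
    ultimately show ?thesis using d by (intro exI[of _ r]) auto
  qed
  then have "\<forall>x\<in>?E. \<exists>r. 0 < r \<and> r < 1 \<and> cball x r \<subseteq> U \<and> (\<integral>\<^sup>+t\<in>cball x r. g t \<partial>lborel) > ennreal (c * r)"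
    by (rule ballI)
  from bchoice[OF this] obtain r where "\<forall>x\<in>?E. 0 < r x \<and> r x < 1 \<and> cball x (r x) \<subseteq> U \<and>
      (\<integral>\<^sup>+t\<in>cball x (r x). g t \<partial>lborel) > ennreal (c * r x)" ..
  note r = this[rule_format]
  define E where "E = ?E"
  have rE: "0 < r x" "r x < 1" "cball x (r x) \<subseteq> U"
     "(\<integral>\<^sup>+t\<in>cball x (r x). g t \<partial>lborel) > ennreal (c * r x)" if "x \<in> E" for x
    using r[of x] that unfolding E_def by blast+
  have cov: "E \<subseteq> (\<Union>x\<in>E. cball x (r x))"
  proof
    fix x assume x: "x \<in> E"
    have "x \<in> cball x (r x)" using rE(1)[OF x] by simp
    then show "x \<in> (\<Union>x\<in>E. cball x (r x))" using x by blast
  qed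
  obtain C where C: "countable C" "C \<subseteq> E"
     "pairwise (\<lambda>i j. disjnt (cball i (r i)) (cball j (r j))) C"
     "E \<subseteq> (\<Union>i\<in>C. cball i (5 * r i))"
    by (rule Vitali_covering_lemma_cballs[OF cov, of 1]) (simp_all add: rE less_imp_le)
  define T where "T = (\<Union>i\<in>C. cball i (5 * r i))"
  have T[measurable]: "T \<in> sets borel" unfolding T_def using C(1) by (intro sets.countable_UN') auto
  have disj: "disjoint_family_on (\<lambda>i. cball i (r i)) C"
    using C(3) by (auto simp: disjoint_family_on_def pairwise_def disjnt_def)
  have "emeasure lborel T \<le> (\<integral>\<^sup>+i. emeasure lborel (cball i (5 * r i)) \<partial>count_space C)"
  proof -
    have "emeasure lborel T = (\<integral>\<^sup>+x. indicator T x \<partial>lborel)" by simp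
    also have "\<dots> \<le> (\<integral>\<^sup>+x. (\<integral>\<^sup>+i. indicator (cball i (5 * r i)) x \<partial>count_space C) \<partial>lborel)"
    proof (rule nn_integral_mono)
      fix x :: real
      show "indicator T x \<le> (\<integral>\<^sup>+i. indicator (cball i (5 * r i)) x \<partial>count_space C)"
      proof (cases "x \<in> T")
        case True
        then obtain i where "i \<in> C" "x \<in> cball i (5 * r i)" by (auto simp: T_def)
        then show ?thesis using nn_integral_ge_point[of i C "\<lambda>i. indicator (cball i (5 * r i)) x"] True by simp
      qed simp
    qed
    also have "\<dots> = (\<integral>\<^sup>+i. (\<integral>\<^sup>+x. indicator (cball i (5 * r i)) x \<partial>lborel) \<partial>count_space C)"
      by (rule nn_integral_count_space_nn_integral[OF C(1)]) measurable
    finally show ?thesis by simp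
  qed
  also have "\<dots> \<le> (\<integral>\<^sup>+i. ennreal (10 / c) * emeasure \<nu> (cball i (r i)) \<partial>count_space C)"
  proof (rule nn_integral_mono)
    fix i assume "i \<in> space (count_space C)"
    then have i: "i \<in> E" using C(2) by auto
    have "emeasure lborel (cball i (5 * r i)) = ennreal (10 / c) * ennreal (c * r i)"
      using rE[OF i] c by (simp add: cball_eq_atLeastAtMost ennreal_mult'[symmetric])
    also have "ennreal (c * r i) \<le> (\<integral>\<^sup>+t\<in>cball i (r i). g t \<partial>lborel)"
      using rE[OF i] by (simp add: less_imp_le)
    also have "\<dots> = emeasure \<nu> (cball i (r i))"
      unfolding em[OF borel_closed[OF closed_cball]]
      by (rule nn_integral_cong) (use rE[OF i] in \<open>auto simp: indicator_def U_def split: if_splits\<close>)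
    finally show "emeasure lborel (cball i (5 * r i)) \<le> ennreal (10 / c) * emeasure \<nu> (cball i (r i))"
      by (simp add: mult_left_mono)
  qed
  also have "\<dots> = ennreal (10 / c) * (\<integral>\<^sup>+i. emeasure \<nu> (cball i (r i)) \<partial>count_space C)"
    by (rule nn_integral_cmult) simp
  also have "(\<integral>\<^sup>+i. emeasure \<nu> (cball i (r i)) \<partial>count_space C) = emeasure \<nu> (\<Union>i\<in>C. cball i (r i))"
    by (rule emeasure_UN_countable[OF _ C(1) disj, symmetric]) auto
  also have "\<dots> \<le> emeasure \<nu> U"
    by (rule emeasure_mono) (use C(2) rE(3) in blast, simp add: borel_open Uo)
  also have "\<dots> \<le> ennreal (e * c / 10)" by (rule \<nu>U)
  also have "ennreal (10 / c) * ennreal (e * c / 10) = ennreal e"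
    using c e by (simp add: ennreal_mult'[symmetric])
  finally have Te: "emeasure lborel T \<le> ennreal e" by (simp add: mult_left_mono)
  have "T \<in> lmeasurable"
    using Te by (intro fmeasurableI) (auto simp: le_less_trans[OF _ ennreal_less_top])
  moreover have "measure lebesgue T \<le> e"
    using Te e by (simp add: measure_def enn2real_leI)
  ultimately show "\<exists>T. ?E \<subseteq> T \<and> T \<in> lmeasurable \<and> measure lebesgue T \<le> e"
    using C(4) unfolding T_def E_def by (intro exI[of _ "\<Union>i\<in>C. cball i (5 * r i)"] conjI)
qed

lemma AE_averages_tendsto_zero:
  fixes g :: "real \<Rightarrow> ennreal"
  assumes [measurable]: "g \<in> borel_measurable borel"
    and fin: "\<And>a. (\<integral>\<^sup>+t\<in>{-a<..<a}. g t \<partial>lborel) < \<infinity>"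
  shows "AE x in lborel. g x = 0 \<longrightarrow>
    (\<forall>c>0. \<exists>d>0. \<forall>r. 0 < r \<and> r < d \<longrightarrow> (\<integral>\<^sup>+t\<in>cball x r. g t \<partial>lborel) \<le> ennreal (c * r))"
proof -
  define E where "E n k = {x\<in>{-real n<..<real n}. g x = 0 \<and>
           (\<forall>d>0. \<exists>r. 0 < r \<and> r < d \<and> (\<integral>\<^sup>+t\<in>cball x r. g t \<partial>lborel) > ennreal (1 / (1 + real k) * r))}" for n k
  have "negligible (E n k)" for n k
    unfolding E_def by (rule negligible_large_averages) (use fin in auto)
  then have "AE x in lebesgue. x \<notin> E n k" for n k
    by (simp add: negligible_iff_null_sets AE_not_in)
  then have "AE x in lborel. \<forall>n k. x \<notin> E n k"
    by (simp add: AE_completion_iff AE_all_countable)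
  then show ?thesis
  proof (eventually_elim, intro impI allI)
    fix x c :: real assume x: "\<forall>n k. x \<notin> E n k" and gx: "g x = 0" and c: "c > 0"
    obtain n :: nat where n: "\<bar>x\<bar> < real n" using reals_Archimedean2 by blast
    obtain k :: nat where k: "1 / (1 + real k) < c"
      using c reals_Archimedean[of c] by (auto simp: inverse_eq_divide)
    have "x \<notin> E n k" using x by blast
    then obtain d where d: "d > 0" "\<And>r. 0 < r \<Longrightarrow> r < d \<Longrightarrow> 
       (\<integral>\<^sup>+t\<in>cball x r. g t \<partial>lborel) \<le> ennreal (1 / (1 + real k) * r)"
      using gx n unfolding E_def not_less[symmetric] by (auto simp: abs_less_iff)
    show "\<exists>d>0. \<forall>r. 0 < r \<and> r < d \<longrightarrow> (\<integral>\<^sup>+t\<in>cball x r. g t \<partial>lborel) \<le> ennreal (c * r)"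
    proof (intro exI[of _ d] conjI allI impI d)
      fix r assume r: "0 < r \<and> r < d"
      then show "(\<integral>\<^sup>+t\<in>cball x r. g t \<partial>lborel) \<le> ennreal (c * r)"
        using d(2)[of r] k by (intro order.trans[OF _ ennreal_leI[OF mult_right_mono[of "1 / (1 + real k)" c]]]) auto
    qed
  qed
qed

text \<open>The Lebesgue point condition with limit value 0. Since the integral is an extended
  nonnegative one, finiteness near \<open>x\<close> is part of the condition. The length
  \<open>2 * r\<close> of the ball is absorbed into \<open>c\<close>.\<close>

definition vanishes_in_mean_at :: "(real \<Rightarrow> real) \<Rightarrow> real \<Rightarrow> bool" where
  "vanishes_in_mean_at g x \<longleftrightarrow>
    (\<forall>c>0. \<exists>d>0. \<forall>r. 0 < r \<and> r < d \<longrightarrow> (\<integral>\<^sup>+t\<in>cball x r. ennreal \<bar>g t\<bar> \<partial>lborel) \<le> ennreal (c * r))"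

text \<open>\<open>AE_averages_tendsto_zero\<close> speaks only of points where the function is 0.
  It is applied to the positive parts of \<open>f - q\<close> and \<open>q - f\<close> for all
  rational \<open>q\<close>, at the price of countably many null sets; rationals just above and just
  below \<open>f x\<close> then control \<open>f - f x\<close>.\<close>

lemma AE_lebesgue_point:
  fixes f :: "real \<Rightarrow> real"
  assumes [measurable]: "f \<in> borel_measurable borel"
    and int: "\<And>a. set_integrable lborel {-a<..<a} f"
  shows "AE x in lborel. vanishes_in_mean_at (\<lambda>t. f t - f x) x"
proof -
  have fin1: "(\<integral>\<^sup>+t\<in>{-a<..<a}. ennreal (\<bar>f t\<bar> + \<bar>q\<bar>) \<partial>lborel) < \<infinity>" for a q :: real
  proof -
    have "set_integrable lborel {-a<..<a} (\<lambda>t. q)"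
      by (rule borel_integrable_atLeastAtMost'[THEN set_integrable_subset, of "-a" a]) auto
    then have "set_integrable lborel {-a<..<a} (\<lambda>t. \<bar>f t\<bar> + \<bar>q\<bar>)"
      using int[of a] by (intro set_integral_add set_integrable_abs)
    then have "(\<integral>\<^sup>+t. ennreal (norm (indicator {-a<..<a} t *\<^sub>R (\<bar>f t\<bar> + \<bar>q\<bar>))) \<partial>lborel) < \<infinity>"
      unfolding set_integrable_def integrable_iff_bounded by simp
    also have "(\<integral>\<^sup>+t. ennreal (norm (indicator {-a<..<a} t *\<^sub>R (\<bar>f t\<bar> + \<bar>q\<bar>))) \<partial>lborel) =
       (\<integral>\<^sup>+t\<in>{-a<..<a}. ennreal (\<bar>f t\<bar> + \<bar>q\<bar>) \<partial>lborel)"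
      by (rule nn_integral_cong) (auto simp: indicator_def)
    finally show ?thesis .
  qed
  have fin: "(\<integral>\<^sup>+t\<in>{-a<..<a}. ennreal (max 0 (f t - q)) \<partial>lborel) < \<infinity>"
            "(\<integral>\<^sup>+t\<in>{-a<..<a}. ennreal (max 0 (q - f t)) \<partial>lborel) < \<infinity>" for a q :: real
    by (rule le_less_trans[OF nn_integral_mono fin1[where a=a and q=q]];
        auto intro!: ennreal_leI simp: indicator_def simp del: ennreal_plus)+
  have "AE x in lborel. \<forall>q\<in>\<rat>. 
     (ennreal (max 0 (f x - q)) = 0 \<longrightarrow> (\<forall>c>0. \<exists>d>0. \<forall>r. 0 < r \<and> r < d \<longrightarrow> 
         (\<integral>\<^sup>+t\<in>cball x r. ennreal (max 0 (f t - q)) \<partial>lborel) \<le> ennreal (c * r)))"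
    by (subst AE_ball_countable[OF countable_rat]) (intro ballI AE_averages_tendsto_zero fin, measurable)
  moreover have "AE x in lborel. \<forall>q\<in>\<rat>. 
     (ennreal (max 0 (q - f x)) = 0 \<longrightarrow> (\<forall>c>0. \<exists>d>0. \<forall>r. 0 < r \<and> r < d \<longrightarrow> 
         (\<integral>\<^sup>+t\<in>cball x r. ennreal (max 0 (q - f t)) \<partial>lborel) \<le> ennreal (c * r)))"
    by (subst AE_ball_countable[OF countable_rat]) (intro ballI AE_averages_tendsto_zero fin, measurable)
  ultimately show ?thesis
    unfolding vanishes_in_mean_at_def
  proof (eventually_elim, intro allI impI)
    fix x c :: real assume 1: "\<forall>q\<in>\<rat>. 
     (ennreal (max 0 (f x - q)) = 0 \<longrightarrow> (\<forall>c>0. \<exists>d>0. \<forall>r. 0 < r \<and> r < d \<longrightarrow> 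
         (\<integral>\<^sup>+t\<in>cball x r. ennreal (max 0 (f t - q)) \<partial>lborel) \<le> ennreal (c * r)))"
     and 2: "\<forall>q\<in>\<rat>. 
     (ennreal (max 0 (q - f x)) = 0 \<longrightarrow> (\<forall>c>0. \<exists>d>0. \<forall>r. 0 < r \<and> r < d \<longrightarrow> 
         (\<integral>\<^sup>+t\<in>cball x r. ennreal (max 0 (q - f t)) \<partial>lborel) \<le> ennreal (c * r)))"
     and c: "c > 0"
    obtain p where p: "p \<in> \<rat>" "f x - c/8 < p" "p < f x" 
      using Rats_dense_in_real[of "f x - c/8" "f x"] c by auto
    obtain q where q: "q \<in> \<rat>" "f x < q" "q < f x + c/8" 
      using Rats_dense_in_real[of "f x" "f x + c/8"] c by auto
    obtain d1 where d1: "d1 > 0" "\<And>r. 0 < r \<Longrightarrow> r < d1 \<Longrightarrow> 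
      (\<integral>\<^sup>+t\<in>cball x r. ennreal (max 0 (f t - q)) \<partial>lborel) \<le> ennreal (c/4 * r)"
      using 1[rule_format, OF q(1), of "c/4"] q c by auto
    obtain d2 where d2: "d2 > 0" "\<And>r. 0 < r \<Longrightarrow> r < d2 \<Longrightarrow> 
      (\<integral>\<^sup>+t\<in>cball x r. ennreal (max 0 (p - f t)) \<partial>lborel) \<le> ennreal (c/4 * r)"
      using 2[rule_format, OF p(1), of "c/4"] p c by auto
    show "\<exists>d>0. \<forall>r. 0 < r \<and> r < d \<longrightarrow> (\<integral>\<^sup>+t\<in>cball x r. ennreal \<bar>f t - f x\<bar> \<partial>lborel) \<le> ennreal (c * r)"
    proof (intro exI[of _ "min d1 d2"] conjI allI impI)
      fix r assume r: "0 < r \<and> r < min d1 d2"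
      \<comment> \<open>Pointwise, \<open>\<bar>f t - f x\<bar>\<close> is at most the excess of
        \<open>f t\<close> over \<open>q\<close> plus its deficit below \<open>p\<close> plus
        \<open>c/4\<close>. The three integrals over a ball of length \<open>2 * r\<close>
        contribute at most \<open>c/4 * r\<close>, \<open>c/4 * r\<close> and
        \<open>c/2 * r\<close>.\<close>
      have "(\<integral>\<^sup>+t\<in>cball x r. ennreal \<bar>f t - f x\<bar> \<partial>lborel) \<le>
        (\<integral>\<^sup>+t. ennreal (max 0 (f t - q)) * indicator (cball x r) t + 
          (ennreal (max 0 (p - f t)) * indicator (cball x r) t + ennreal (c/4) * indicator (cball x r) t) \<partial>lborel)"
        by (rule nn_integral_mono)
           (use p q c in \<open>auto simp: indicator_def ennreal_plus[symmetric] simp del: ennreal_plus intro!: ennreal_leI\<close>)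
      also have "\<dots> = (\<integral>\<^sup>+t\<in>cball x r. ennreal (max 0 (f t - q)) \<partial>lborel) + 
          ((\<integral>\<^sup>+t\<in>cball x r. ennreal (max 0 (p - f t)) \<partial>lborel) + (\<integral>\<^sup>+t. ennreal (c/4) * indicator (cball x r) t \<partial>lborel))"
        by (subst nn_integral_add, measurable, subst nn_integral_add, measurable)
      also have "\<dots> \<le> ennreal (c/4*r) + (ennreal (c/4*r) + ennreal (c/4 * (2*r)))"
        using r c by (intro add_mono d1 d2)
          (auto simp: nn_integral_cmult cball_eq_atLeastAtMost ennreal_mult'[symmetric])
      also have "\<dots> = ennreal (c * r)"
        using r c by (simp add: ennreal_plus[symmetric] algebra_simps del: ennreal_plus)
      finally show "(\<integral>\<^sup>+t\<in>cball x r. ennreal \<bar>f t - f x\<bar> \<partial>lborel) \<le> ennreal (c * r)" .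
    qed (use d1 d2 in auto)
  qed
qed


text \<open>The kernel is dominated by a sum of indicators of concentric balls of radii
  \<open>2^k * y\<close> with heights decaying like \<open>4^(-k) / y\<close>. The hypothesis bounds
  the integral over the \<open>k\<close>-th ball by \<open>c * 2^k * y\<close>, and a geometric
  series remains, independent of \<open>y\<close>.\<close>

lemma nn_integral_poisson_near:
  fixes g :: "real \<Rightarrow> ennreal"
  assumes [measurable]: "g \<in> borel_measurable borel"
    and bound: "\<And>r. 0 < r \<Longrightarrow> r < d \<Longrightarrow> (\<integral>\<^sup>+t\<in>cball x r. g t \<partial>lborel) \<le> ennreal (c * r)"
    and c: "0 \<le> c" and y: "0 < y" and d': "0 < d'" "d' < d"
  shows "(\<integral>\<^sup>+t\<in>cball x d'. ennreal (poisson x y t) * g t \<partial>lborel) \<le> ennreal (8 * c)"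
proof -
  \<comment> \<open>Cutting the radius at \<open>d'\<close> keeps every ball in the range where
    \<open>bound\<close> applies.\<close>
  define w where "w k t = ennreal (4 / y * (1/4)^k) * indicator (cball x (min (2^k * y) d')) t" for k :: nat and t :: real
  have [measurable]: "w k \<in> borel_measurable borel" for k unfolding w_def by measurable
  have pw: "ennreal (poisson x y t) \<le> (\<Sum>k. w k t)" if t: "t \<in> cball x d'" for t
  proof -
    have "\<exists>k. \<bar>t - x\<bar> \<le> 2^k * y"
    proof -
      obtain k where "\<bar>t - x\<bar> / y < 2 ^ k" using real_arch_pow[of 2 "\<bar>t - x\<bar> / y"] by auto
      then show ?thesis using y by (intro exI[of _ k]) (simp add: field_simps)
    qed
    \<comment> \<open>Minimality puts \<open>t\<close> outside the ball of radius
      \<open>2^(k-1) * y\<close> if \<open>k > 0\<close>, which bounds the kernel from above by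
      \<open>4 / (4^k * y)\<close>; for \<open>k = 0\<close> its maximum \<open>1 / y\<close> is
      good enough.\<close>
    define k where "k = (LEAST k. \<bar>t - x\<bar> \<le> 2^k * y)"
    have k: "\<bar>t - x\<bar> \<le> 2^k * y" unfolding k_def by (rule LeastI_ex) fact
    have sq: "(t - x)\<^sup>2 + y\<^sup>2 > 0" using y by (simp add: add_nonneg_pos)
    have "poisson x y t \<le> 4 / y * (1/4)^k"
    proof (cases k)
      case 0
      have "q \<le> 4 * (p + q)" if "0 \<le> p" "0 \<le> q" for p q :: real using that by simp
      then have "y * y \<le> 4 * ((t - x)\<^sup>2 + y\<^sup>2)" by (simp add: power2_eq_square)
      then show ?thesis using 0 y sq by (simp add: field_simps)
    next
      case (Suc j)
      have "\<not> \<bar>t - x\<bar> \<le> 2^j * y" using Suc not_less_Least[of j "\<lambda>k. \<bar>t - x\<bar> \<le> 2^k * y"] by (simp add: k_def)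
      then have "(2^j * y)\<^sup>2 \<le> \<bar>t - x\<bar>\<^sup>2" using y by (intro power_mono) auto
      moreover have "(2^j * y)\<^sup>2 = 4^j * (y * y)"
      proof -
        have "(4::real)^j = 2^j * 2^j" by (simp flip: power_mult_distrib)
        then show ?thesis by (simp add: power2_eq_square)
      qed
      ultimately have "4^j * (y * y) \<le> (t - x)\<^sup>2 + y\<^sup>2"
        using zero_le_power2[of y] by (simp add: add_increasing2)
      then show ?thesis using Suc y sq by (simp add: field_simps power_divide)
    qed
    then have "ennreal (poisson x y t) \<le> w k t"
      using t k by (auto simp: w_def dist_real_def abs_minus_commute intro!: ennreal_leI)
    also have "\<dots> \<le> (\<Sum>k. w k t)" using sum_le_suminf[of "\<lambda>k. w k t" "{k}"] by simp
    finally show ?thesis .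
  qed
  have "(\<integral>\<^sup>+t\<in>cball x d'. ennreal (poisson x y t) * g t \<partial>lborel) \<le> (\<integral>\<^sup>+t. (\<Sum>k. w k t * g t) \<partial>lborel)"
    using pw by (intro nn_integral_mono) (auto simp: indicator_def mult_right_mono ennreal_suminf_multc)
  also have "\<dots> = (\<Sum>k. \<integral>\<^sup>+t. w k t * g t \<partial>lborel)"
    by (rule nn_integral_suminf) measurable
  also have "\<dots> \<le> (\<Sum>k. ennreal (4 * c * (1/2)^k))"
  proof (rule suminf_le[OF _ summableI summableI])
    fix k :: nat
    have "(\<integral>\<^sup>+t. w k t * g t \<partial>lborel) = (\<integral>\<^sup>+t. ennreal (4 / y * (1/4)^k) * (g t * indicator (cball x (min (2^k * y) d')) t) \<partial>lborel)"
      by (rule nn_integral_cong) (simp add: w_def mult_ac)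
    also have "\<dots> = ennreal (4 / y * (1/4)^k) * (\<integral>\<^sup>+t\<in>cball x (min (2^k * y) d'). g t \<partial>lborel)"
      by (rule nn_integral_cmult) measurable
    also have "\<dots> \<le> ennreal (4 / y * (1/4)^k) * ennreal (c * min (2^k * y) d')"
      using y d' by (intro mult_left_mono bound) auto
    also have "\<dots> \<le> ennreal (4 / y * (1/4)^k) * ennreal (c * (2^k * y))"
      using c by (intro mult_left_mono ennreal_leI) auto
    also have "\<dots> = ennreal (4 * c * (1/2)^k)"
    proof -
      have "(1/4::real)^k * 2^k = (1/2)^k" by (simp flip: power_mult_distrib)
      then have "4 / y * (1/4)^k * (c * (2^k * y)) = 4 * c * (1/2)^k" using y by (simp add: field_simps)
      then show ?thesis using y c by (simp add: ennreal_mult'[symmetric])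
    qed
    finally show "(\<integral>\<^sup>+t. w k t * g t \<partial>lborel) \<le> ennreal (4 * c * (1/2)^k)" .
  qed
  also have "\<dots> = ennreal (4 * c * 2)"
    using c geometric_sums[of "1/2::real"] by (intro suminf_ennreal_eq sums_mult) auto
  finally show ?thesis by simp
qed

lemma poisson_denominator_le:
  fixes t x y :: real
  assumes "0 < y"
  shows "1 / ((t - x)\<^sup>2 + y\<^sup>2) \<le> (2 + (1 + 2 * x\<^sup>2) / y\<^sup>2) / (1 + t\<^sup>2)"
proof -
  \<comment> \<open>This is \<open>t\<^sup>2 \<le> 2 * (t - x)\<^sup>2 + 2 * x\<^sup>2\<close> in
    disguise.\<close>
  have "0 \<le> (t - 2 * x)\<^sup>2" by simp
  then have 1: "1 + t\<^sup>2 \<le> 2 * (t - x)\<^sup>2 + (1 + 2 * x\<^sup>2)" by (simp add: power2_eq_square algebra_simps)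
  have "(1 + 2 * x\<^sup>2) \<le> (1 + 2 * x\<^sup>2) / y\<^sup>2 * ((t - x)\<^sup>2 + y\<^sup>2)"
    using assms by (simp add: field_simps)
  with 1 have "1 + t\<^sup>2 \<le> (2 + (1 + 2 * x\<^sup>2) / y\<^sup>2) * ((t - x)\<^sup>2 + y\<^sup>2)"
    using zero_le_power2[of y] unfolding distrib_right by (smt (verit))
  moreover have "(t - x)\<^sup>2 + y\<^sup>2 > 0" using assms by (simp add: add_nonneg_pos)
  moreover have "1 + t\<^sup>2 > 0" by (simp add: add_pos_nonneg)
  ultimately show ?thesis by (simp add: field_simps)
qed

lemma integrable_poisson:
  fixes g :: "real \<Rightarrow> 'a :: {banach, second_countable_topology}"
  assumes int: "integrable lborel (\<lambda>t. g t /\<^sub>R (1 + t\<^sup>2))" and y: "0 < y"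
    and g[measurable]: "g \<in> borel_measurable borel"
  shows "integrable lborel (\<lambda>t. (poisson x y t) *\<^sub>R g t)"
proof (rule Bochner_Integration.integrable_bound)
  show "integrable lborel (\<lambda>t. (y * (2 + (1 + 2 * x\<^sup>2) / y\<^sup>2)) *\<^sub>R (g t /\<^sub>R (1 + t\<^sup>2)))"
    using int by (intro integrable_scaleR_right)
  show "AE t in lborel. norm ((poisson x y t) *\<^sub>R g t) \<le>
      norm ((y * (2 + (1 + 2 * x\<^sup>2) / y\<^sup>2)) *\<^sub>R (g t /\<^sub>R (1 + t\<^sup>2)))"
  proof (rule AE_I2)
    fix t
    have A: "0 \<le> 1 + t\<^sup>2" "0 \<le> 2 + (1 + 2 * x\<^sup>2) / y\<^sup>2" "0 \<le> (t - x)\<^sup>2 + y\<^sup>2" by simp_all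
    have "y * (1 / ((t - x)\<^sup>2 + y\<^sup>2)) \<le> y * ((2 + (1 + 2 * x\<^sup>2) / y\<^sup>2) / (1 + t\<^sup>2))"
      using y by (intro mult_left_mono poisson_denominator_le) auto
    then have "poisson x y t * norm (g t) \<le> y * (2 + (1 + 2 * x\<^sup>2) / y\<^sup>2) / (1 + t\<^sup>2) * norm (g t)"
      by (intro mult_right_mono) auto
    then show "norm ((poisson x y t) *\<^sub>R g t) \<le>
      norm ((y * (2 + (1 + 2 * x\<^sup>2) / y\<^sup>2)) *\<^sub>R (g t /\<^sub>R (1 + t\<^sup>2)))"
      using y A by (simp add: abs_mult abs_of_nonneg divide_inverse mult_ac)
  qed
qed measurable

text \<open>Near \<open>x\<close> the vanishing mean gives a bound uniform in \<open>y\<close> by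
  \<open>nn_integral_poisson_near\<close>; away from \<open>x\<close> the kernel is at most
  \<open>y\<close> times a fixed multiple of \<open>1 / (1 + t\<^sup>2)\<close>.\<close>

lemma poisson_tendsto_zero:
  fixes g :: "real \<Rightarrow> real"
  assumes g[measurable]: "g \<in> borel_measurable borel"
    and int: "integrable lborel (\<lambda>t. g t / (1 + t\<^sup>2))" 
    and van: "vanishes_in_mean_at g x"
  shows "((\<lambda>y. \<integral>t. poisson x y t * \<bar>g t\<bar> \<partial>lborel) \<longlongrightarrow> 0) (at_right 0)"
proof (rule tendstoI)
  fix e :: real assume e: "e > 0"
  \<comment> \<open>The near part costs a factor 8 and thus takes \<open>e / 2\<close>; the far part
    tends to 0 with \<open>y\<close>.\<close>
  define c where "c = e / 16"
  have c: "c > 0" using e by (simp add: c_def)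
  obtain d where d: "d > 0" "\<And>r. 0 < r \<Longrightarrow> r < d \<Longrightarrow> (\<integral>\<^sup>+t\<in>cball x r. ennreal \<bar>g t\<bar> \<partial>lborel) \<le> ennreal (c * r)"
    using van c unfolding vanishes_in_mean_at_def by blast
  define d' where "d' = d / 2"
  have d': "0 < d'" "d' < d" using d(1) by (auto simp: d'_def)
  define K where "K = 2 * (2 + (1 + 2 * x\<^sup>2) / d'\<^sup>2)"
  have K: "K \<ge> 0" by (simp add: K_def)
  define J where "J = (\<integral>t. \<bar>g t\<bar> / (1 + t\<^sup>2) \<partial>lborel)"
  have intJ: "integrable lborel (\<lambda>t. \<bar>g t\<bar> / (1 + t\<^sup>2))"
    using integrable_norm[OF int] by (simp add: abs_of_nonneg)
  have J: "J \<ge> 0" unfolding J_def by (intro integral_nonneg_AE AE_I2) simp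
  have main: "(\<integral>t. poisson x y t * \<bar>g t\<bar> \<partial>lborel) \<le> 8 * c + y * (K * J)" if y: "y > 0" for y
  proof -
    have i: "integrable lborel (\<lambda>t. poisson x y t * \<bar>g t\<bar>)"
      using integrable_poisson[of "\<lambda>t. \<bar>g t\<bar>" y x] intJ y by (simp add: divide_inverse mult_ac)
    have "ennreal (\<integral>t. poisson x y t * \<bar>g t\<bar> \<partial>lborel) = (\<integral>\<^sup>+t. ennreal (poisson x y t * \<bar>g t\<bar>) \<partial>lborel)"
      using y by (intro nn_integral_eq_integral[symmetric] i AE_I2) simp
    also have "\<dots> \<le> (\<integral>\<^sup>+t. (ennreal (poisson x y t) * ennreal \<bar>g t\<bar>) * indicator (cball x d') t
          + ennreal (y * K * (\<bar>g t\<bar> / (1 + t\<^sup>2))) \<partial>lborel)"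
    proof (rule nn_integral_mono)
      fix t
      show "ennreal (poisson x y t * \<bar>g t\<bar>) \<le> (ennreal (poisson x y t) * ennreal \<bar>g t\<bar>) * indicator (cball x d') t
          + ennreal (y * K * (\<bar>g t\<bar> / (1 + t\<^sup>2)))"
      proof (cases "t \<in> cball x d'")
        case True
        then show ?thesis using y by (simp add: ennreal_mult[symmetric] del: times_divide_eq_left)
      next
        case False
        then have "d'\<^sup>2 \<le> \<bar>t - x\<bar>\<^sup>2" using d' by (intro power_mono) (auto simp: dist_real_def)
        \<comment> \<open>Off the ball \<open>(t - x)\<^sup>2\<close> is at least
          \<open>d'\<^sup>2\<close>, so putting \<open>d'\<close> for \<open>y\<close> in the
          denominator costs at most a factor 2 and leaves \<open>y\<close> only in the
          numerator.\<close>
        have "poisson x y t \<le> y * (2 * (1 / ((t - x)\<^sup>2 + d'\<^sup>2)))"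
        proof -
          have "(t - x)\<^sup>2 + d'\<^sup>2 \<le> 2 * ((t - x)\<^sup>2 + y\<^sup>2)" 
          proof -
            have "p + a \<le> 2 * (p + q)" if "a \<le> p" "0 \<le> q" for a p q :: real using that by simp
            from this[of "d'\<^sup>2" "(t - x)\<^sup>2" "y\<^sup>2"] show ?thesis using \<open>d'\<^sup>2 \<le> _\<close> by simp
          qed
          moreover have "0 < (t - x)\<^sup>2 + d'\<^sup>2" "0 < (t - x)\<^sup>2 + y\<^sup>2" using d' y by (simp_all add: add_nonneg_pos)
          ultimately have "1 / ((t - x)\<^sup>2 + y\<^sup>2) \<le> 2 * (1 / ((t - x)\<^sup>2 + d'\<^sup>2))" by (simp add: field_simps)
          from mult_left_mono[OF this, of y] show ?thesis using y by simp
        qed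
        also have "\<dots> \<le> y * (K / (1 + t\<^sup>2))"
          using y mult_left_mono[OF poisson_denominator_le[OF d'(1), of t x], of 2]
          by (intro mult_left_mono) (auto simp: K_def)
        finally have "poisson x y t * \<bar>g t\<bar> \<le> y * (K / (1 + t\<^sup>2)) * \<bar>g t\<bar>"
          by (rule mult_right_mono) simp
        then show ?thesis using False by (auto intro!: ennreal_leI simp: mult_ac)
      qed
    qed
    also have "\<dots> \<le> ennreal (8 * c) + ennreal (y * K * J)"
    proof (subst nn_integral_add)
      show "(\<integral>\<^sup>+t. (ennreal (poisson x y t) * ennreal \<bar>g t\<bar>) * indicator (cball x d') t \<partial>lborel) +
        (\<integral>\<^sup>+t. ennreal (y * K * (\<bar>g t\<bar> / (1 + t\<^sup>2))) \<partial>lborel) \<le> ennreal (8 * c) + ennreal (y * K * J)"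
      proof (rule add_mono)
        show "(\<integral>\<^sup>+t. (ennreal (poisson x y t) * ennreal \<bar>g t\<bar>) * indicator (cball x d') t \<partial>lborel) \<le> ennreal (8 * c)"
          using c y d' by (intro nn_integral_poisson_near[where d=d] d) auto
        show "(\<integral>\<^sup>+t. ennreal (y * K * (\<bar>g t\<bar> / (1 + t\<^sup>2))) \<partial>lborel) \<le> ennreal (y * K * J)"
        proof -
          have "(\<integral>\<^sup>+t. ennreal (y * K * (\<bar>g t\<bar> / (1 + t\<^sup>2))) \<partial>lborel) = ennreal (\<integral>t. y * K * (\<bar>g t\<bar> / (1 + t\<^sup>2)) \<partial>lborel)"
            by (intro nn_integral_eq_integral integrable_mult_right intJ AE_I2) (use y K in simp)
          also have "(\<integral>t. y * K * (\<bar>g t\<bar> / (1 + t\<^sup>2)) \<partial>lborel) = y * K * J"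
            unfolding J_def by (rule integral_mult_right_zero)
          finally show ?thesis by simp
        qed
      qed
    qed measurable
    finally show ?thesis using c y K J by (simp add: ennreal_plus[symmetric] mult_ac del: ennreal_plus)
  qed
  have "((\<lambda>y. 8 * c + y * (K * J)) \<longlongrightarrow> 8 * c + 0 * (K * J)) (at_right 0)"
    by (intro tendsto_intros)
  then have "eventually (\<lambda>y. 8 * c + y * (K * J) < e) (at_right 0)"
    by (rule order_tendstoD(2)) (use e in \<open>simp add: c_def\<close>)
  moreover have "eventually (\<lambda>y::real. y > 0) (at_right 0)" by (simp add: eventually_at_right_less)
  ultimately show "\<forall>\<^sub>F y in at_right 0. dist (\<integral>t. poisson x y t * \<bar>g t\<bar> \<partial>lborel) 0 < e"
  proof eventually_elim
    case (elim y)
    have "0 \<le> (\<integral>t. poisson x y t * \<bar>g t\<bar> \<partial>lborel)"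
      using elim by (intro integral_nonneg_AE AE_I2) simp
    then show ?case using main[of y] elim by (simp add: dist_real_def)
  qed
qed

lemma nn_integral_le_of_AE_tendsto:
  fixes u :: "nat \<Rightarrow> 'a \<Rightarrow> ennreal"
  assumes [measurable]: "\<And>n. u n \<in> borel_measurable M" and lim: "AE x in M. (\<lambda>n. u n x) \<longlonglongrightarrow> v x"
    and le: "\<And>n. (\<integral>\<^sup>+x. u n x \<partial>M) \<le> C n" and C: "C \<longlonglongrightarrow> c"
  shows "(\<integral>\<^sup>+x. v x \<partial>M) \<le> c"
proof -
  have "(\<integral>\<^sup>+x. v x \<partial>M) = (\<integral>\<^sup>+x. liminf (\<lambda>n. u n x) \<partial>M)"
    using lim by (intro nn_integral_cong_AE, eventually_elim) (simp add: lim_imp_Liminf)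
  also have "\<dots> \<le> liminf (\<lambda>n. \<integral>\<^sup>+x. u n x \<partial>M)"
    by (rule nn_integral_liminf) measurable
  also have "\<dots> \<le> liminf C" by (intro Liminf_mono always_eventually allI le)
  also have "\<dots> = c" by (rule lim_imp_Liminf[OF _ C]) simp
  finally show ?thesis .
qed

lemma has_bochner_integral_poisson:
  assumes "0 < y"
  shows "has_bochner_integral lborel (\<lambda>t. poisson x y t) pi"
proof -
  have "has_bochner_integral lborel (\<lambda>t::real. inverse (1 + t\<^sup>2)) pi"
    using integrable_inverse_1_plus_square LBINT_inverse_1_plus_square
    by (simp add: has_bochner_integral_iff set_integrable_def interval_lebesgue_integral_def set_lebesgue_integral_def)
  then have "has_bochner_integral lborel (\<lambda>t. inverse (1 + (- x / y + 1 / y * t)\<^sup>2)) (pi /\<^sub>R \<bar>1 / y\<bar>)"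
    using assms by (subst lborel_has_bochner_integral_real_affine_iff[of "1 / y", symmetric]) auto
  from has_bochner_integral_mult_right[OF this, of "1 / y"]
  have "has_bochner_integral lborel (\<lambda>t. 1 / y * inverse (1 + (- x / y + 1 / y * t)\<^sup>2)) pi"
    using assms by simp
  also have "(\<lambda>t. 1 / y * inverse (1 + (- x / y + 1 / y * t)\<^sup>2)) = (\<lambda>t. poisson x y t)"
  proof
    fix t
    have "1 + (- x / y + 1 / y * t)\<^sup>2 = ((t - x)\<^sup>2 + y\<^sup>2) / y\<^sup>2"
      using assms by (simp add: field_simps power2_eq_square)
    then show "1 / y * inverse (1 + (- x / y + 1 / y * t)\<^sup>2) = poisson x y t"
      using assms by (simp add: power2_eq_square)
  qed
  finally show ?thesis .
qed

lemma has_bochner_integral_inverse_1_plus_square: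
  "has_bochner_integral lborel (\<lambda>t::real. 1 / (1 + t\<^sup>2)) pi"
  using has_bochner_integral_poisson[of 1 0] by (simp add: add.commute)

section \<open>Differentiation of indefinite integrals and of Lipschitz functions\<close>

lemma indefinite_integral_has_derivative:
  fixes g \<rho> :: "real \<Rightarrow> real"
  assumes [measurable]: "\<rho> \<in> borel_measurable borel"
    and int: "\<And>a b. set_integrable lborel {a..b} \<rho>"
    and g: "\<And>a b. a \<le> b \<Longrightarrow> g b - g a = (LBINT t:{a..b}. \<rho> t)"
    and van: "vanishes_in_mean_at (\<lambda>t. \<rho> t - A) x"
  shows "(g has_real_derivative A) (at x)"
  unfolding DERIV_def
proof (rule LIM_I)
  fix c :: real assume c: "c > 0"
  obtain d where d: "d > 0" "\<And>r. 0 < r \<Longrightarrow> r < d \<Longrightarrow>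
      (\<integral>\<^sup>+t\<in>cball x r. ennreal \<bar>\<rho> t - A\<bar> \<partial>lborel) \<le> ennreal (c/2 * r)"
    using van c unfolding vanishes_in_mean_at_def by (metis half_gt_zero)
  have key: "\<bar>g b - g a - A * (b - a)\<bar> \<le> c/2 * r" if ab: "a \<le> b" "{a..b} \<subseteq> cball x r" and r: "0 < r" "r < d" for a b r
  proof -
    have i1: "set_integrable lborel {a..b} (\<lambda>t. A)" by (rule borel_integrable_atLeastAtMost') auto
    have i2: "set_integrable lborel {a..b} (\<lambda>t. \<rho> t - A)" by (rule set_integral_diff(1)[OF int i1])
    have "g b - g a - A * (b - a) = (LBINT t:{a..b}. \<rho> t) - (LBINT t:{a..b}. A)"
      using ab by (simp add: g[OF ab(1)] set_lebesgue_integral_def)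
    also have "\<dots> = (LBINT t:{a..b}. \<rho> t - A)"
      by (rule set_integral_diff(2)[OF int i1, symmetric])
    finally have "\<bar>g b - g a - A * (b - a)\<bar> = norm (LBINT t:{a..b}. \<rho> t - A)" by simp
    also have "ennreal \<dots> \<le> (\<integral>\<^sup>+t. ennreal (norm (indicator {a..b} t *\<^sub>R (\<rho> t - A))) \<partial>lborel)"
      unfolding set_lebesgue_integral_def
      by (rule integral_norm_bound_ennreal) (use i2 in \<open>simp add: set_integrable_def\<close>)
    also have "\<dots> \<le> (\<integral>\<^sup>+t\<in>cball x r. ennreal \<bar>\<rho> t - A\<bar> \<partial>lborel)"
      by (rule nn_integral_mono) (use ab in \<open>auto simp: indicator_def\<close>)
    also have "\<dots> \<le> ennreal (c/2 * r)" by (rule d) (use r in auto)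
    finally show ?thesis using c r by simp
  qed
  have "\<bar>(g (x + h) - g x) / h - A\<bar> < c" if h: "h \<noteq> 0" "\<bar>h\<bar> < d" for h
  proof -
    have "\<bar>g (x + h) - g x - A * h\<bar> \<le> c/2 * \<bar>h\<bar>"
    proof (cases "h > 0")
      case True
      have "\<bar>g (x + h) - g x - A * (x + h - x)\<bar> \<le> c/2 * \<bar>h\<bar>"
        by (rule key) (use True h in \<open>auto simp: dist_real_def\<close>)
      then show ?thesis by simp
    next
      case False
      have "\<bar>g x - g (x + h) - A * (x - (x + h))\<bar> \<le> c/2 * \<bar>h\<bar>"
        by (rule key) (use False h in \<open>auto simp: dist_real_def\<close>)
      also have "\<bar>g x - g (x + h) - A * (x - (x + h))\<bar> = \<bar>g (x + h) - g x - A * h\<bar>" by simp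
      finally show ?thesis .
    qed
    also have "\<dots> < c * \<bar>h\<bar>" using c h by simp
    finally have "\<bar>(g (x + h) - g x - A * h) / h\<bar> < c" using h by (simp add: abs_divide divide_less_eq)
    also have "(g (x + h) - g x - A * h) / h = (g (x + h) - g x) / h - A" using h by (simp add: field_simps)
    finally show ?thesis .
  qed
  then show "\<exists>s>0. \<forall>h. h \<noteq> 0 \<and> norm (h - 0) < s \<longrightarrow> norm ((g (x + h) - g x) / h - A) < c"
    using d(1) by (intro exI[of _ d]) auto
qed

text \<open>Both \<open>h\<close> and \<open>\<lambda>x. x - h x\<close> are nondecreasing and
  continuous, and their Stieltjes measures add up to Lebesgue measure. So the measure of
  \<open>h\<close> is dominated by Lebesgue measure and has a density, of which \<open>h\<close> is
  an indefinite integral.\<close>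

lemma AE_differentiable_mono_contraction:
  fixes h :: "real \<Rightarrow> real"
  assumes mono: "\<And>a b. a \<le> b \<Longrightarrow> h a \<le> h b" and contr: "\<And>a b. a \<le> b \<Longrightarrow> h b - h a \<le> b - a"
  shows "AE x in lborel. \<exists>D. (h has_real_derivative D) (at x)"
proof -
  define M1 where "M1 = interval_measure h"
  define M2 where "M2 = interval_measure (\<lambda>x. x - h x)"
  have "1-lipschitz_on UNIV h"
  proof (rule lipschitz_onI)
    fix x y show "dist (h x) (h y) \<le> 1 * dist x y"
      using mono[of x y] mono[of y x] contr[of x y] contr[of y x] by (cases "x \<le> y") (auto simp: dist_real_def)
  qed simp
  then have conth: "continuous_on UNIV h" by (rule lipschitz_on_continuous_on)
  have cont1: "continuous (at_right a) h" for a
    using conth by (simp add: continuous_on_eq_continuous_at continuous_at_imp_continuous_at_within)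
  have cont2: "continuous (at_right a) (\<lambda>x. x - h x)" for a
    by (intro continuous_intros cont1)
  have mono2: "a - h a \<le> b - h b" if "a \<le> b" for a b using contr[OF that] by simp
  have S1[simp]: "sets M1 = sets borel" and S2[simp]: "sets M2 = sets borel" by (simp_all add: M1_def M2_def)
  have Ioc1: "emeasure M1 {a<..b} = ennreal (h b - h a)" if "a \<le> b" for a b
    unfolding M1_def by (rule emeasure_interval_measure_Ioc[OF that mono cont1])
  have Ioc2: "emeasure M2 {a<..b} = ennreal ((b - h b) - (a - h a))" if "a \<le> b" for a b
    unfolding M2_def by (rule emeasure_interval_measure_Ioc[OF that mono2 cont2])
  have pt1: "emeasure M1 {b} = 0" for b
    using emeasure_interval_measure_Icc[of b b h] mono conth by (simp add: M1_def)
  have pt2: "emeasure M2 {b} = 0" for b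
    using emeasure_interval_measure_Icc[of b b "\<lambda>x. x - h x"] mono2 conth
    by (simp add: M2_def continuous_on_diff)
  define N where "N = measure_of UNIV (sets borel) (\<lambda>A. emeasure M1 A + emeasure M2 A)"
  have SN[simp]: "sets N = sets borel" unfolding N_def using sigma_algebra.sets_measure_of_eq[of UNIV "sets borel"]
    by (simp add: sets.sigma_algebra_axioms[of borel, simplified])
  have em: "emeasure N A = emeasure M1 A + emeasure M2 A" if "A \<in> sets borel" for A
    unfolding N_def
  proof (rule emeasure_measure_of_sigma[OF _ _ _ that])
    show "sigma_algebra UNIV (sets (borel :: real measure))" using sets.sigma_algebra_axioms[of "borel :: real measure"] by simp
    show "positive (sets borel) (\<lambda>A. emeasure M1 A + emeasure M2 A)" by (simp add: positive_def)
    show "countably_additive (sets borel) (\<lambda>A. emeasure M1 A + emeasure M2 A)"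
    proof (rule countably_additiveI)
      fix A :: "nat \<Rightarrow> real set" assume A: "range A \<subseteq> sets borel" "disjoint_family A"
      have "(\<Sum>i. emeasure M1 (A i) + emeasure M2 (A i)) = (\<Sum>i. emeasure M1 (A i)) + (\<Sum>i. emeasure M2 (A i))"
        by (rule suminf_add[symmetric]) (auto intro: summableI)
      then show "(\<Sum>i. emeasure M1 (A i) + emeasure M2 (A i)) = emeasure M1 (\<Union> (range A)) + emeasure M2 (\<Union> (range A))"
        using A by (simp add: suminf_emeasure)
    qed
  qed
  \<comment> \<open>Agreement on open intervals identifies the measures. Stieltjes measures are
    computed on half-open intervals; by continuity the endpoint carries no mass.\<close>
  have "lborel = N"
  proof (rule lborel_eqI)
    fix l u :: real assume lu: "\<And>b. b \<in> Basis \<Longrightarrow> l \<bullet> b \<le> u \<bullet> b"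
    then have le: "l \<le> u" by simp
    have o: "emeasure M {l<..<u} = emeasure M {l<..u}" if "sets M = sets borel" "emeasure M {u} = 0" for M
    proof -
      have "emeasure M ({l<..u} - {u}) = emeasure M {l<..u}"
        by (rule emeasure_Diff_null_set) (use that in \<open>auto simp: null_sets_def\<close>)
      also have "{l<..u} - {u} = {l<..<u}" by auto
      finally show ?thesis .
    qed
    have "emeasure N (box l u) = ennreal (h u - h l) + ennreal ((u - h u) - (l - h l))"
      using Ioc1[OF le] Ioc2[OF le] o[OF S1 pt1] o[OF S2 pt2] by (simp add: em box_real)
    also have "\<dots> = ennreal (u - l)"
      using mono[OF le] contr[OF le] by (simp add: ennreal_plus[symmetric] del: ennreal_plus)
    finally show "emeasure N (box l u) = (\<Prod>b\<in>Basis. (u - l) \<bullet> b)" by simp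
  qed simp
  then have em': "emeasure M1 A \<le> emeasure lborel A" if "A \<in> sets borel" for A
    using em[OF that] by simp
  have "absolutely_continuous lborel M1"
    unfolding absolutely_continuous_def
  proof
    fix A :: "real set" assume A: "A \<in> null_sets lborel"
    then have "A \<in> sets borel" "emeasure lborel A = 0" by auto
    with em'[of A] show "A \<in> null_sets M1" by (intro null_setsI) auto
  qed
  then obtain f where f[measurable]: "f \<in> borel_measurable lborel" and M1: "density lborel f = M1"
    using sigma_finite_measure.Radon_Nikodym[OF sigma_finite_lborel, of M1] by auto
  have nn: "(\<integral>\<^sup>+t\<in>{a<..b}. f t \<partial>lborel) = ennreal (h b - h a)" if "a \<le> b" for a b
    using Ioc1[OF that] unfolding M1[symmetric] by (simp add: emeasure_density)
  have "AE x in lborel. f x * indicator {-real n<..real n} x \<noteq> \<infinity>" for n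
    using nn[of "-real n" "real n"] by (intro nn_integral_PInf_AE) auto
  then have "AE x in lborel. \<forall>n. f x * indicator {-real n<..real n} x \<noteq> \<infinity>" by (simp add: AE_all_countable)
  then have finf: "AE x in lborel. f x \<noteq> \<infinity>"
  proof eventually_elim
    case (elim x)
    obtain n :: nat where "\<bar>x\<bar> < real n" using reals_Archimedean2 by blast
    then have "indicator {-real n<..real n} x = (1 :: ennreal)" by (auto simp: indicator_def)
    then show ?case using elim[rule_format, of n] by simp
  qed
  \<comment> \<open>\<open>enn2real\<close> sends infinity to 0; by \<open>finf\<close> this changes
    the density only on a null set.\<close>
  define \<rho> where "\<rho> x = enn2real (f x)" for x
  have [measurable]: "\<rho> \<in> borel_measurable borel" unfolding \<rho>_def by measurable
  have nn\<rho>: "(\<integral>\<^sup>+t. ennreal (indicator {a..b} t * \<rho> t) \<partial>lborel) = ennreal (h b - h a)" if "a \<le> b" for a b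
  proof -
    have "AE t in lborel. t \<noteq> a" by (simp add: AE_lborel_singleton)
    then have "(\<integral>\<^sup>+t. ennreal (indicator {a..b} t * \<rho> t) \<partial>lborel) = (\<integral>\<^sup>+t\<in>{a<..b}. f t \<partial>lborel)"
      using finf by (intro nn_integral_cong_AE, eventually_elim) (auto simp: indicator_def \<rho>_def less_top)
    then show ?thesis using nn[OF that] by simp
  qed
  have hb: "has_bochner_integral lborel (\<lambda>t. indicator {a..b} t *\<^sub>R \<rho> t) (h b - h a)" if "a \<le> b" for a b
    by (rule has_bochner_integral_nn_integral) (use nn\<rho>[OF that] mono[OF that] in \<open>auto simp: \<rho>_def indicator_def\<close>)
  have int: "set_integrable lborel {a..b} \<rho>" for a b
    using hb[of a b] by (cases "a \<le> b") (auto simp: set_integrable_def has_bochner_integral_iff)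
  have "AE x in lborel. vanishes_in_mean_at (\<lambda>t. \<rho> t - \<rho> x) x"
  proof (rule AE_lebesgue_point)
    show "set_integrable lborel {-a<..<a} \<rho>" for a
      by (rule set_integrable_subset[OF int[of "-a" a]]) auto
  qed measurable
  then show ?thesis
  proof eventually_elim
    case (elim x)
    have "(h has_real_derivative \<rho> x) (at x)"
      by (rule indefinite_integral_has_derivative[OF _ int _ elim])
         (use hb in \<open>auto simp: has_bochner_integral_iff set_lebesgue_integral_def\<close>)
    then show ?case by blast
  qed
qed

text \<open>An affine change turns slopes in \<open>[-c, c]\<close> into slopes in
  \<open>[0, 1]\<close>, the case of a nondecreasing contraction.\<close>

lemma AE_differentiable_lipschitz:
  fixes g :: "real \<Rightarrow> real"
  assumes "K-lipschitz_on UNIV g"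
  shows "AE x in lborel. \<exists>D. (g has_real_derivative D) (at x)"
proof -
  \<comment> \<open>The summand 1 allows division by \<open>c\<close> also for
    \<open>K = 0\<close>.\<close>
  define c where "c = K + 1"
  have c: "c > 0" using lipschitz_on_nonneg[OF assms] by (simp add: c_def)
  have lip: "\<bar>g b - g a\<bar> \<le> c * (b - a)" if "a \<le> b" for a b
  proof -
    have "\<bar>g b - g a\<bar> \<le> K * (b - a)"
      using lipschitz_onD[OF assms, of b a] that by (simp add: dist_real_def)
    also have "\<dots> \<le> c * (b - a)" using that by (simp add: c_def mult_right_mono)
    finally show ?thesis .
  qed
  define h where "h x = (g x + c * x) / (2 * c)" for x
  have "AE x in lborel. \<exists>D. (h has_real_derivative D) (at x)"
  proof (rule AE_differentiable_mono_contraction)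
    fix a b :: real assume ab: "a \<le> b"
    show "h a \<le> h b" "h b - h a \<le> b - a"
    proof -
      have 1: "g a - g b \<le> c * (b - a)" "g b - g a \<le> c * (b - a)" using lip[OF ab] by linarith+
      have "(g a + c * a) / (2 * c) \<le> (g b + c * b) / (2 * c)"
        using 1 c by (intro divide_right_mono) (simp_all add: algebra_simps)
      then show "h a \<le> h b" by (simp add: h_def)
      have "h b - h a = ((g b - g a) + c * (b - a)) / (2 * c)" using c by (simp add: h_def field_simps)
      also have "\<dots> \<le> (2 * c * (b - a)) / (2 * c)" using 1 c by (intro divide_right_mono) simp_all
      also have "\<dots> = b - a" using c by simp
      finally show "h b - h a \<le> b - a" .
    qed
  qed
  then show ?thesis
  proof eventually_elim
    case (elim x)
    then obtain D where "(h has_real_derivative D) (at x)" by blast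
    then have "((\<lambda>x. 2 * c * h x - c * x) has_real_derivative 2 * c * D - c * 1) (at x)"
      by (auto intro!: derivative_eq_intros)
    moreover have "(\<lambda>x. 2 * c * h x - c * x) = g" using c by (auto simp: h_def)
    ultimately show ?case by auto
  qed
qed

text \<open>A bound in \<open>L\<^sup>p\<close> with \<open>p > 1\<close> forces uniform
  integrability on a finite measure space. The difference is split at a height \<open>K\<close>: the
  part below it converges to 0 boundedly, and what lies above is at most
  \<open>K powr (1 - p)\<close> times the \<open>p\<close>-th power.\<close>

lemma (in finite_measure) tendsto_integral_of_bounded_powr:
  fixes a :: "nat \<Rightarrow> 'a \<Rightarrow> complex"
  assumes [measurable]: "\<And>n. a n \<in> borel_measurable M" "b \<in> borel_measurable M"
    and lim: "AE x in M. (\<lambda>n. a n x) \<longlonglongrightarrow> b x" and p: "1 < p"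
    and bd: "\<And>n. (\<integral>\<^sup>+x. ennreal (norm (a n x) powr p) \<partial>M) \<le> ennreal C"
  shows "integrable M b" "integrable M (a n)" "(\<lambda>n. \<integral>x. a n x \<partial>M) \<longlonglongrightarrow> (\<integral>x. b x \<partial>M)"
proof -
  have bdb: "(\<integral>\<^sup>+x. ennreal (norm (b x) powr p) \<partial>M) \<le> ennreal C"
  proof (rule nn_integral_le_of_AE_tendsto[OF _ _ bd tendsto_const])
    show "AE x in M. (\<lambda>n. ennreal (norm (a n x) powr p)) \<longlonglongrightarrow> ennreal (norm (b x) powr p)"
      using lim by eventually_elim (use p in \<open>auto intro!: tendsto_ennrealI tendsto_powr' tendsto_norm tendsto_const\<close>)
  qed measurable
  have le: "u \<le> 1 + u powr p" if "0 \<le> u" for u :: real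
  proof (cases "u \<le> 1")
    case False
    then have "u powr 1 \<le> u powr p" using p by (intro powr_mono) auto
    then show ?thesis using False by simp
  qed (simp add: add_increasing2)
  have intg: "integrable M u" if [measurable]: "u \<in> borel_measurable M"
     and bu: "(\<integral>\<^sup>+x. ennreal (norm (u x) powr p) \<partial>M) \<le> ennreal C" for u :: "'a \<Rightarrow> complex"
  proof -
    have "integrable M (\<lambda>x. norm (u x) powr p)"
      unfolding integrable_iff_bounded using bu by (auto intro: le_less_trans)
    then have "integrable M (\<lambda>x. 1 + norm (u x) powr p)" by simp
    then show ?thesis by (rule Bochner_Integration.integrable_bound) (use le[of "norm _"] in auto)
  qed
  show ib: "integrable M b" by (rule intg[OF _ bdb]) measurable
  show ia: "integrable M (a n)" for n by (rule intg[OF _ bd]) measurable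
  define d where "d n x = norm (a n x - b x)" for n x
  have [measurable]: "d n \<in> borel_measurable M" for n unfolding d_def by measurable
  have "(\<lambda>n. \<integral>\<^sup>+x. ennreal (d n x) \<partial>M) \<longlonglongrightarrow> 0"
  proof (rule order_tendstoI)
    fix e' :: ennreal assume "0 < e'"
    then obtain z where z: "0 < z" "z < e'" using dense by blast
    define e where "e = enn2real z"
    have "z < top" using z(2) by (rule order.strict_trans2) simp
    then have e: "e > 0" "ennreal e < e'" using z by (simp_all add: e_def enn2real_positive_iff)
    define D where "D = 2 powr p * (2 * \<bar>C\<bar>) + 1"
    have D: "D > 0" by (simp add: D_def add_nonneg_pos)
    \<comment> \<open>Solves \<open>K powr (1 - p) * D = e / 2\<close>, where \<open>D\<close>
      exceeds the bound for the integral of \<open>d n x powr p\<close>; the summand 1 in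
      \<open>D\<close> makes it positive.\<close>
    define K where "K = (2 * D / e) powr (1 / (p - 1))"
    have K: "K > 0" using D e by (simp add: K_def)
    have Kp: "K powr (1 - p) * D = e / 2"
    proof -
      have "1 / (p - 1) * (1 - p) = -1" using p by (simp add: field_simps)
      then have "K powr (1 - p) = (2 * D / e) powr (-1)" unfolding K_def powr_powr by simp
      also have "\<dots> = e / (2 * D)" using D e by (simp add: powr_minus)
      finally show ?thesis using D by simp
    qed
    \<comment> \<open>Above the height \<open>K\<close> one has
      \<open>u = u powr p * u powr (1 - p)\<close>, and the second factor decreases in
      \<open>u\<close>.\<close>
    have pw: "u \<le> min u K + u powr p * K powr (1 - p)" if "0 \<le> u" for u
    proof (cases "u \<le> K")
      case False
      have "u = u powr p * u powr (1 - p)" using False K by (simp flip: powr_add)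
      also have "\<dots> \<le> u powr p * K powr (1 - p)" using False K p by (intro mult_left_mono powr_mono2') auto
      finally show ?thesis using K False by (simp add: min_def)
    qed (use K in simp)
    have dp: "d n x powr p \<le> 2 powr p * (norm (a n x) powr p + norm (b x) powr p)" for n x
    proof -
      have "d n x \<le> 2 * max (norm (a n x)) (norm (b x))"
        unfolding d_def using norm_triangle_ineq4[of "a n x" "b x"] by linarith
      then have "d n x powr p \<le> (2 * max (norm (a n x)) (norm (b x))) powr p"
        using p by (intro powr_mono2) (auto simp: d_def)
      also have "\<dots> = 2 powr p * (max (norm (a n x)) (norm (b x)) powr p)" by (simp add: powr_mult)
      also have "max (norm (a n x)) (norm (b x)) powr p \<le> norm (a n x) powr p + norm (b x) powr p"
        by (simp add: max_def add_increasing add_increasing2)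
      finally show ?thesis by simp
    qed
    have dI: "(\<integral>\<^sup>+x. ennreal (d n x powr p * K powr (1 - p)) \<partial>M) \<le> ennreal (e / 2)" for n
    proof -
      have "(\<integral>\<^sup>+x. ennreal (d n x powr p * K powr (1 - p)) \<partial>M) \<le>
        (\<integral>\<^sup>+x. ennreal (2 powr p * K powr (1 - p)) * (ennreal (norm (a n x) powr p) + ennreal (norm (b x) powr p)) \<partial>M)"
      proof (rule nn_integral_mono)
        fix x
        have "d n x powr p * K powr (1 - p) \<le> 2 powr p * (norm (a n x) powr p + norm (b x) powr p) * K powr (1 - p)"
          by (intro mult_right_mono dp) simp
        then show "ennreal (d n x powr p * K powr (1 - p)) \<le> ennreal (2 powr p * K powr (1 - p)) * (ennreal (norm (a n x) powr p) + ennreal (norm (b x) powr p))"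
          by (simp add: ennreal_plus[symmetric] ennreal_mult[symmetric] mult_ac ennreal_leI del: ennreal_plus)
      qed
      also have "\<dots> = ennreal (2 powr p * K powr (1 - p)) * ((\<integral>\<^sup>+x. ennreal (norm (a n x) powr p) \<partial>M) + (\<integral>\<^sup>+x. ennreal (norm (b x) powr p) \<partial>M))"
        by (simp add: nn_integral_cmult nn_integral_add)
      also have "\<dots> \<le> ennreal (2 powr p * K powr (1 - p)) * (ennreal \<bar>C\<bar> + ennreal \<bar>C\<bar>)"
        by (intro mult_left_mono add_mono order.trans[OF bd] order.trans[OF bdb] ennreal_leI) auto
      also have "\<dots> = ennreal (K powr (1 - p) * (D - 1))"
        by (simp add: ennreal_plus[symmetric] ennreal_mult[symmetric] D_def mult_ac del: ennreal_plus)
      also have "\<dots> \<le> ennreal (K powr (1 - p) * D)" by (intro ennreal_leI mult_left_mono) auto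
      finally show ?thesis by (simp add: Kp)
    qed
    have "(\<lambda>n. \<integral>\<^sup>+x. ennreal (min (d n x) K) \<partial>M) \<longlonglongrightarrow> (\<integral>\<^sup>+x. 0 \<partial>M)"
    proof (rule nn_integral_dominated_convergence[where w="\<lambda>_. ennreal K"])
      show "AE x in M. (\<lambda>n. ennreal (min (d n x) K)) \<longlonglongrightarrow> 0"
        using lim
      proof eventually_elim
        case (elim x)
        have "(\<lambda>n. d n x) \<longlonglongrightarrow> 0" unfolding d_def using elim by (simp add: tendsto_norm_zero_iff LIM_zero_iff)
        then have "(\<lambda>n. min (d n x) K) \<longlonglongrightarrow> min 0 K" by (intro tendsto_min tendsto_const)
        then show ?case using K by (auto intro: tendsto_ennrealI simp flip: ennreal_0)
      qed
      show "(\<integral>\<^sup>+x. ennreal K \<partial>M) < \<infinity>" by (simp add: ennreal_mult_less_top less_top[symmetric] ennreal_mult_eq_top_iff)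
    qed (auto intro!: ennreal_leI)
    then have "eventually (\<lambda>n. (\<integral>\<^sup>+x. ennreal (min (d n x) K) \<partial>M) < ennreal (e / 2)) sequentially"
      using e by (intro order_tendstoD(2)) auto
    then show "eventually (\<lambda>n. (\<integral>\<^sup>+x. ennreal (d n x) \<partial>M) < e') sequentially"
    proof eventually_elim
      case (elim n)
      have "(\<integral>\<^sup>+x. ennreal (d n x) \<partial>M) \<le> (\<integral>\<^sup>+x. ennreal (min (d n x) K) + ennreal (d n x powr p * K powr (1 - p)) \<partial>M)"
        using pw[of "d n _"] K by (intro nn_integral_mono) (auto simp: d_def ennreal_plus[symmetric] simp del: ennreal_plus intro!: ennreal_leI)
      also have "\<dots> = (\<integral>\<^sup>+x. ennreal (min (d n x) K) \<partial>M) + (\<integral>\<^sup>+x. ennreal (d n x powr p * K powr (1 - p)) \<partial>M)"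
        by (rule nn_integral_add) measurable
      also have "\<dots> \<le> ennreal (e / 2) + ennreal (e / 2)" by (intro add_mono less_imp_le[OF elim] dI)
      also have "\<dots> = ennreal e" using e by (simp add: ennreal_plus[symmetric] del: ennreal_plus)
      finally show ?case using e by simp
    qed
  qed simp
  then show "(\<lambda>n. \<integral>x. a n x \<partial>M) \<longlonglongrightarrow> (\<integral>x. b x \<partial>M)"
    unfolding d_def by (intro tendsto_L1_int[OF ia ib])
qed

section \<open>Poisson formula in the upper half-plane\<close>

lemma upper_half_plane_iff [simp]: "z \<in> upper_half_plane \<longleftrightarrow> Im z > 0"
  by (simp add: upper_half_plane_def)

lemma open_upper_half_plane [simp]: "open upper_half_plane"
  unfolding upper_half_plane_def by (rule open_halfspace_Im_gt)

lemma convex_upper_half_plane [simp]: "convex upper_half_plane"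
  unfolding upper_half_plane_def by (rule convex_halfspace_Im_gt)

section \<open>Holomorphic functions on horizontal lines: Cauchy's theorem and the Poisson
  formula\<close>

lemma continuous_on_horizontal_line:
  assumes "f holomorphic_on {z. Im z > b}" "b < c"
  shows "continuous_on A (\<lambda>t. f (Complex t c))"
proof -
  have "continuous_on A (f \<circ> (\<lambda>t. Complex t c))"
    using assms by (intro continuous_on_compose continuous_intros
        continuous_on_subset[OF holomorphic_on_imp_continuous_on[OF assms(1)]]) auto
  then show ?thesis by (simp add: o_def)
qed

lemma borel_measurable_horizontal_line:
  assumes "f holomorphic_on {z. Im z > b}" "b < c"
  shows "(\<lambda>t. f (Complex t c)) \<in> borel_measurable borel"
  by (rule borel_measurable_continuous_onI[OF continuous_on_horizontal_line[OF assms]])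

lemma has_vector_derivative_horizontal_line:
  assumes "(f has_field_derivative f') (at (Complex t c))"
  shows "((\<lambda>t. f (Complex t c)) has_vector_derivative f') (at t)"
proof -
  have "((\<lambda>t. Complex t c) has_vector_derivative 1) (at t)"
    unfolding Complex_eq by (auto intro!: derivative_eq_intros)
  from field_vector_diff_chain_at[OF this assms] show ?thesis by (simp add: o_def)
qed

lemma has_vector_derivative_vertical_line:
  assumes "(f has_field_derivative f') (at (Complex x t))"
  shows "((\<lambda>t. f (Complex x t)) has_vector_derivative \<i> * f') (at t)"
proof -
  have "((\<lambda>t. Complex x t) has_vector_derivative \<i>) (at t)"
    unfolding Complex_eq by (auto intro!: derivative_eq_intros)
  from field_vector_diff_chain_at[OF this assms] show ?thesis by (simp add: o_def)
qed

lemma integral_real_line_eq_limit: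
  fixes f F :: "real \<Rightarrow> complex"
  assumes F: "\<And>x. (F has_vector_derivative f x) (at x)" and cont: "continuous_on UNIV f"
    and int: "integrable lborel f" and lim: "(\<lambda>n. F (real n) - F (- real n)) \<longlonglongrightarrow> L"
  shows "(\<integral>x. f x \<partial>lborel) = L"
proof -
  have "(\<lambda>n. \<integral>x. indicator {-real n..real n} x *\<^sub>R f x \<partial>lborel) \<longlonglongrightarrow> (\<integral>x. f x \<partial>lborel)"
  proof (rule integral_dominated_convergence[where w="\<lambda>x. norm (f x)"])
    show "AE x in lborel. (\<lambda>n. indicator {-real n..real n} x *\<^sub>R f x) \<longlonglongrightarrow> f x"
    proof (rule AE_I2)
      fix x :: real
      obtain N :: nat where N: "\<bar>x\<bar> < real N" using reals_Archimedean2 by blast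
      have "eventually (\<lambda>n. indicator {-real n..real n} x *\<^sub>R f x = f x) sequentially"
        using eventually_ge_at_top[of N] by (rule eventually_mono) (use N in \<open>auto simp: indicator_def abs_less_iff\<close>)
      then show "(\<lambda>n. indicator {-real n..real n} x *\<^sub>R f x) \<longlonglongrightarrow> f x" by (rule tendsto_eventually)
    qed
  qed (use int in \<open>auto simp: indicator_def\<close>)
  moreover have "(\<integral>x. indicator {-real n..real n} x *\<^sub>R f x \<partial>lborel) = F (real n) - F (- real n)" for n
    by (rule integral_FTC_Icc) (auto intro: has_vector_derivative_at_within F continuous_on_subset[OF cont])
  ultimately show ?thesis using lim LIMSEQ_unique by simp
qed

text \<open>Cauchy's theorem for the rectangle of width \<open>2 * X\<close> and height
  \<open>X\<close> standing on the line, expressed through a primitive \<open>P\<close>. The other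
  three sides have total length \<open>4 * X\<close> and the integrand is at most
  \<open>C / X\<^sup>2\<close> there, so the integral over the bottom side is
  \<open>O(1 / X)\<close>.\<close>

lemma horizontal_integral_eq_zero:
  assumes hol: "K holomorphic_on {z. Im z > b}" and bc: "b < c" and c: "0 < c"
    and bd: "\<And>z. Im z \<ge> c \<Longrightarrow> norm z \<ge> R \<Longrightarrow> norm (K z) \<le> C / (norm z)\<^sup>2"
  shows "has_bochner_integral lborel (\<lambda>t. K (Complex t c)) 0"
proof -
  let ?S = "{z. Im z > b}"
  have opS: "open ?S" and cvS: "convex ?S" by (simp_all add: open_halfspace_Im_gt convex_halfspace_Im_gt)
  obtain P where P: "\<And>z. z \<in> ?S \<Longrightarrow> (P has_field_derivative K z) (at z within ?S)"
    using holomorphic_convex_primitive'[OF cvS opS hol] by blast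
  have P': "(P has_field_derivative K z) (at z)" if "Im z \<ge> c" for z
    using P[of z] that bc opS by (simp add: at_within_open[OF _ opS])
  define R' where "R' = max R 1"
  have contK: "continuous_on A (\<lambda>t. K (Complex t c))" for A
    by (rule continuous_on_horizontal_line[OF hol bc])
  have meas[measurable]: "(\<lambda>t. K (Complex t c)) \<in> borel_measurable borel"
    by (rule borel_measurable_horizontal_line[OF hol bc])
  have "compact ((\<lambda>t. K (Complex t c)) ` {-R'..R'})"
    by (intro compact_continuous_image contK) auto
  then obtain B where B: "\<And>t. t \<in> {-R'..R'} \<Longrightarrow> norm (K (Complex t c)) \<le> B"
    using compact_imp_bounded bounded_iff by (metis imageI)
  have C0: "C \<ge> 0"
  proof -
    have "0 \<le> C / (norm (Complex R' c))\<^sup>2"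
      using bd[of "Complex R' c"] abs_Re_le_cmod[of "Complex R' c"]
      by (intro order_trans[OF norm_ge_zero]) (auto simp: R'_def)
    moreover have "norm (Complex R' c) > 0" using c by (simp add: complex_eq_iff)
    ultimately show ?thesis by (simp add: zero_le_divide_iff)
  qed
  \<comment> \<open>A multiple of \<open>1 / (1 + t\<^sup>2)\<close> dominates: for
    \<open>\<bar>t\<bar> \<le> R'\<close> by compactness, beyond by the decay hypothesis and
    \<open>1 + t\<^sup>2 \<le> 2 * t\<^sup>2\<close>.\<close>
  have int: "integrable lborel (\<lambda>t. K (Complex t c))"
  proof (rule Bochner_Integration.integrable_bound)
    show "integrable lborel (\<lambda>t. (2 * C + \<bar>B\<bar> * (1 + R'\<^sup>2)) * (1 / (1 + t\<^sup>2)))"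
      using has_bochner_integral_inverse_1_plus_square by (intro integrable_mult_right) (simp add: has_bochner_integral_iff)
    show "AE t in lborel. norm (K (Complex t c)) \<le> norm ((2 * C + \<bar>B\<bar> * (1 + R'\<^sup>2)) * (1 / (1 + t\<^sup>2)))"
    proof (rule AE_I2)
      fix t :: real
      have pos: "1 + t\<^sup>2 > 0" by (simp add: add_pos_nonneg)
      have "norm (K (Complex t c)) * (1 + t\<^sup>2) \<le> 2 * C + \<bar>B\<bar> * (1 + R'\<^sup>2)"
      proof (cases "\<bar>t\<bar> \<le> R'")
        case True
        then have "t\<^sup>2 \<le> R'\<^sup>2" using power_mono[of "\<bar>t\<bar>" R' 2] by simp
        moreover have "norm (K (Complex t c)) \<le> \<bar>B\<bar>"
        proof -
          have "t \<in> {-R'..R'}" using True by (auto simp: abs_le_iff)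
          from B[OF this] show ?thesis by linarith
        qed
        ultimately have "norm (K (Complex t c)) * (1 + t\<^sup>2) \<le> \<bar>B\<bar> * (1 + R'\<^sup>2)"
          by (intro mult_mono) auto
        then show ?thesis using C0 by simp
      next
        case False
        have n: "norm (Complex t c) \<ge> \<bar>t\<bar>" using abs_Re_le_cmod[of "Complex t c"] by simp
        have t1: "1 \<le> t\<^sup>2" using False power_mono[of 1 "\<bar>t\<bar>" 2] by (simp add: R'_def)
        have "norm (K (Complex t c)) \<le> C / (norm (Complex t c))\<^sup>2"
          using n False by (intro bd) (auto simp: R'_def)
        also have "\<dots> \<le> C / t\<^sup>2"
        proof (intro divide_left_mono mult_pos_pos C0)
          show le: "t\<^sup>2 \<le> (norm (Complex t c))\<^sup>2" using power_mono[OF n, of 2] by simp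
          show "0 < t\<^sup>2" using t1 by linarith
          with le show "0 < (norm (Complex t c))\<^sup>2" by linarith
        qed
        finally have "norm (K (Complex t c)) * (1 + t\<^sup>2) \<le> C / t\<^sup>2 * (1 + t\<^sup>2)"
          by (intro mult_right_mono) auto
        also have "\<dots> \<le> C / t\<^sup>2 * (2 * t\<^sup>2)" using t1 C0 by (intro mult_left_mono) auto
        also have "\<dots> = 2 * C" using t1 by auto
        finally show ?thesis using C0 by (simp add: add_increasing2)
      qed
      then show "norm (K (Complex t c)) \<le> norm ((2 * C + \<bar>B\<bar> * (1 + R'\<^sup>2)) * (1 / (1 + t\<^sup>2)))"
        using pos by (simp add: field_simps abs_of_pos)
    qed
  qed simp
  have "(\<integral>t. K (Complex t c) \<partial>lborel) = 0"
  proof (rule integral_real_line_eq_limit[OF _ contK int])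
    show "((\<lambda>t. P (Complex t c)) has_vector_derivative K (Complex x c)) (at x)" for x
      by (intro has_vector_derivative_horizontal_line P') simp
    have bound: "norm (P (Complex X c) - P (Complex (-X) c)) \<le> 4 * C / X" if X: "X \<ge> R'" for X
    proof -
      have X1: "X \<ge> R" "X \<ge> 1" using X by (auto simp: R'_def)
      have KX: "norm (K z) \<le> C / X\<^sup>2" if z: "Im z \<ge> c" "norm z \<ge> X" for z
      proof -
        have "norm (K z) \<le> C / (norm z)\<^sup>2" using z X1 by (intro bd) auto
        also have "\<dots> \<le> C / X\<^sup>2"
          using z X1 C0 power_mono[of X "norm z" 2] by (intro divide_left_mono mult_pos_pos zero_less_power) auto
        finally show ?thesis .
      qed
      have side: "norm (P (Complex s c) - P (Complex s (c + X))) \<le> C / X\<^sup>2 * X" if s: "\<bar>s\<bar> = X" for s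
      proof -
        have "norm (P (Complex s c) - P (Complex s (c + X))) \<le> C / X\<^sup>2 * norm (Complex s c - Complex s (c + X))"
        proof (rule field_differentiable_bound)
          show "convex ({z. Re z = s} \<inter> {z. Im z \<ge> c})"
          proof -
            have "{z. Re z = s} = {z. Re z \<ge> s} \<inter> {z. Re z \<le> s}" by auto
            then show ?thesis
              by (simp only:) (intro convex_Int convex_halfspace_Im_ge convex_halfspace_Re_ge convex_halfspace_Re_le)
          qed
          fix z assume z: "z \<in> {z. Re z = s} \<inter> {z. Im z \<ge> c}"
          then show "(P has_field_derivative K z) (at z within {z. Re z = s} \<inter> {z. Im z \<ge> c})"
            by (intro has_field_derivative_at_within[OF P']) auto
          show "norm (K z) \<le> C / X\<^sup>2" using z s abs_Re_le_cmod[of z] by (intro KX) auto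
        qed (use X1 in auto)
        also have "norm (Complex s c - Complex s (c + X)) = X"
          using X1 by (simp add: cmod_def)
        finally show ?thesis .
      qed
      have top: "norm (P (Complex X (c + X)) - P (Complex (-X) (c + X))) \<le> C / X\<^sup>2 * (2 * X)"
      proof -
        have "norm (P (Complex X (c + X)) - P (Complex (-X) (c + X))) \<le> C / X\<^sup>2 * norm (Complex X (c + X) - Complex (-X) (c + X))"
        proof (rule field_differentiable_bound)
          show "convex {z. Im z \<ge> c + X}" by (rule convex_halfspace_Im_ge)
          fix z assume z: "z \<in> {z. Im z \<ge> c + X}"
          then show "(P has_field_derivative K z) (at z within {z. Im z \<ge> c + X})"
            using X1 by (intro has_field_derivative_at_within[OF P']) auto
          show "norm (K z) \<le> C / X\<^sup>2" using z X1 c abs_Im_le_cmod[of z] by (intro KX) auto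
        qed auto
        also have "norm (Complex X (c + X) - Complex (-X) (c + X)) = 2 * X"
          using X1 by (simp add: cmod_def real_sqrt_mult)
        finally show ?thesis .
      qed
      have "norm (P (Complex X c) - P (Complex (-X) c)) \<le>
         norm (P (Complex X c) - P (Complex X (c + X))) +
         norm (P (Complex X (c + X)) - P (Complex (-X) (c + X))) + 
         norm (P (Complex (-X) c) - P (Complex (-X) (c + X)))"
        by norm
      also have "\<dots> \<le> C / X\<^sup>2 * X + C / X\<^sup>2 * (2 * X) + C / X\<^sup>2 * X"
        using X1 by (intro add_mono side top) auto
      also have "\<dots> = 4 * C / X" using X1 by (simp add: power2_eq_square)
      finally show ?thesis .
    qed
    have "(\<lambda>n. P (Complex (real n) c) - P (Complex (- real n) c)) \<longlonglongrightarrow> 0"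
    proof (rule Lim_null_comparison)
      show "eventually (\<lambda>n. norm (P (Complex (real n) c) - P (Complex (- real n) c)) \<le> 4 * C / real n) sequentially"
        using eventually_ge_at_top[of "nat \<lceil>R'\<rceil>"] by eventually_elim (rule bound, linarith)
      show "(\<lambda>n. 4 * C / real n) \<longlonglongrightarrow> 0" by (rule lim_const_over_n)
    qed
    then show "(\<lambda>n. P (Complex (real n) c) - P (Complex (- real n) c)) \<longlonglongrightarrow> 0" .
  qed
  then show ?thesis using int by (simp add: has_bochner_integral_iff)
qed

text \<open>With \<open>w'\<close> the reflection of \<open>w\<close> in the line
  \<open>Im z = c\<close>, the quotient of \<open>B z - B w\<close> by
  \<open>(z - w) * (z - w')\<close> is holomorphic above the line and decays quadratically. On the
  line the denominator is \<open>(t - x)\<^sup>2 + y\<^sup>2\<close>, so the vanishing of its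
  integral is the Poisson formula.\<close>

lemma poisson_formula_bounded:
  assumes hol: "B holomorphic_on upper_half_plane" and c: "0 < c" and y: "0 < y"
    and bd: "\<And>z. Im z \<ge> c \<Longrightarrow> norm (B z) \<le> M"
  shows "has_bochner_integral lborel (\<lambda>t. (poisson x y t) *\<^sub>R B (Complex t c)) (pi *\<^sub>R B (Complex x (c + y)))"
proof -
  define w where "w = Complex x (c + y)"
  define w' where "w' = Complex x (c - y)"
  define q where "q z = (if z = w then deriv B w else (B z - B w) / (z - w))" for z
  \<comment> \<open>The half-plane \<open>Im z > b\<close> must lie in the domain of
    \<open>B\<close> and avoid the pole \<open>w'\<close>, whose height is
    \<open>c - y\<close>.\<close>
  define b where "b = max 0 (c - y)"
  have b: "b < c" "0 \<le> b" "c - y \<le> b" using c y by (auto simp: b_def)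
  have "q holomorphic_on upper_half_plane"
    unfolding q_def by (rule pole_lemma_open[OF hol]) simp
  then have "(\<lambda>z. q z / (z - w')) holomorphic_on {z. Im z > b}"
    using b by (intro holomorphic_intros) (auto elim!: holomorphic_on_subset simp: w'_def)
  moreover have "norm (q z / (z - w')) \<le> 8 * M / (norm z)\<^sup>2" if z: "Im z \<ge> c" "norm z \<ge> 2 * norm w + 1" for z
  proof -
    have "norm w' \<le> norm w"
      using c y by (auto simp: w_def w'_def cmod_def intro!: real_sqrt_le_mono power_mono abs_le_square_iff[THEN iffD1])
    then have 1: "norm (z - w) \<ge> norm z / 2" "norm (z - w') \<ge> norm z / 2"
      using z norm_triangle_ineq2[of z w] norm_triangle_ineq2[of z w'] by linarith+
    have z0: "norm z > 0" using z norm_ge_zero[of w] by linarith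
    have M0: "0 \<le> M" using bd[OF z(1)] norm_ge_zero order_trans by blast
    have "z \<noteq> w" using 1 z0 by auto
    have "norm (B z - B w) \<le> 2 * M" 
      using bd[OF z(1)] bd[of w] y norm_triangle_ineq4[of "B z" "B w"] by (simp add: w_def)
    then have "norm (q z / (z - w')) \<le> (2 * M) / (norm (z - w) * norm (z - w'))"
      using \<open>z \<noteq> w\<close> by (simp add: q_def norm_divide norm_mult divide_right_mono)
    also have "\<dots> \<le> (2 * M) / (norm z / 2 * (norm z / 2))"
      using 1 z0 M0 by (intro divide_left_mono mult_mono mult_pos_pos) auto
    also have "\<dots> = 8 * M / (norm z)\<^sup>2" by (simp add: power2_eq_square field_simps)
    finally show ?thesis .
  qed
  ultimately have 1: "has_bochner_integral lborel (\<lambda>t. q (Complex t c) / (Complex t c - w')) 0"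
    by (rule horizontal_integral_eq_zero[OF _ b(1) c])
  have eq: "q (Complex t c) / (Complex t c - w') = (B (Complex t c) - B w) /\<^sub>R ((t - x)\<^sup>2 + y\<^sup>2)" for t
  proof -
    have "Complex t c \<noteq> w" using y by (simp add: w_def)
    moreover have "(Complex t c - w) * (Complex t c - w') = of_real ((t - x)\<^sup>2 + y\<^sup>2)"
      by (simp add: w_def w'_def complex_eq_iff power2_eq_square algebra_simps)
    ultimately show ?thesis
      by (simp add: q_def scaleR_conv_of_real divide_inverse mult.assoc inverse_mult_distrib[symmetric] mult.commute
          flip: of_real_inverse del: of_real_add of_real_diff of_real_power inverse_mult_distrib)
  qed
  have 2: "has_bochner_integral lborel (\<lambda>t. y *\<^sub>R ((B (Complex t c) - B w) /\<^sub>R ((t - x)\<^sup>2 + y\<^sup>2))) (y *\<^sub>R 0)"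
    using 1 unfolding eq by (rule has_bochner_integral_scaleR_right)
  have 3: "has_bochner_integral lborel (\<lambda>t. (poisson x y t) *\<^sub>R B w) (pi *\<^sub>R B w)"
    by (rule has_bochner_integral_scaleR_left) (rule has_bochner_integral_poisson[OF y])
  from has_bochner_integral_add[OF 2 3]
  show ?thesis unfolding w_def[symmetric]
    by (rule has_bochner_integral_cong[THEN iffD1, rotated -1]) (auto simp: algebra_simps divide_inverse)
qed

lemma continuous_on_upper_horizontal:
  assumes "f holomorphic_on upper_half_plane" "0 < c"
  shows "continuous_on A (\<lambda>t. f (Complex t c))"
  using continuous_on_horizontal_line[of f 0 c] assms by (simp add: upper_half_plane_def)

lemma borel_measurable_upper_horizontal:
  assumes "f holomorphic_on upper_half_plane" "0 < c"
  shows "(\<lambda>t. f (Complex t c)) \<in> borel_measurable borel"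
  by (rule borel_measurable_continuous_onI[OF continuous_on_upper_horizontal[OF assms]])

lemma LIMSEQ_holomorphic_upper_vertical:
  assumes "f holomorphic_on upper_half_plane" "0 < y"
  shows "(\<lambda>n. f (Complex x (y + 1 / (1 + real n)))) \<longlonglongrightarrow> f (Complex x y)"
proof -
  have "(\<lambda>n. 1 / (1 + real n)) \<longlonglongrightarrow> 0" by real_asymp
  then have "(\<lambda>n. Complex x (y + 1 / (1 + real n))) \<longlonglongrightarrow> Complex x (y + 0)"
    by (intro tendsto_intros)
  moreover have "isCont f (Complex x (y + 0))"
    using assms holomorphic_on_imp_continuous_on[OF assms(1)]
    by (simp add: continuous_on_eq_continuous_at)
  ultimately show ?thesis using isCont_tendsto_compose[of "Complex x y" f] by simp
qed

text \<open>\<open>F / (1 + d * F)\<close> again has nonnegative real part and is bounded by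
  \<open>1 / d\<close>, so the Poisson formula holds for it; Fatou's lemma as \<open>d\<close> tends
  to 0 leaves an inequality. It can be strict, as \<open>- \<i> * z\<close> shows.\<close>

lemma poisson_positive_le:
  assumes hol: "F holomorphic_on upper_half_plane" and pos: "\<And>z. Im z > 0 \<Longrightarrow> Re (F z) \<ge> 0"
    and c: "0 < c" and y: "0 < y"
  shows "(\<integral>\<^sup>+t. ennreal (poisson x y t * Re (F (Complex t c))) \<partial>lborel) \<le> ennreal (pi * Re (F (Complex x (c + y))))"
proof -
  define d where "d n = 1 / (1 + real n)" for n
  have d: "d n > 0" for n by (simp add: d_def)
  have dlim: "d \<longlonglongrightarrow> 0" unfolding d_def by real_asymp
  define G where "G n z = F z / (1 + d n * F z)" for n z
  have re: "Re (1 + d n * F z) \<ge> 1" if "Im z > 0" for n z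
    using pos[OF that] d[of n] by simp
  then have nz: "1 + d n * F z \<noteq> 0" if "Im z > 0" for n z
    using that by (metis not_one_le_zero zero_complex.simps(1))
  have Ghol: "G n holomorphic_on upper_half_plane" for n
    unfolding G_def by (intro holomorphic_intros hol) (use nz in auto)
  have Gb: "norm (G n z) \<le> 1 / d n" if "Im z > 0" for n z
  proof -
    have "(norm (d n * F z))\<^sup>2 \<le> (norm (1 + d n * F z))\<^sup>2"
    proof -
      have "(d n * Re (F z))\<^sup>2 \<le> (1 + d n * Re (F z))\<^sup>2"
        using pos[OF that] d[of n] by (intro power_mono) auto
      then show ?thesis unfolding cmod_power2 by simp
    qed
    then have "norm (d n * F z) \<le> norm (1 + d n * F z)" by (rule power2_le_imp_le) simp
    then have "d n * norm (F z) \<le> norm (1 + d n * F z)" using d[of n] by (simp add: norm_mult)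
    then show ?thesis using d[of n] nz[OF that, of n]
      by (simp add: G_def norm_divide divide_le_eq field_simps)
  qed
  have Gpos: "Re (G n z) \<ge> 0" if "Im z > 0" for n z
  proof -
    have "0 \<le> Re (F z) * (1 + d n * Re (F z)) + Im (F z) * (d n * Im (F z))"
      
    proof -
      have "0 \<le> Im (F z) * (d n * Im (F z))" using d[of n] mult_nonneg_nonneg[of "d n" "Im (F z) * Im (F z)"] by (simp add: mult_ac)
      moreover have "0 \<le> Re (F z) * (1 + d n * Re (F z))" using pos[OF that] d[of n] by simp
      ultimately show ?thesis by simp
    qed
    then show ?thesis by (simp add: G_def Re_divide)
  qed
  have Glim: "(\<lambda>n. G n z) \<longlonglongrightarrow> F z" for z
  proof -
    have "(\<lambda>n. F z / (1 + of_real (d n) * F z)) \<longlonglongrightarrow> F z / (1 + of_real 0 * F z)"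
      by (intro tendsto_intros dlim) auto
    then show ?thesis by (simp add: G_def)
  qed
  have nn: "(\<integral>\<^sup>+t. ennreal (poisson x y t * Re (G n (Complex t c))) \<partial>lborel) = ennreal (pi * Re (G n (Complex x (c + y))))" for n
  proof -
    have "has_bochner_integral lborel (\<lambda>t. (poisson x y t) *\<^sub>R G n (Complex t c)) (pi *\<^sub>R G n (Complex x (c + y)))"
      by (rule poisson_formula_bounded[OF Ghol c y]) (use Gb c in force)
    from has_bochner_integral_Re[OF this] have "has_bochner_integral lborel (\<lambda>t. poisson x y t * Re (G n (Complex t c))) (pi * Re (G n (Complex x (c + y))))"
      by simp
    then show ?thesis 
      unfolding has_bochner_integral_iff using y c Gpos
      by (subst nn_integral_eq_integral) auto
  qed
  have [measurable]: "(\<lambda>t. F (Complex t c)) \<in> borel_measurable borel" "(\<lambda>t. G n (Complex t c)) \<in> borel_measurable borel" for n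
    by (intro borel_measurable_upper_horizontal hol Ghol c)+
  show ?thesis
  proof (rule nn_integral_le_of_AE_tendsto[OF _ _ eq_refl[OF nn]])
    show "AE t in lborel. (\<lambda>n. ennreal (poisson x y t * Re (G n (Complex t c)))) \<longlonglongrightarrow> ennreal (poisson x y t * Re (F (Complex t c)))"
      by (intro AE_I2 tendsto_ennrealI tendsto_mult tendsto_Re Glim tendsto_const)
    show "(\<lambda>n. ennreal (pi * Re (G n (Complex x (c + y))))) \<longlonglongrightarrow> ennreal (pi * Re (F (Complex x (c + y))))"
      by (intro tendsto_ennrealI tendsto_mult tendsto_Re Glim tendsto_const)
  qed measurable
qed

text \<open>Fatou's lemma once more, as the line descends to the real axis. The limit inferior is
  used because the existence of vertical limits is itself derived from this inequality.\<close>

lemma poisson_liminf_le: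
  assumes hol: "F holomorphic_on upper_half_plane" and pos: "\<And>z. Im z > 0 \<Longrightarrow> Re (F z) \<ge> 0"
    and y: "0 < y"
  shows "(\<integral>\<^sup>+t. ennreal (poisson x y t) * liminf (\<lambda>n. ennreal (Re (F (Complex t (1 / (1 + real n)))))) \<partial>lborel)
      \<le> ennreal (pi * Re (F (Complex x y)))"
proof -
  let ?c = "\<lambda>n. 1 / (1 + real n)"
  have [measurable]: "(\<lambda>t. F (Complex t (?c n))) \<in> borel_measurable borel" for n
    by (intro borel_measurable_upper_horizontal hol) simp
  define N where "N = density lborel (\<lambda>t. ennreal (poisson x y t))"
  have [measurable_cong, simp]: "sets N = sets borel" by (simp add: N_def)
  have "(\<integral>\<^sup>+t. ennreal (poisson x y t) * liminf (\<lambda>n. ennreal (Re (F (Complex t (?c n))))) \<partial>lborel)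
     = (\<integral>\<^sup>+t. liminf (\<lambda>n. ennreal (Re (F (Complex t (?c n))))) \<partial>N)"
    unfolding N_def by (rule nn_integral_density[symmetric]) measurable
  also have "\<dots> \<le> liminf (\<lambda>n. \<integral>\<^sup>+t. ennreal (Re (F (Complex t (?c n)))) \<partial>N)"
    by (rule nn_integral_liminf) measurable
  also have "\<dots> = liminf (\<lambda>n. \<integral>\<^sup>+t. ennreal (poisson x y t * Re (F (Complex t (?c n)))) \<partial>lborel)"
    unfolding N_def using y pos by (subst nn_integral_density) (simp_all add: ennreal_mult del: times_divide_eq_left)
  also have "\<dots> \<le> liminf (\<lambda>n. ennreal (pi * Re (F (Complex x (?c n + y)))))"
    by (intro Liminf_mono always_eventually allI poisson_positive_le[OF hol pos _ y]) auto
  also have "\<dots> = ennreal (pi * Re (F (Complex x y)))"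
    using LIMSEQ_holomorphic_upper_vertical[OF hol y, of x]
    by (intro lim_imp_Liminf tendsto_ennrealI tendsto_mult tendsto_Re tendsto_const) (auto simp: add.commute)
  finally show ?thesis .
qed

text \<open>If \<open>\<bar>Im \<Lambda>\<bar> \<le> \<theta> < pi / 2\<close>, then
  \<open>exp \<Lambda>\<close> has positive real part and \<open>exp (Re \<Lambda>)\<close> is at
  most \<open>Re (exp \<Lambda>) / cos \<theta>\<close>. For \<open>\<Lambda> = p * Ln F\<close>
  this controls the \<open>p\<close>-th power of \<open>\<bar>F\<bar>\<close>.\<close>

lemma nn_integral_exp_le:
  assumes hol: "\<Lambda> holomorphic_on upper_half_plane" and th: "\<theta> < pi / 2"
    and bd: "\<And>z. Im z > 0 \<Longrightarrow> \<bar>Im (\<Lambda> z)\<bar> \<le> \<theta>" and c: "0 < c" and y: "0 < y"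
  shows "(\<integral>\<^sup>+t. ennreal (poisson x y t * exp (Re (\<Lambda> (Complex t c)))) \<partial>lborel)
    \<le> ennreal (pi / cos \<theta> * exp (Re (\<Lambda> (Complex x (c + y)))))"
proof -
  have th0: "0 \<le> \<theta>" using bd[of \<i>] by simp
  have cth: "cos \<theta> > 0" using th th0 by (intro cos_gt_zero_pi) auto
  have cle: "cos \<theta> \<le> cos (Im (\<Lambda> z))" if "Im z > 0" for z
  proof -
    have "cos \<theta> \<le> cos \<bar>Im (\<Lambda> z)\<bar>" using bd[OF that] th th0 by (intro cos_monotone_0_pi_le) auto
    then show ?thesis by (simp add: abs_if split: if_splits)
  qed
  have 1: "(\<integral>\<^sup>+t. ennreal (poisson x y t * Re (exp (\<Lambda> (Complex t c)))) \<partial>lborel) \<le> ennreal (pi * Re (exp (\<Lambda> (Complex x (c + y)))))"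
  proof (rule poisson_positive_le[OF _ _ c y])
    show "(\<lambda>z. exp (\<Lambda> z)) holomorphic_on upper_half_plane" by (intro holomorphic_intros hol)
    show "Re (exp (\<Lambda> z)) \<ge> 0" if "Im z > 0" for z using cle[OF that] cth by (simp add: Re_exp)
  qed
  have [measurable]: "(\<lambda>t. \<Lambda> (Complex t c)) \<in> borel_measurable borel"
    by (intro borel_measurable_upper_horizontal hol c)
  have "ennreal (cos \<theta>) * (\<integral>\<^sup>+t. ennreal (poisson x y t * exp (Re (\<Lambda> (Complex t c)))) \<partial>lborel)
     = (\<integral>\<^sup>+t. ennreal (cos \<theta> * (poisson x y t * exp (Re (\<Lambda> (Complex t c))))) \<partial>lborel)"
    using cth y by (subst nn_integral_cmult[symmetric]) (simp_all add: ennreal_mult del: times_divide_eq_left times_divide_eq_right)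
  also have "\<dots> \<le> (\<integral>\<^sup>+t. ennreal (poisson x y t * Re (exp (\<Lambda> (Complex t c)))) \<partial>lborel)"
  proof (intro nn_integral_mono ennreal_leI)
    fix t
    have "(poisson x y t * exp (Re (\<Lambda> (Complex t c)))) * cos \<theta> \<le> 
      (poisson x y t * exp (Re (\<Lambda> (Complex t c)))) * cos (Im (\<Lambda> (Complex t c)))"
      using y c by (intro mult_left_mono cle mult_nonneg_nonneg divide_nonneg_nonneg) auto
    then show "cos \<theta> * (poisson x y t * exp (Re (\<Lambda> (Complex t c)))) \<le> poisson x y t * Re (exp (\<Lambda> (Complex t c)))"
      by (simp add: Re_exp mult_ac)
  qed
  also note 1
  also have "ennreal (pi * Re (exp (\<Lambda> (Complex x (c + y))))) \<le> ennreal (pi * exp (Re (\<Lambda> (Complex x (c + y)))))"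
    by (intro ennreal_leI mult_left_mono) (auto simp: Re_exp)
  finally have "ennreal (1 / cos \<theta>) * (ennreal (cos \<theta>) * (\<integral>\<^sup>+t. ennreal (poisson x y t * exp (Re (\<Lambda> (Complex t c)))) \<partial>lborel))
     \<le> ennreal (1 / cos \<theta>) * ennreal (pi * exp (Re (\<Lambda> (Complex x (c + y)))))"
    by (rule mult_left_mono) simp
  then show ?thesis using cth 
    by (simp add: mult.assoc[symmetric] ennreal_mult[symmetric])
qed

text \<open>An antiderivative of \<open>B\<close> is Lipschitz up to the real line, hence differentiable there almost
  everywhere; integrating the Poisson formula by parts recovers \<open>B\<close> from it.\<close>

lemma AE_vertical_limit_bounded:
  assumes hol: "B holomorphic_on upper_half_plane" and bd: "\<And>z. Im z > 0 \<Longrightarrow> norm (B z) \<le> M"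
  shows "AE x in lborel. \<exists>l. ((\<lambda>y. B (Complex x y)) \<longlongrightarrow> l) (at_right 0)"
proof -
  let ?H = upper_half_plane
  have M: "0 \<le> M" using order_trans[OF norm_ge_zero bd[of \<i>]] by simp
  obtain G where G: "\<And>z. z \<in> ?H \<Longrightarrow> (G has_field_derivative B z) (at z within ?H)"
    using holomorphic_convex_primitive'[OF convex_upper_half_plane open_upper_half_plane hol] by blast
  have "M-lipschitz_on ?H G"
  proof (rule lipschitz_onI[OF _ M])
    fix z w assume "z \<in> ?H" "w \<in> ?H"
    then show "dist (G z) (G w) \<le> M * dist z w"
      unfolding dist_norm by (intro field_differentiable_bound[OF convex_upper_half_plane G]) (auto intro: bd)
  qed
  then obtain G0 where lip: "M-lipschitz_on (closure ?H) G0" and G0: "\<And>z. z \<in> ?H \<Longrightarrow> G0 z = G z"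
    using lipschitz_extend_closure by blast
  have clH: "closure ?H = {z. Im z \<ge> 0}"
    using closure_halfspace_gt[of \<i> 0] by (simp add: upper_half_plane_def inner_complex_def)
  have lip': "norm (G0 z - G0 w) \<le> M * norm (z - w)" if "Im z \<ge> 0" "Im w \<ge> 0" for z w
    using lipschitz_onD[OF lip, of z w] that by (simp add: clH dist_norm)
  have G0': "(G0 has_field_derivative B z) (at z)" if "Im z > 0" for z
  proof -
    have "(G has_field_derivative B z) (at z)" using G[of z] that by (simp add: at_within_open[OF _ open_upper_half_plane])
    then show ?thesis
      by (rule has_field_derivative_transform_within_open[OF _ open_upper_half_plane]) (use that G0 in auto)
  qed
  define g where "g t = G0 (complex_of_real t)" for t
  have glip: "norm (g s - g t) \<le> M * \<bar>s - t\<bar>" for s t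
    using lip'[of "of_real s" "of_real t"] by (simp add: g_def flip: of_real_diff)
  have lip1: "M-lipschitz_on UNIV (\<lambda>t. Re (g t))"
    by (rule lipschitz_onI[OF _ M], rule order_trans[OF _ glip[unfolded real_norm_def[symmetric], folded dist_norm]])
       (metis abs_Re_le_cmod dist_norm minus_complex.simps(1) real_norm_def)
  have lip2: "M-lipschitz_on UNIV (\<lambda>t. Im (g t))"
    by (rule lipschitz_onI[OF _ M], rule order_trans[OF _ glip[unfolded real_norm_def[symmetric], folded dist_norm]])
       (metis abs_Im_le_cmod dist_norm minus_complex.simps(2) real_norm_def)
  from AE_differentiable_lipschitz[OF lip1] AE_differentiable_lipschitz[OF lip2]
  show ?thesis
  proof eventually_elim
    case (elim x)
    then obtain A1 A2 where A: "((\<lambda>t. Re (g t)) has_real_derivative A1) (at x)" "((\<lambda>t. Im (g t)) has_real_derivative A2) (at x)"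
      by blast
    define A where "A = Complex A1 A2"
    have gA: "(g has_vector_derivative A) (at x)"
      unfolding has_vector_derivative_complex_iff using A by (simp add: A_def)
    \<comment> \<open>The remainder of the first-order expansion of the antiderivative at
      \<open>x\<close>; its derivative \<open>B z - A\<close> is what has to tend to 0.\<close>
    define E where "E z = G0 z - g x - A * (z - of_real x)" for z
    define K where "K = M + norm A"
    have K: "K \<ge> 0" using M by (simp add: K_def)
    have E: "norm (E z) \<le> K * norm (z - of_real x)" if "Im z \<ge> 0" for z
    proof -
      have "norm (E z) \<le> norm (G0 z - g x) + norm (A * (z - of_real x))" unfolding E_def by (rule norm_triangle_ineq4)
      also have "\<dots> \<le> M * norm (z - of_real x) + norm A * norm (z - of_real x)"
        unfolding g_def using lip'[of z "of_real x"] that by (simp add: norm_mult)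
      finally show ?thesis by (simp add: K_def algebra_simps)
    qed
    have E': "(E has_field_derivative B z - A) (at z)" if "Im z > 0" for z
      unfolding E_def using G0'[OF that] by (auto intro!: derivative_eq_intros)
    \<comment> \<open>Minus the derivative in \<open>t\<close> of the Poisson kernel, produced by
      the integration by parts.\<close>
    define k where "k y t = 2 * y * (t - x) / ((t - x)\<^sup>2 + y\<^sup>2)\<^sup>2" for y t :: real
    define p where "p y t = poisson x y t" for y t :: real
    have den: "(t - x)\<^sup>2 + y\<^sup>2 > 0" if "y > 0" for t y :: real using that by (simp add: add_nonneg_pos)
    have pder: "(p y has_real_derivative - k y t) (at t)" if "y > 0" for y t
      unfolding p_def k_def using den[OF that, of t] 
      by (auto intro!: derivative_eq_intros simp: power2_eq_square)
    have kcont: "continuous_on UNIV (k y)" if "y > 0" for y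
    proof -
      have "(t - x)\<^sup>2 + y\<^sup>2 \<noteq> 0" for t using den[OF that, of t] by linarith
      then show ?thesis unfolding k_def by (intro continuous_intros) auto
    qed
    have pcont: "continuous_on UNIV (p y)" if "y > 0" for y
    proof -
      have "(t - x)\<^sup>2 + y\<^sup>2 \<noteq> 0" for t using den[OF that, of t] by linarith
      then show ?thesis unfolding p_def by (intro continuous_intros) auto
    qed
    \<comment> \<open>A factor \<open>\<bar>t - x\<bar>\<close> turns the differentiated kernel back
      into a Poisson kernel. \<open>E\<close> supplies this factor on the real line, with the
      relative error left over.\<close>
    have k2: "\<bar>k y t\<bar> * \<bar>t - x\<bar> \<le> 2 * p y t" if "y > 0" for y t
    proof -
      have "\<bar>k y t\<bar> * \<bar>t - x\<bar> = 2 * y * (t - x)\<^sup>2 / ((t - x)\<^sup>2 + y\<^sup>2)\<^sup>2"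
        using that by (simp add: k_def abs_mult power2_eq_square)
      also have "\<dots> \<le> 2 * y * ((t - x)\<^sup>2 + y\<^sup>2) / ((t - x)\<^sup>2 + y\<^sup>2)\<^sup>2"
        using that by (intro divide_right_mono mult_left_mono) auto
      also have "\<dots> = 2 * p y t" using den[OF that, of t] by (simp add: p_def power2_eq_square)
      finally show ?thesis .
    qed
    have k1: "\<bar>k y t\<bar> \<le> p y t / y" if "y > 0" for y t
    proof -
      have "2 * \<bar>t - x\<bar> * y \<le> (t - x)\<^sup>2 + y\<^sup>2"
        using zero_le_power2[of "\<bar>t - x\<bar> - y"] by (simp add: power2_eq_square algebra_simps) 
      then have "\<bar>k y t\<bar> \<le> ((t - x)\<^sup>2 + y\<^sup>2) / ((t - x)\<^sup>2 + y\<^sup>2)\<^sup>2"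
      proof -
        assume le: "2 * \<bar>t - x\<bar> * y \<le> (t - x)\<^sup>2 + y\<^sup>2"
        have "\<bar>2 * y * (t - x)\<bar> = 2 * \<bar>t - x\<bar> * y" unfolding abs_mult using that by simp
        then have "\<bar>k y t\<bar> = 2 * \<bar>t - x\<bar> * y / ((t - x)\<^sup>2 + y\<^sup>2)\<^sup>2" by (simp add: k_def)
        with le show ?thesis by (simp add: divide_right_mono)
      qed
      also have "\<dots> = p y t / y" using den[OF that, of t] that by (simp add: p_def power2_eq_square)
      finally show ?thesis .
    qed
    have pint: "integrable lborel (p y)" if "y > 0" for y
      using has_bochner_integral_poisson[OF that, of x] by (simp add: p_def[abs_def] has_bochner_integral_iff)
    have Econt: "continuous_on UNIV (\<lambda>t. E (Complex t c))" if "c > 0" for c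
      using that by (intro continuous_at_imp_continuous_on ballI has_vector_derivative_continuous[OF has_vector_derivative_horizontal_line[OF E']]) simp
    \<comment> \<open>A majorant independent of the height \<open>c\<close>, so that
      \<open>c\<close> can tend to 0 by dominated convergence.\<close>
    have kE: "norm (k y t *\<^sub>R E (Complex t c)) \<le> (2 * K + K) * p y t" if "y > 0" "0 < c" "c \<le> y" for y c t
    proof -
      have "norm (E (Complex t c)) \<le> K * norm (Complex t c - of_real x)" using that by (intro E) auto
      also have "norm (Complex t c - of_real x) \<le> \<bar>t - x\<bar> + c"
        using cmod_le[of "Complex t c - of_real x"] that by simp
      finally have e: "norm (E (Complex t c)) \<le> K * (\<bar>t - x\<bar> + c)" using K by (simp add: mult_left_mono)
      have "\<bar>k y t\<bar> * norm (E (Complex t c)) \<le> \<bar>k y t\<bar> * (K * (\<bar>t - x\<bar> + c))"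
        by (intro mult_left_mono e) auto
      also have "\<dots> = K * (\<bar>k y t\<bar> * \<bar>t - x\<bar>) + K * (\<bar>k y t\<bar> * c)" by (simp add: algebra_simps)
      also have "\<dots> \<le> K * (2 * p y t) + K * (p y t / y * y)"
        using that K by (intro add_mono mult_left_mono mult_mono k1 k2) (auto simp: p_def)
      also have "\<dots> = (2 * K + K) * p y t" using that by (simp add: algebra_simps)
      finally show ?thesis by simp
    qed
    \<comment> \<open>The Poisson formula for \<open>B - A\<close> on the line of height
      \<open>c\<close>, with the derivative moved from \<open>E\<close> to the kernel. The boundary
      terms vanish since \<open>p y\<close> decays quadratically and \<open>E\<close> grows at most
      linearly.\<close>
    have BA: "pi *\<^sub>R (B (Complex x (c + y)) - A) = (\<integral>t. k y t *\<^sub>R E (Complex t c) \<partial>lborel)"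
      if y: "y > 0" and c: "0 < c" "c \<le> y" for c y
    proof -
      have b1: "has_bochner_integral lborel (\<lambda>t. p y t *\<^sub>R (B (Complex t c) - A)) (pi *\<^sub>R (B (Complex x (c + y)) - A))"
        unfolding p_def
      proof (rule poisson_formula_bounded[where B="\<lambda>z. B z - A", OF _ c(1) y])
        show "(\<lambda>z. B z - A) holomorphic_on upper_half_plane" by (intro holomorphic_intros hol)
        show "norm (B z - A) \<le> K" if "Im z \<ge> c" for z
          using bd[of z] that c norm_triangle_ineq4[of "B z" A] by (simp add: K_def)
      qed
      have b2: "integrable lborel (\<lambda>t. k y t *\<^sub>R E (Complex t c))"
      proof (rule Bochner_Integration.integrable_bound)
        show "integrable lborel (\<lambda>t. (2 * K + K) * p y t)" by (intro integrable_mult_right pint y)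
        show "(\<lambda>t. k y t *\<^sub>R E (Complex t c)) \<in> borel_measurable lborel"
          using borel_measurable_continuous_onI[OF continuous_on_scaleR[OF kcont[OF y] Econt[OF c(1)]]] by simp
      qed (use kE[OF y c] K y in \<open>auto simp: p_def\<close>)
      have "(\<integral>t. - (k y t *\<^sub>R E (Complex t c)) + p y t *\<^sub>R (B (Complex t c) - A) \<partial>lborel) = 0"
      proof (rule integral_real_line_eq_limit)
        show "((\<lambda>t. p y t *\<^sub>R E (Complex t c)) has_vector_derivative - (k y t *\<^sub>R E (Complex t c)) + p y t *\<^sub>R (B (Complex t c) - A)) (at t)" for t
          using c has_vector_derivative_scaleR[OF pder[OF y] has_vector_derivative_horizontal_line[OF E']]
          by (simp add: add.commute)
        show "continuous_on UNIV (\<lambda>t. - (k y t *\<^sub>R E (Complex t c)) + p y t *\<^sub>R (B (Complex t c) - A))"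
          by (intro continuous_intros kcont pcont Econt y c(1) continuous_on_upper_horizontal[OF hol])
        show "integrable lborel (\<lambda>t. - (k y t *\<^sub>R E (Complex t c)) + p y t *\<^sub>R (B (Complex t c) - A))"
          using b1 b2 by (intro Bochner_Integration.integrable_add Bochner_Integration.integrable_minus) (auto simp: has_bochner_integral_iff)
        have l: "(\<lambda>n. p y (s * real n) *\<^sub>R E (Complex (s * real n) c)) \<longlonglongrightarrow> 0" if s: "s = 1 \<or> s = -1" for s
        proof (rule Lim_null_comparison)
          show "eventually (\<lambda>n. norm (p y (s * real n) *\<^sub>R E (Complex (s * real n) c)) \<le> p y (s * real n) * (K * (\<bar>s * real n - x\<bar> + c))) sequentially"
          proof (intro always_eventually allI)
            fix n
            have "norm (E (Complex (s * real n) c)) \<le> K * norm (Complex (s * real n) c - of_real x)" using c by (intro E) auto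
            also have "\<dots> \<le> K * (\<bar>s * real n - x\<bar> + c)"
              using cmod_le[of "Complex (s * real n) c - of_real x"] c K by (intro mult_left_mono) auto
            finally show "norm (p y (s * real n) *\<^sub>R E (Complex (s * real n) c)) \<le> p y (s * real n) * (K * (\<bar>s * real n - x\<bar> + c))"
            proof -
              assume *: "norm (E (Complex (s * real n) c)) \<le> K * (\<bar>s * real n - x\<bar> + c)"
              have p0: "\<bar>p y (s * real n)\<bar> = p y (s * real n)" using y by (simp add: p_def)
              show ?thesis unfolding norm_scaleR p0 by (rule mult_left_mono[OF *]) (use y in \<open>simp add: p_def\<close>)
            qed
          qed
          show "(\<lambda>n. p y (s * real n) * (K * (\<bar>s * real n - x\<bar> + c))) \<longlonglongrightarrow> 0"
            using s y unfolding p_def by (elim disjE; simp only:; real_asymp)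
        qed
        show "(\<lambda>n. p y (real n) *\<^sub>R E (Complex (real n) c) - p y (- real n) *\<^sub>R E (Complex (- real n) c)) \<longlonglongrightarrow> 0"
          using tendsto_diff[OF l[of 1] l[of "-1"]] by simp
      qed
      then show ?thesis using b1 b2 by (simp add: has_bochner_integral_iff)
    qed
    \<comment> \<open>The relative error of the first-order expansion on the real line. At
      \<open>t = x\<close> division by zero gives 0, the right value here: differentiability makes
      \<open>e\<close> small near \<open>x\<close>, so its Poisson integrals vanish in the
      limit.\<close>
    define e where "e t = norm (E (of_real t)) / \<bar>t - x\<bar>" for t
    have Ec0: "continuous_on UNIV (\<lambda>t. E (of_real t))"
    proof -
      have "continuous_on UNIV (\<lambda>t. G0 (complex_of_real t))"
        by (rule continuous_on_compose2[OF lipschitz_on_continuous_on[OF lip]])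
           (simp_all add: clH image_subset_iff continuous_on_of_real_id)
      then show ?thesis unfolding E_def by (intro continuous_intros)
    qed
    have [measurable]: "(\<lambda>t. E (complex_of_real t)) \<in> borel_measurable borel"
      by (rule borel_measurable_continuous_onI[OF Ec0])
    have em[measurable]: "e \<in> borel_measurable borel" unfolding e_def by measurable
    have eK: "\<bar>e t\<bar> \<le> K" for t
      using E[of "of_real t"] K by (cases "t = x") (auto simp: e_def divide_le_eq simp flip: of_real_diff)
    have evan: "vanishes_in_mean_at e x"
      unfolding vanishes_in_mean_at_def
    proof (intro allI impI)
      fix c :: real assume c: "c > 0"
      have "((\<lambda>t. (g t - g x - (t - x) *\<^sub>R A) /\<^sub>R norm (t - x)) \<longlongrightarrow> 0) (at x)"
        using gA unfolding has_vector_derivative_def has_derivative_at_within by simp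
      then have "eventually (\<lambda>t. dist ((g t - g x - (t - x) *\<^sub>R A) /\<^sub>R norm (t - x)) 0 < c / 2) (at x)"
        using c by (intro tendstoD) auto
      then obtain d where d: "d > 0" "\<And>t. t \<noteq> x \<Longrightarrow> dist t x < d \<Longrightarrow> dist ((g t - g x - (t - x) *\<^sub>R A) /\<^sub>R norm (t - x)) 0 < c / 2"
        unfolding eventually_at by blast
      have ec: "\<bar>e t\<bar> \<le> c / 2" if "dist x t < d" for t
      proof (cases "t = x")
        case False
        have "E (of_real t) = g t - g x - (t - x) *\<^sub>R A" by (simp add: E_def g_def scaleR_conv_of_real)
        then have "\<bar>e t\<bar> = dist ((g t - g x - (t - x) *\<^sub>R A) /\<^sub>R norm (t - x)) 0"
          unfolding e_def by (simp add: divide_inverse_commute abs_mult)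
        also have "\<dots> < c / 2" by (rule d(2)[OF False]) (use that in \<open>simp add: dist_commute\<close>)
        finally show ?thesis by simp
      qed (use c in \<open>simp add: e_def\<close>)
      show "\<exists>d>0. \<forall>r. 0 < r \<and> r < d \<longrightarrow> (\<integral>\<^sup>+t\<in>cball x r. ennreal \<bar>e t\<bar> \<partial>lborel) \<le> ennreal (c * r)"
      proof (intro exI[of _ d] conjI allI impI d)
        fix r assume r: "0 < r \<and> r < d"
        have "(\<integral>\<^sup>+t\<in>cball x r. ennreal \<bar>e t\<bar> \<partial>lborel) \<le> (\<integral>\<^sup>+t. ennreal (c / 2) * indicator (cball x r) t \<partial>lborel)"
          using r ec by (intro nn_integral_mono) (auto simp: indicator_def intro!: ennreal_leI)
        also have "\<dots> = ennreal (c / 2) * ennreal (2 * r)"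
          using r by (subst nn_integral_cmult_indicator) (auto simp: cball_eq_atLeastAtMost)
        also have "\<dots> = ennreal (c * r)" using r c by (simp add: ennreal_mult[symmetric])
        finally show "(\<integral>\<^sup>+t\<in>cball x r. ennreal \<bar>e t\<bar> \<partial>lborel) \<le> ennreal (c * r)" .
      qed
    qed
    have eint: "integrable lborel (\<lambda>t. e t / (1 + t\<^sup>2))"
    proof (rule Bochner_Integration.integrable_bound)
      show "integrable lborel (\<lambda>t. K * (1 / (1 + t\<^sup>2)))"
        using has_bochner_integral_inverse_1_plus_square by (intro integrable_mult_right) (simp add: has_bochner_integral_iff)
      show "AE t in lborel. norm (e t / (1 + t\<^sup>2)) \<le> norm (K * (1 / (1 + t\<^sup>2)))"
        using eK K by (intro AE_I2) (auto intro!: divide_right_mono simp: abs_divide abs_of_nonneg)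
    qed measurable
    have main: "norm (B (Complex x y) - A) \<le> 2 * (\<integral>t. poisson x y t * \<bar>e t\<bar> \<partial>lborel)" if y: "y > 0" for y
    proof -
      define c where "c n = y / (1 + real n)" for n
      have c: "0 < c n" "c n \<le> y" for n using y by (auto simp: c_def field_simps)
      have clim: "c \<longlonglongrightarrow> 0" unfolding c_def by real_asymp
      have "(\<lambda>n. \<integral>t. k y t *\<^sub>R E (Complex t (c n)) \<partial>lborel) \<longlonglongrightarrow> (\<integral>t. k y t *\<^sub>R E (of_real t) \<partial>lborel)"
      proof (rule integral_dominated_convergence[where w="\<lambda>t. (2 * K + K) * p y t"])
        show "integrable lborel (\<lambda>t. (2 * K + K) * p y t)" by (intro integrable_mult_right pint y)
        show "(\<lambda>t. k y t *\<^sub>R E (Complex t (c n))) \<in> borel_measurable lborel" for n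
          using borel_measurable_continuous_onI[OF continuous_on_scaleR[OF kcont[OF y] Econt[OF c(1)]]] by simp
        show "(\<lambda>t. k y t *\<^sub>R E (of_real t)) \<in> borel_measurable lborel"
          using borel_measurable_continuous_onI[OF continuous_on_scaleR[OF kcont[OF y] Ec0]] by simp
        show "AE t in lborel. (\<lambda>n. k y t *\<^sub>R E (Complex t (c n))) \<longlonglongrightarrow> k y t *\<^sub>R E (of_real t)"
        proof (rule AE_I2)
          fix t
          have "(\<lambda>n. G0 (Complex t (c n))) \<longlonglongrightarrow> G0 (of_real t)"
          proof (rule continuous_on_tendsto_compose[OF lipschitz_on_continuous_on[OF lip]])
            show "(\<lambda>n. Complex t (c n)) \<longlonglongrightarrow> complex_of_real t"
              using tendsto_Complex[OF tendsto_const clim, of t] by (simp add: complex_of_real_def)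
          qed (use c in \<open>auto simp: clH less_imp_le\<close>)
          moreover have "(\<lambda>n. Complex t (c n)) \<longlonglongrightarrow> complex_of_real t"
            using tendsto_Complex[OF tendsto_const clim, of t] by (simp add: complex_of_real_def)
          ultimately show "(\<lambda>n. k y t *\<^sub>R E (Complex t (c n))) \<longlonglongrightarrow> k y t *\<^sub>R E (of_real t)"
            unfolding E_def by (intro tendsto_intros)
        qed
        show "AE t in lborel. norm (k y t *\<^sub>R E (Complex t (c n))) \<le> (2 * K + K) * p y t" for n
          using kE[OF y c] by simp
      qed
      also have "(\<lambda>n. \<integral>t. k y t *\<^sub>R E (Complex t (c n)) \<partial>lborel) = (\<lambda>n. pi *\<^sub>R (B (Complex x (c n + y)) - A))"
        using BA[OF y c] by simp
      finally have 1: "(\<lambda>n. pi *\<^sub>R (B (Complex x (c n + y)) - A)) \<longlonglongrightarrow> (\<integral>t. k y t *\<^sub>R E (of_real t) \<partial>lborel)" .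
      have "(\<lambda>n. B (Complex x (c n + y))) \<longlonglongrightarrow> B (Complex x y)"
      proof (rule isCont_tendsto_compose[where g=B])
        show "isCont B (Complex x y)" using y holomorphic_on_imp_continuous_on[OF hol]
          by (simp add: continuous_on_eq_continuous_at)
        show "(\<lambda>n. Complex x (c n + y)) \<longlonglongrightarrow> Complex x y"
          using tendsto_Complex[OF tendsto_const tendsto_add[OF clim tendsto_const], of x y] by simp
      qed
      then have "(\<lambda>n. pi *\<^sub>R (B (Complex x (c n + y)) - A)) \<longlonglongrightarrow> pi *\<^sub>R (B (Complex x y) - A)"
        by (intro tendsto_intros)
      with 1 have eq: "pi *\<^sub>R (B (Complex x y) - A) = (\<integral>t. k y t *\<^sub>R E (of_real t) \<partial>lborel)"
        by (rule LIMSEQ_unique[symmetric])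
      have i: "integrable lborel (\<lambda>t. poisson x y t * \<bar>e t\<bar>)"
        using integrable_poisson[of "\<lambda>t. \<bar>e t\<bar>" y x] integrable_norm[OF eint] y 
        by (simp add: divide_inverse mult_ac abs_mult abs_of_nonneg)
      have "pi * norm (B (Complex x y) - A) = norm (pi *\<^sub>R (B (Complex x y) - A))" by simp
      also have "\<dots> \<le> (\<integral>t. 2 * (poisson x y t * \<bar>e t\<bar>) \<partial>lborel)"
        unfolding eq
      proof (rule order_trans[OF integral_norm_bound], rule integral_mono')
        show "integrable lborel (\<lambda>t. 2 * (poisson x y t * \<bar>e t\<bar>))" using i by (intro integrable_mult_right)
        show "norm (k y t *\<^sub>R E (of_real t)) \<le> 2 * (poisson x y t * \<bar>e t\<bar>)" for t
        proof -
          have "E (of_real x) = 0" by (simp add: E_def g_def)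
          then have "norm (E (of_real t)) = \<bar>t - x\<bar> * \<bar>e t\<bar>" by (cases "t = x") (auto simp: e_def)
          then have "norm (k y t *\<^sub>R E (of_real t)) = (\<bar>k y t\<bar> * \<bar>t - x\<bar>) * \<bar>e t\<bar>" by simp
          also have "\<dots> \<le> 2 * p y t * \<bar>e t\<bar>" by (intro mult_right_mono k2 y) simp
          finally show "norm (k y t *\<^sub>R E (of_real t)) \<le> 2 * (poisson x y t * \<bar>e t\<bar>)" by (simp add: p_def)
        qed
      qed (use y in simp)
      also have "\<dots> = 2 * (\<integral>t. poisson x y t * \<bar>e t\<bar> \<partial>lborel)" by (rule integral_mult_right_zero)
      finally have "pi * norm (B (Complex x y) - A) \<le> 2 * (\<integral>t. poisson x y t * \<bar>e t\<bar> \<partial>lborel)" .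
      moreover have "1 * norm (B (Complex x y) - A) \<le> pi * norm (B (Complex x y) - A)"
        using pi_gt3 by (intro mult_right_mono) auto
      ultimately show ?thesis by simp
    qed
    have "((\<lambda>y. B (Complex x y) - A) \<longlongrightarrow> 0) (at_right 0)"
    proof (rule Lim_null_comparison)
      show "eventually (\<lambda>y. norm (B (Complex x y) - A) \<le> 2 * (\<integral>t. poisson x y t * \<bar>e t\<bar> \<partial>lborel)) (at_right 0)"
        unfolding eventually_at_right_field by (intro exI[of _ 1] conjI allI impI main) auto
      show "((\<lambda>y. 2 * (\<integral>t. poisson x y t * \<bar>e t\<bar> \<partial>lborel)) \<longlongrightarrow> 0) (at_right 0)"
        using tendsto_mult_left[OF poisson_tendsto_zero[OF em eint evan], of 2] by simp
    qed
    then show ?case by (intro exI[of _ A]) (simp add: LIM_zero_iff)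
  qed
qed

section \<open>Boundary limits and the Schwarz--Pick lemma\<close>

text \<open>The bounded function \<open>1 / (1 + F)\<close> has limits, and they are almost never \<open>0\<close>, because the Poisson
  averages of the nonnegative function \<open>ln \<bar>1 + F\<bar>\<close> stay bounded.\<close>

lemma AE_vertical_limit_Re_nonneg:
  assumes hol: "F holomorphic_on upper_half_plane" and pos: "\<And>z. Im z > 0 \<Longrightarrow> Re (F z) \<ge> 0"
  shows "AE x in lborel. \<exists>l. ((\<lambda>y. F (Complex x y)) \<longlongrightarrow> l) (at_right 0)"
proof -
  define b where "b z = 1 / (1 + F z)" for z
  have re: "Re (1 + F z) \<ge> 1" if "Im z > 0" for z using pos[OF that] by simp
  have nm: "norm (1 + F z) \<ge> 1" if "Im z > 0" for z
    using re[OF that] complex_Re_le_cmod order_trans by blast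
  have nz: "1 + F z \<noteq> 0" if "Im z > 0" for z using nm[OF that] by auto
  have bhol: "b holomorphic_on upper_half_plane"
    unfolding b_def by (intro holomorphic_intros hol) (use nz in auto)
  have bb: "norm (b z) \<le> 1" if "Im z > 0" for z
    using nm[OF that] by (simp add: b_def norm_divide divide_le_eq)
  define L where "L z = Ln (1 + F z)" for z
  have Lhol: "L holomorphic_on upper_half_plane"
    unfolding L_def
  proof (intro holomorphic_intros hol)
    fix z assume "z \<in> upper_half_plane"
    then have "Re (1 + F z) > 0" using re[of z] by simp
    then show "1 + F z \<notin> \<real>\<^sub>\<le>\<^sub>0" using complex_nonpos_Reals_iff by force
  qed
  have ReL: "Re (L z) = ln (norm (1 + F z))" if "Im z > 0" for z
    using nz[OF that] by (simp add: L_def)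
  have Lpos: "Re (L z) \<ge> 0" if "Im z > 0" for z
    using nm[OF that] by (simp add: ReL[OF that])
  define u where "u t = liminf (\<lambda>n. ennreal (Re (L (Complex t (1 / (1 + real n))))))" for t
  have Lmeas[measurable]: "(\<lambda>t. L (Complex t (1 / (1 + real n)))) \<in> borel_measurable borel" for n
    by (intro borel_measurable_upper_horizontal Lhol) simp
  have [measurable]: "u \<in> borel_measurable borel" unfolding u_def by measurable
  have "(\<integral>\<^sup>+t. ennreal (1 / ((t - 0)\<^sup>2 + 1\<^sup>2)) * u t \<partial>lborel) \<le> ennreal (pi * Re (L (Complex 0 1)))"
    unfolding u_def by (rule poisson_liminf_le[OF Lhol Lpos]) auto
  then have "(\<integral>\<^sup>+t. ennreal (1 / ((t - 0)\<^sup>2 + 1\<^sup>2)) * u t \<partial>lborel) \<noteq> \<infinity>"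
    by (auto simp: top_unique)
  then have "AE t in lborel. ennreal (1 / ((t - 0)\<^sup>2 + 1\<^sup>2)) * u t \<noteq> \<infinity>"
    by (intro nn_integral_PInf_AE) auto
  moreover have "AE x in lborel. \<exists>l. ((\<lambda>y. b (Complex x y)) \<longlongrightarrow> l) (at_right 0)"
    by (rule AE_vertical_limit_bounded[OF bhol bb])
  ultimately show ?thesis
  proof eventually_elim
    case (elim x)
    then obtain l where l: "((\<lambda>y. b (Complex x y)) \<longlongrightarrow> l) (at_right 0)" by blast
    have pos': "0 < (1::real) / ((x - 0)\<^sup>2 + 1\<^sup>2)" by (simp add: add_nonneg_pos)
    have "u x \<noteq> \<infinity>"
    proof
      assume "u x = \<infinity>"
      then have "ennreal (1 / ((x - 0)\<^sup>2 + 1\<^sup>2)) * u x = \<infinity>" using pos' by (simp add: ennreal_mult_top del: diff_zero)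
      then show False using elim(1) by simp
    qed
    have "l \<noteq> 0"
    proof
      assume "l = 0"
      \<comment> \<open>A finite level above \<open>u x\<close>. If \<open>b\<close> tended to 0,
        then \<open>Re L = ln \<bar>1 + F\<bar>\<close> would eventually stay above
        \<open>K\<close>, against the definition of \<open>u x\<close> as a limit inferior.\<close>
      define K where "K = enn2real (u x) + 1"
      have uK: "u x < ennreal K" using \<open>u x \<noteq> \<infinity>\<close> by (cases "u x") (auto simp: K_def ennreal_less_iff)
      have "filterlim (\<lambda>n. 1 / (1 + real n)) (at_right 0) sequentially" by real_asymp
      from filterlim_compose[OF l this] have "(\<lambda>n. b (Complex x (1 / (1 + real n)))) \<longlonglongrightarrow> 0" using \<open>l = 0\<close> by simp
      then have "eventually (\<lambda>n. dist (b (Complex x (1 / (1 + real n)))) 0 < exp (- K)) sequentially"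
        by (rule tendstoD) simp
      then have "eventually (\<lambda>n. ennreal K \<le> ennreal (Re (L (Complex x (1 / (1 + real n)))))) sequentially"
      proof eventually_elim
        case (elim n)
        let ?z = "Complex x (1 / (1 + real n))"
        have z: "Im ?z > 0" by simp
        have "1 / norm (1 + F ?z) < exp (- K)" using elim by (simp add: b_def norm_divide)
        moreover have N: "norm (1 + F ?z) > 0" using nm[OF z] by linarith
        ultimately have "exp K < norm (1 + F ?z)" by (simp add: exp_minus divide_simps)
        then have "K < ln (norm (1 + F ?z))" using N ln_less_cancel_iff[of "exp K" "norm (1 + F ?z)"] by simp
        then show ?case using ReL[OF z] by (simp add: ennreal_leI)
      qed
      then have "ennreal K \<le> u x" unfolding u_def by (rule Liminf_bounded)
      then show False using uK by simp
    qed
    have "((\<lambda>y. 1 / b (Complex x y) - 1) \<longlongrightarrow> 1 / l - 1) (at_right 0)"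
      using \<open>l \<noteq> 0\<close> by (intro tendsto_intros l)
    moreover have "eventually (\<lambda>y. 1 / b (Complex x y) - 1 = F (Complex x y)) (at_right 0)"
      unfolding eventually_at_right_field by (intro exI[of _ 1]) (simp add: b_def)
    ultimately have "((\<lambda>y. F (Complex x y)) \<longlongrightarrow> 1 / l - 1) (at_right 0)"
      by (rule Lim_transform_eventually)
    then show ?case by blast
  qed
qed

text \<open>Schwarz's lemma after rescaling the ball to the unit disc and sending the half-plane to
  the disc by \<open>(w - f a) / (w - cnj (f a))\<close>. The inequality is multiplied out so that
  no denominators remain.\<close>

lemma Schwarz_Pick_ball:
  assumes hol: "f holomorphic_on ball a r" and pos: "\<And>z. z \<in> ball a r \<Longrightarrow> Im (f z) > 0" and b: "b \<in> ball a r"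
  shows "norm (f b - f a) * r \<le> norm (b - a) * norm (f b - cnj (f a))"
proof -
  have r: "r > 0" using b by (auto intro: le_less_trans[OF zero_le_dist])
  define h where "h \<zeta> = f (a + of_real r * \<zeta>)" for \<zeta>
  define g where "g \<zeta> = (h \<zeta> - f a) / (h \<zeta> - cnj (f a))" for \<zeta>
  have inb: "a + of_real r * \<zeta> \<in> ball a r" if "norm \<zeta> < 1" for \<zeta>
    using that r by (simp add: dist_norm norm_mult)
  have fa: "Im (f a) > 0" using pos[of a] r by simp
  have hpos: "Im (h \<zeta>) > 0" if "norm \<zeta> < 1" for \<zeta> unfolding h_def by (intro pos inb that)
  have hne: "h \<zeta> \<noteq> cnj (f a)" if "norm \<zeta> < 1" for \<zeta> using hpos[OF that] fa by (auto simp: complex_eq_iff)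
  have hhol: "h holomorphic_on ball 0 1"
  proof -
    have "f \<circ> (\<lambda>\<zeta>. a + of_real r * \<zeta>) holomorphic_on ball 0 1"
      by (rule holomorphic_on_compose_gen[OF _ hol]) (use inb in \<open>auto intro!: holomorphic_intros\<close>)
    then show ?thesis by (simp add: h_def[abs_def] o_def)
  qed
  have "norm (g ((b - a) / of_real r)) \<le> norm ((b - a) / of_real r)"
  proof (rule Schwarz_Lemma)
    show "g holomorphic_on ball 0 1" unfolding g_def by (intro holomorphic_intros hhol) (use hne in auto)
    show "g 0 = 0" by (simp add: g_def h_def)
    show "norm (g \<zeta>) < 1" if "norm \<zeta> < 1" for \<zeta>
    proof -
      have "(norm (h \<zeta> - f a))\<^sup>2 < (norm (h \<zeta> - cnj (f a)))\<^sup>2"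
      proof -
        have "0 < Im (h \<zeta>) * Im (f a)" using hpos[OF that] fa by simp
        then show ?thesis unfolding cmod_power2 by (simp add: power2_eq_square algebra_simps)
      qed
      then have "norm (h \<zeta> - f a) < norm (h \<zeta> - cnj (f a))" by (rule power2_less_imp_less) simp
      then show ?thesis using hne[OF that] by (simp add: g_def norm_divide)
    qed
    show "norm ((b - a) / of_real r) < 1" using b r by (simp add: norm_divide dist_norm norm_minus_commute)
  qed
  moreover have "norm ((b - a) / of_real r) < 1" using b r by (simp add: norm_divide dist_norm norm_minus_commute)
  ultimately show ?thesis
    using r hne[of "(b - a) / of_real r"] by (simp add: g_def h_def norm_divide divide_le_eq field_simps)
qed

text \<open>Reduced to the disc by the Cayley map \<open>C\<close>, which takes 0 to
  \<open>w\<close>.\<close>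

lemma Schwarz_Pick_upper_half_plane:
  assumes hol: "f holomorphic_on upper_half_plane" and pos: "\<And>z. Im z > 0 \<Longrightarrow> Im (f z) > 0"
    and z: "Im z > 0" and w: "Im w > 0"
  shows "norm (f z - f w) * norm (z - cnj w) \<le> norm (z - w) * norm (f z - cnj (f w))"
proof -
  define C where "C \<zeta> = (w - cnj w * \<zeta>) / (1 - \<zeta>)" for \<zeta>
  have Cpos: "Im (C \<zeta>) > 0" if "norm \<zeta> < 1" for \<zeta>
  proof -
    have "(norm \<zeta>)\<^sup>2 < 1" using that by (simp add: power_less_one_iff abs_square_less_1)
    then have 1: "(Re \<zeta>)\<^sup>2 + (Im \<zeta>)\<^sup>2 < 1" by (simp add: cmod_power2)
    have ne: "\<zeta> \<noteq> 1" using that by auto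
    then have d: "(1 - Re \<zeta>)\<^sup>2 + (Im \<zeta>)\<^sup>2 > 0"
      by (auto simp: complex_eq_iff sum_power2_gt_zero_iff)
    have "Im (C \<zeta>) = Im w * (1 - ((Re \<zeta>)\<^sup>2 + (Im \<zeta>)\<^sup>2)) / ((1 - Re \<zeta>)\<^sup>2 + (Im \<zeta>)\<^sup>2)"
      by (simp add: C_def Im_divide power2_eq_square algebra_simps)
    also have "\<dots> > 0" using 1 d w by simp
    finally show ?thesis .
  qed
  define \<zeta> where "\<zeta> = (z - w) / (z - cnj w)"
  have zw: "z - cnj w \<noteq> 0" using z w by (auto simp: complex_eq_iff)
  have "norm \<zeta> < 1"
  proof -
    have "(norm (z - w))\<^sup>2 < (norm (z - cnj w))\<^sup>2"
      using mult_pos_pos[OF z w] unfolding cmod_power2 by (simp add: power2_eq_square algebra_simps)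
    then have "norm (z - w) < norm (z - cnj w)" by (rule power2_less_imp_less) simp
    then show ?thesis using zw by (simp add: \<zeta>_def norm_divide)
  qed
  have "w - cnj w \<noteq> 0" using w by (simp add: complex_eq_iff)
  have "1 - \<zeta> = (w - cnj w) / (z - cnj w)" "w - cnj w * \<zeta> = z * (w - cnj w) / (z - cnj w)"
    using zw by (simp_all add: \<zeta>_def field_simps)
  then have Cz: "C \<zeta> = z" using zw \<open>w - cnj w \<noteq> 0\<close> by (simp add: C_def)
  have C0: "C 0 = w" by (simp add: C_def)
  have "norm ((f \<circ> C) \<zeta> - (f \<circ> C) 0) * 1 \<le> norm (\<zeta> - 0) * norm ((f \<circ> C) \<zeta> - cnj ((f \<circ> C) 0))"
  proof (rule Schwarz_Pick_ball)
    show "f \<circ> C holomorphic_on ball 0 1"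
    proof (rule holomorphic_on_compose_gen[OF _ hol])
      show "C holomorphic_on ball 0 1" unfolding C_def by (intro holomorphic_intros) auto
    qed (use Cpos in auto)
  qed (use Cpos pos \<open>norm \<zeta> < 1\<close> in auto)
  moreover have "norm \<zeta> = norm (z - w) / norm (z - cnj w)" by (simp add: \<zeta>_def norm_divide)
  ultimately show ?thesis using zw by (simp add: Cz C0 divide_simps mult.commute)
qed

text \<open>The Schwarz--Pick inequality for \<open>\<i> * F\<close> at \<open>z\<close> and
  \<open>\<i>\<close> gives \<open>norm (F z) * (a - b) \<le> norm (F \<i>) * (a + b)\<close>, where
  \<open>a\<close> and \<open>b\<close> are the distances of \<open>z\<close> from
  \<open>- \<i>\<close> and \<open>\<i>\<close>. Now \<open>a\<^sup>2 - b\<^sup>2 = 4 * Im z\<close>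
  and \<open>b \<le> a\<close>.\<close>

lemma Re_pos_growth:
  assumes hol: "F holomorphic_on upper_half_plane" and pos: "\<And>z. Im z > 0 \<Longrightarrow> Re (F z) > 0"
    and z: "Im z > 0"
  shows "norm (F z) \<le> norm (F \<i>) * (norm (z + \<i>))\<^sup>2 / Im z"
proof -
  have "norm (\<i> * F z - \<i> * F \<i>) * norm (z - cnj \<i>) \<le> norm (z - \<i>) * norm (\<i> * F z - cnj (\<i> * F \<i>))"
    by (rule Schwarz_Pick_upper_half_plane[where f="\<lambda>z. \<i> * F z", OF _ _ z]) (use pos in \<open>auto intro!: holomorphic_intros hol\<close>)
  also have "norm (\<i> * F z - \<i> * F \<i>) = norm (F z - F \<i>)" by (simp add: norm_mult flip: right_diff_distrib)
  also have "norm (\<i> * F z - cnj (\<i> * F \<i>)) = norm (F z + cnj (F \<i>))" by (simp add: norm_mult flip: distrib_left)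
  finally have 1: "norm (F z - F \<i>) * norm (z + \<i>) \<le> norm (z - \<i>) * norm (F z + cnj (F \<i>))" by simp
  define a where "a = norm (z + \<i>)"
  define b where "b = norm (z - \<i>)"
  have ab: "a\<^sup>2 - b\<^sup>2 = 4 * Im z"
    unfolding a_def b_def cmod_power2 by (simp add: power2_eq_square algebra_simps)
  have a0: "a \<ge> 0" and b0: "b \<ge> 0" by (simp_all add: a_def b_def)
  have "b\<^sup>2 \<le> a\<^sup>2" using ab z by simp
  then have ba: "b \<le> a" using a0 by (rule power2_le_imp_le)
  have "(norm (F z) - norm (F \<i>)) * a \<le> norm (F z - F \<i>) * a"
    by (intro mult_right_mono norm_triangle_ineq2 a0)
  also have "\<dots> \<le> b * norm (F z + cnj (F \<i>))" using 1 by (simp add: a_def b_def)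
  also have "\<dots> \<le> b * (norm (F z) + norm (F \<i>))"
    using norm_triangle_ineq[of "F z" "cnj (F \<i>)"] by (intro mult_left_mono b0) simp
  finally have "norm (F z) * (a - b) \<le> norm (F \<i>) * (a + b)" by (simp add: algebra_simps)
  then have "norm (F z) * (a - b) * (a + b) \<le> norm (F \<i>) * (a + b) * (a + b)"
    using a0 b0 by (intro mult_right_mono) auto
  also have "\<dots> \<le> norm (F \<i>) * (2 * a) * (2 * a)"
    using ba a0 b0 by (intro mult_mono mult_nonneg_nonneg) auto
  also have "norm (F z) * (a - b) * (a + b) = norm (F z) * (a\<^sup>2 - b\<^sup>2)" by (simp add: power2_eq_square algebra_simps)
  finally have "norm (F z) * Im z \<le> norm (F \<i>) * a\<^sup>2" unfolding ab by (simp add: power2_eq_square)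
  then show ?thesis using z by (simp add: a_def field_simps)
qed

text \<open>Julia's lemma at infinity, for the angular derivative \<open>1\<close>.\<close>

lemma Im_le_of_asymptotically_fixed:
  assumes hol: "g holomorphic_on upper_half_plane" and pos: "\<And>z. Im z > 0 \<Longrightarrow> Im (g z) > 0"
    and w: "\<And>n::nat. Im (w n) > 0" and winf: "filterlim (\<lambda>n. norm (w n)) at_top sequentially"
    and fixed: "(\<lambda>n. norm (g (w n) - w n) / Im (w n)) \<longlonglongrightarrow> 0"
    and z: "Im z > 0"
  shows "Im z \<le> Im (g z)"
proof -
  have sq: "(norm (a - cnj b))\<^sup>2 = (norm (a - b))\<^sup>2 + 4 * Im a * Im b" for a b
    unfolding cmod_power2 by (simp add: power2_eq_square algebra_simps)
  have "norm (w n) > 0" for n using w[of n] by (metis norm_eq_zero norm_ge_zero order_le_less zero_complex.simps(2) order_less_irrefl)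
  note wn = this
  \<comment> \<open>By \<open>sq\<close>, the squared Schwarz--Pick inequality has the same product
    of squared distances on both sides. After cancelling it and dividing by the square of
    \<open>norm (w n)\<close> and by \<open>Im (w n)\<close>, every quotient tends to 1.\<close>
  have ineq: "(norm (g z - g (w n)) / norm (w n))\<^sup>2 * Im z \<le> (norm (z - w n) / norm (w n))\<^sup>2 * (Im (g z) * (Im (g (w n)) / Im (w n)))" for n
  proof -
    have "(norm (g z - g (w n)) * norm (z - cnj (w n)))\<^sup>2 \<le> (norm (z - w n) * norm (g z - cnj (g (w n))))\<^sup>2"
      by (intro power_mono Schwarz_Pick_upper_half_plane hol pos z w) auto
    then have "(norm (g z - g (w n)))\<^sup>2 * (Im z * Im (w n)) \<le> (norm (z - w n))\<^sup>2 * (Im (g z) * Im (g (w n)))"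
      unfolding power_mult_distrib sq by (simp add: algebra_simps)
    then have "(norm (g z - g (w n)))\<^sup>2 * (Im z * Im (w n)) / ((norm (w n))\<^sup>2 * Im (w n)) \<le> 
       (norm (z - w n))\<^sup>2 * (Im (g z) * Im (g (w n))) / ((norm (w n))\<^sup>2 * Im (w n))"
      using w[of n] wn[of n] by (intro divide_right_mono) auto
    then show ?thesis using w[of n] wn[of n] by (simp add: power_divide mult_ac)
  qed
  have c0: "(\<lambda>n. K / norm (w n)) \<longlonglongrightarrow> 0" for K
    by (rule real_tendsto_divide_at_top[OF tendsto_const winf])
  have tends1: "u \<longlonglongrightarrow> 1" if "\<And>n. \<bar>u n - 1\<bar> \<le> v n" "v \<longlonglongrightarrow> 0" for u v :: "nat \<Rightarrow> real"
  proof -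
    have "(\<lambda>n. u n - 1) \<longlonglongrightarrow> 0"
      by (rule Lim_null_comparison[OF _ that(2)]) (use that(1) in auto)
    then show ?thesis by (simp add: LIM_zero_iff)
  qed
  have l1: "(\<lambda>n. norm (z - w n) / norm (w n)) \<longlonglongrightarrow> 1"
  proof (rule tends1[OF _ c0[of "norm z"]])
    fix n
    have "\<bar>norm (z - w n) - norm (w n)\<bar> \<le> norm z"
      using norm_triangle_ineq3[of "z - w n" "- w n"] by simp
    then have "\<bar>(norm (z - w n) - norm (w n)) / norm (w n)\<bar> \<le> norm z / norm (w n)"
      using wn[of n] by (simp add: abs_divide divide_right_mono)
    also have "(norm (z - w n) - norm (w n)) / norm (w n) = norm (z - w n) / norm (w n) - 1"
      using wn[of n] by (simp add: field_simps)
    finally show "\<bar>norm (z - w n) / norm (w n) - 1\<bar> \<le> norm z / norm (w n)" .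
  qed
  have l2: "(\<lambda>n. norm (g z - g (w n)) / norm (w n)) \<longlonglongrightarrow> 1"
  proof (rule tends1)
    show "(\<lambda>n. norm (g z) / norm (w n) + norm (g (w n) - w n) / Im (w n)) \<longlonglongrightarrow> 0"
      using tendsto_add[OF c0[of "norm (g z)"] fixed] by simp
    fix n
    have "\<bar>norm (g z - g (w n)) - norm (w n)\<bar> \<le> norm (g z) + norm (g (w n) - w n)"
      using norm_triangle_ineq3[of "g z - g (w n)" "- w n"] norm_triangle_ineq4[of "g z" "g (w n) - w n"]
      by (simp add: algebra_simps)
    then have "\<bar>(norm (g z - g (w n)) - norm (w n)) / norm (w n)\<bar> \<le> (norm (g z) + norm (g (w n) - w n)) / norm (w n)"
      using wn[of n] by (simp add: abs_divide divide_right_mono)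
    also have "\<dots> = norm (g z) / norm (w n) + norm (g (w n) - w n) / norm (w n)" by (simp add: add_divide_distrib)
    also have "norm (g (w n) - w n) / norm (w n) \<le> norm (g (w n) - w n) / Im (w n)"
      using abs_Im_le_cmod[of "w n"] w[of n] wn[of n] by (intro divide_left_mono) auto
    also have "(norm (g z - g (w n)) - norm (w n)) / norm (w n) = norm (g z - g (w n)) / norm (w n) - 1"
      using wn[of n] by (simp add: field_simps)
    finally show "\<bar>norm (g z - g (w n)) / norm (w n) - 1\<bar> \<le> norm (g z) / norm (w n) + norm (g (w n) - w n) / Im (w n)"
      by simp
  qed
  have l3: "(\<lambda>n. Im (g (w n)) / Im (w n)) \<longlonglongrightarrow> 1"
  proof (rule tends1[OF _ fixed])
    fix n
    have "\<bar>(Im (g (w n)) - Im (w n)) / Im (w n)\<bar> \<le> norm (g (w n) - w n) / Im (w n)"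
      using abs_Im_le_cmod[of "g (w n) - w n"] w[of n] by (simp add: abs_divide divide_right_mono)
    also have "(Im (g (w n)) - Im (w n)) / Im (w n) = Im (g (w n)) / Im (w n) - 1"
      using w[of n] by (simp add: field_simps)
    finally show "\<bar>Im (g (w n)) / Im (w n) - 1\<bar> \<le> norm (g (w n) - w n) / Im (w n)" .
  qed
  have "1\<^sup>2 * Im z \<le> 1\<^sup>2 * (Im (g z) * 1)"
  proof (rule LIMSEQ_le)
    show "(\<lambda>n. (norm (g z - g (w n)) / norm (w n))\<^sup>2 * Im z) \<longlonglongrightarrow> 1\<^sup>2 * Im z" by (intro tendsto_intros l2)
    show "(\<lambda>n. (norm (z - w n) / norm (w n))\<^sup>2 * (Im (g z) * (Im (g (w n)) / Im (w n)))) \<longlonglongrightarrow> 1\<^sup>2 * (Im (g z) * 1)"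
      by (intro tendsto_intros l1 l3)
  qed (use ineq in auto)
  then show ?thesis by simp
qed

section \<open>The derivative of the conformal map lies in a sector\<close>

text \<open>The assumption \<open>winf\<close> replaces
  \<open>\<Phi>(\<infinity>) = \<infinity>\<close>, and \<open>r\<close> is a free sequence, because
  the lemma is applied both to \<open>\<Phi>\<close> and, along a subsequence, to
  \<open>\<Phi>\<close> composed with a Moebius map when \<open>winf\<close> is proved by
  contradiction.\<close>

lemma sector_derivative_aux:
  assumes lip: "L-lipschitz_on UNIV \<gamma>" and L: "L > 0"
    and hol: "\<Phi> holomorphic_on upper_half_plane" and bij: "bij_betw \<Phi> upper_half_plane (graph_domain \<gamma>)"
    and r: "filterlim r at_top sequentially" and r0: "\<And>n::nat. r n > 0"
    and w: "\<And>n. Im (w n) > 0" "\<And>n. \<Phi> (w n) = Complex 0 (\<gamma> 0 + r n)"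
    and winf: "filterlim (\<lambda>n. norm (w n)) at_top sequentially"
    and z: "Im z > 0"
  shows "0 < Re (1 / deriv \<Phi> z)" "\<bar>Im (1 / deriv \<Phi> z)\<bar> \<le> L * Re (1 / deriv \<Phi> z)"
proof -
  let ?H = upper_half_plane and ?\<Omega> = "graph_domain \<gamma>"
  have img: "\<Phi> ` ?H = ?\<Omega>" and inj: "inj_on \<Phi> ?H" using bij by (auto simp: bij_betw_def)
  obtain \<Psi> where "\<Psi> holomorphic_on (\<Phi> ` ?H)" and d: "\<And>z. z \<in> ?H \<Longrightarrow> deriv \<Phi> z * deriv \<Psi> (\<Phi> z) = 1"
      and inv: "\<And>z. z \<in> ?H \<Longrightarrow> \<Psi> (\<Phi> z) = z"
    by (rule holomorphic_has_inverse[OF hol open_upper_half_plane inj]) (rule that)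
  then have \<Psi>: "\<Psi> holomorphic_on ?\<Omega>" by (simp only: img)
  have \<Omega>: "\<Phi> z \<in> ?\<Omega>" if "Im z > 0" for z
  proof -
    have "\<Phi> z \<in> \<Phi> ` ?H" using that by (intro imageI) simp
    then show ?thesis by (simp only: img)
  qed
  have \<Psi>H: "Im (\<Psi> u) > 0" if "u \<in> ?\<Omega>" for u
  proof -
    have "u \<in> \<Phi> ` ?H" using that by (simp only: img)
    then obtain z where z: "z \<in> ?H" "u = \<Phi> z" by (rule imageE) simp
    then have "\<Psi> u = z" using inv by simp
    then show ?thesis using z by simp
  qed
  have \<Omega>open: "open ?\<Omega>" using open_mapping_thm3[OF hol open_upper_half_plane inj] img by simp
  have lip': "\<bar>\<gamma> s - \<gamma> t\<bar> \<le> L * \<bar>s - t\<bar>" for s t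
    using lipschitz_onD[OF lip, of s t] by (simp add: dist_real_def)
  have cone: "u + v \<in> ?\<Omega>" if "u \<in> ?\<Omega>" "Im v \<ge> L * \<bar>Re v\<bar>" for u v
    using lip'[of "Re u + Re v" "Re u"] that by (simp add: graph_domain_def)
  have mono: "Im z \<le> Im (\<Psi> (\<Phi> z + v))" if v: "Im v \<ge> L * \<bar>Re v\<bar>" for v
  proof (rule Im_le_of_asymptotically_fixed[where w=w and g="\<lambda>z. \<Psi> (\<Phi> z + v)", OF _ _ w(1) winf _ z])
    have "\<Psi> \<circ> (\<lambda>z. \<Phi> z + v) holomorphic_on ?H"
      by (rule holomorphic_on_compose_gen[OF _ \<Psi>]) (use \<Omega> cone v in \<open>auto intro!: holomorphic_intros hol\<close>)
    then show "(\<lambda>z. \<Psi> (\<Phi> z + v)) holomorphic_on ?H" by (simp add: o_def)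
    show "Im (\<Psi> (\<Phi> z + v)) > 0" if "Im z > 0" for z
      by (intro \<Psi>H cone \<Omega> that v)
    \<comment> \<open>The ball of radius \<open>\<rho> n\<close> around \<open>\<Phi> (w n)\<close>
      lies in \<open>\<Omega>\<close>: its points are higher than
      \<open>\<gamma> 0 + r n - \<rho> n = \<gamma> 0 + L * \<rho> n\<close>, while the graph stays
      below that height for \<open>\<bar>Re u\<bar> < \<rho> n\<close>.\<close>
    define \<rho> where "\<rho> n = r n / (1 + L)" for n
    have \<rho>: "filterlim \<rho> at_top sequentially"
      unfolding \<rho>_def divide_inverse using L by (intro filterlim_at_top_mult_tendsto_pos[OF tendsto_const _ r]) auto
    have "eventually (\<lambda>n. \<rho> n > norm v) sequentially"
      using \<rho> by (rule filterlim_at_top_dense[THEN iffD1, rule_format])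
    then have le: "eventually (\<lambda>n. norm (norm (\<Psi> (\<Phi> (w n) + v) - w n) / Im (w n)) \<le> 2 * norm v / (\<rho> n - norm v)) sequentially"
    proof eventually_elim
      case (elim n)
      let ?a = "\<Phi> (w n)"
      have sub: "ball ?a (\<rho> n) \<subseteq> ?\<Omega>"
      proof
        fix u assume "u \<in> ball ?a (\<rho> n)"
        then have u: "norm (u - ?a) < \<rho> n" by (simp add: dist_norm norm_minus_commute)
        have "\<bar>Re u\<bar> < \<rho> n" "\<bar>Im u - (\<gamma> 0 + r n)\<bar> < \<rho> n"
          using abs_Re_le_cmod[of "u - ?a"] abs_Im_le_cmod[of "u - ?a"] u by (auto simp: w)
        moreover have "L * \<bar>Re u\<bar> \<le> L * \<rho> n" using calculation L by simp
        moreover have "\<rho> n + L * \<rho> n = r n"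
        proof -
          have "\<rho> n + L * \<rho> n = (1 + L) * \<rho> n" by (simp add: algebra_simps)
          then show ?thesis using L by (simp add: \<rho>_def)
        qed
        ultimately show "u \<in> ?\<Omega>" using lip'[of "Re u" 0] by (simp add: graph_domain_def)
      qed
      \<comment> \<open>Schwarz--Pick on that ball shows that moving by \<open>v\<close> displaces
        the preimage by at most \<open>2 * norm v / (\<rho> n - norm v)\<close> times its height,
        which is the input of Julia's lemma.\<close>
      have "norm (\<Psi> (?a + v) - \<Psi> ?a) * \<rho> n \<le> norm (?a + v - ?a) * norm (\<Psi> (?a + v) - cnj (\<Psi> ?a))"
        by (rule Schwarz_Pick_ball) (use sub elim \<Psi>H in \<open>auto intro: holomorphic_on_subset[OF \<Psi>] simp: dist_norm\<close>)
      then have 1: "norm (\<Psi> (?a + v) - w n) * \<rho> n \<le> norm v * norm (\<Psi> (?a + v) - cnj (w n))"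
        unfolding inv[of "w n", simplified, OF w(1)] by simp
      have "norm (\<Psi> (?a + v) - cnj (w n)) \<le> norm (\<Psi> (?a + v) - w n) + norm (w n - cnj (w n))" by norm
      also have "norm (w n - cnj (w n)) = 2 * Im (w n)" using w(1)[of n] by (simp add: complex_diff_cnj norm_mult)
      finally have "norm v * norm (\<Psi> (?a + v) - cnj (w n)) \<le> norm v * (norm (\<Psi> (?a + v) - w n) + 2 * Im (w n))"
        by (rule mult_left_mono) simp
      with 1 have "norm (\<Psi> (?a + v) - w n) * (\<rho> n - norm v) \<le> 2 * norm v * Im (w n)" by (simp add: algebra_simps)
      then show ?case using elim w(1)[of n] by (simp add: field_simps)
    qed
    have "filterlim (\<lambda>n. - norm v + \<rho> n) at_top sequentially"
      by (rule filterlim_tendsto_add_at_top[OF tendsto_const \<rho>])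
    then have "(\<lambda>n. 2 * norm v / (\<rho> n - norm v)) \<longlonglongrightarrow> 0"
      by (intro real_tendsto_divide_at_top[OF tendsto_const]) simp
    with le show "(\<lambda>n. norm (\<Psi> (\<Phi> (w n) + v) - w n) / Im (w n)) \<longlonglongrightarrow> 0"
      by (rule Lim_null_comparison)
  qed
  define S where "S = 1 / deriv \<Phi> z"
  have dne: "deriv \<Phi> z \<noteq> 0" using d[of z] z by auto
  have S: "deriv \<Psi> (\<Phi> z) = S" using d[of z] z dne by (simp add: S_def field_simps)
  \<comment> \<open>The right-hand derivative at 0 of the height of the preimage along the ray
    \<open>\<Phi> z + t * v\<close>; by \<open>mono\<close> this height is never below its initial
    value \<open>Im z\<close>.\<close>
  have Imv: "Im (v * S) \<ge> 0" if v: "Im v \<ge> L * \<bar>Re v\<bar>" for v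
  proof -
    have "(\<Psi> has_field_derivative S) (at (\<Phi> z))"
      using holomorphic_derivI[OF \<Psi> \<Omega>open \<Omega>[OF z]] S by simp
    moreover have "((\<lambda>t. \<Phi> z + of_real t * v) has_vector_derivative v) (at 0)"
      by (auto intro!: derivative_eq_intros simp: scaleR_conv_of_real[symmetric] simp del: scaleR_conv_of_real)
    ultimately have "(\<Psi> \<circ> (\<lambda>t. \<Phi> z + of_real t * v) has_vector_derivative v * S) (at 0)"
      by (intro field_vector_diff_chain_at) auto
    then have "((\<lambda>t. Im (\<Psi> (\<Phi> z + of_real t * v))) has_real_derivative Im (v * S)) (at 0)"
      unfolding has_vector_derivative_complex_iff by (simp add: o_def)
    then have l: "((\<lambda>t. (Im (\<Psi> (\<Phi> z + of_real (0 + t) * v)) - Im (\<Psi> (\<Phi> z + of_real 0 * v))) / t) \<longlongrightarrow> Im (v * S)) (at_right 0)"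
      unfolding DERIV_def by (rule filterlim_mono) (auto simp: at_within_le_at)
    show ?thesis
    proof (rule tendsto_lowerbound[OF l])
      show "eventually (\<lambda>t. 0 \<le> (Im (\<Psi> (\<Phi> z + of_real (0 + t) * v)) - Im (\<Psi> (\<Phi> z + of_real 0 * v))) / t) (at_right 0)"
        unfolding eventually_at_right_field
      proof (intro exI[of _ 1] conjI allI impI)
        fix t :: real assume t: "0 < t"
        have "L * \<bar>Re (of_real t * v)\<bar> \<le> Im (of_real t * v)" 
          using mult_left_mono[OF v, of t] t by (simp add: abs_mult mult_ac)
        from mono[OF this] show "0 \<le> (Im (\<Psi> (\<Phi> z + of_real (0 + t) * v)) - Im (\<Psi> (\<Phi> z + of_real 0 * v))) / t"
          using t z by (simp add: inv)
      qed simp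
    qed simp
  qed
  \<comment> \<open>The two extreme rays of the cone give \<open>L * Re S + Im S \<ge> 0\<close> and
    \<open>L * Re S - Im S \<ge> 0\<close>.\<close>
  have "Im (Complex 1 L * S) \<ge> 0" "Im (Complex (-1) L * S) \<ge> 0"
    by (intro Imv; use L in simp)+
  then have le: "\<bar>Im S\<bar> \<le> L * Re S" by (simp add: abs_le_iff)
  moreover have "Re S > 0"
  proof (rule ccontr)
    assume "\<not> Re S > 0"
    then have "L * Re S \<le> 0" using L by (simp add: mult_nonneg_nonpos)
    with le have "Im S = 0" "L * Re S = 0" by linarith+
    then have "S = 0" using L by (simp add: complex_eq_iff)
    then show False using dne by (simp add: S_def)
  qed
  ultimately show "0 < Re (1 / deriv \<Phi> z)" "\<bar>Im (1 / deriv \<Phi> z)\<bar> \<le> L * Re (1 / deriv \<Phi> z)"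
    by (simp_all add: S_def)
qed

section \<open>Powers of sector-valued functions, and limits at the real line\<close>

lemma Im_Ln_le_of_sector:
  assumes "0 < Re u" "\<bar>Im u\<bar> \<le> L * Re u"
  shows "\<bar>Im (Ln u)\<bar> \<le> arctan L"
proof -
  have "u \<noteq> 0" using assms by auto
  then have "Im (Ln u) = arctan (Im u / Re u)"
    using assms arg_conv_arctan[of u] by (simp add: Arg_eq_Im_Ln)
  moreover have "\<bar>Im u / Re u\<bar> \<le> L" using assms by (simp add: abs_divide divide_le_eq)
  ultimately show ?thesis by (simp add: abs_arctan arctan_le_iff)
qed

text \<open>The sector is symmetric about the real axis, and \<open>u\<close> is a positive multiple
  of the conjugate of \<open>1 / u\<close>.\<close>

lemma sector_inverse:
  assumes "0 < Re (1 / u)" "\<bar>Im (1 / u)\<bar> \<le> L * Re (1 / u)"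
  shows "0 < Re u" "\<bar>Im u\<bar> \<le> L * Re u"
proof -
  have u: "u \<noteq> 0" using assms by auto
  then have n: "(norm u)\<^sup>2 > 0" by simp
  have e: "Re (1 / u) = Re u / (norm u)\<^sup>2" "Im (1 / u) = - Im u / (norm u)\<^sup>2"
    by (simp_all add: Re_divide Im_divide cmod_power2)
  show "0 < Re u" using assms(1) n unfolding e by (simp add: zero_less_divide_iff)
  show "\<bar>Im u\<bar> \<le> L * Re u" using assms(2) n unfolding e by (simp add: abs_divide divide_le_cancel)
qed

lemma sector_exponent:
  obtains p where "1 < p" "p * arctan L < pi / 2"
proof -
  have "arctan L < pi / 2" by (rule arctan_ubound)
  then have "1 * arctan L < pi / 2" by simp
  moreover have "((\<lambda>p. p * arctan L) \<longlongrightarrow> 1 * arctan L) (at_right 1)"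
    by (intro tendsto_intros)
  ultimately have "eventually (\<lambda>p. p * arctan L < pi / 2) (at_right (1::real))"
    using order_tendstoD(2) by blast
  then obtain b where "b > 1" "\<And>p. 1 < p \<Longrightarrow> p < b \<Longrightarrow> p * arctan L < pi / 2"
    unfolding eventually_at_right_field by blast
  show thesis by (rule that[OF _ \<open>\<And>p. 1 < p \<Longrightarrow> p < b \<Longrightarrow> p * arctan L < pi / 2\<close>[of "(1 + b) / 2"]]) (use \<open>b > 1\<close> in auto)
qed

text \<open>Some power \<open>f' powr p\<close> with \<open>p > 1\<close> has positive real part and
  hence grows at most like \<open>1 / y\<close>. So \<open>f'\<close> is
  \<open>O(y powr (- 1 / p))\<close>, which is integrable down to \<open>y = 0\<close> and yields
  the Hoelder exponent \<open>q = 1 - 1 / p\<close>, uniformly for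
  \<open>\<bar>x\<bar> \<le> R\<close>.\<close>

lemma vertical_holder_of_sector_derivative:
  assumes f: "\<And>z. Im z > 0 \<Longrightarrow> (f has_field_derivative f' z) (at z)"
    and hol: "f' holomorphic_on upper_half_plane"
    and sec: "\<And>z. Im z > 0 \<Longrightarrow> 0 < Re (f' z)" "\<And>z. Im z > 0 \<Longrightarrow> \<bar>Im (f' z)\<bar> \<le> L * Re (f' z)"
  obtains C q where "0 < q" "\<And>x y y'. \<bar>x\<bar> \<le> R \<Longrightarrow> 0 < y \<Longrightarrow> y \<le> y' \<Longrightarrow> y' \<le> 1 \<Longrightarrow>
      norm (f (Complex x y') - f (Complex x y)) \<le> C * y' powr q"
proof -
  obtain p where p: "1 < p" "p * arctan L < pi / 2" using sector_exponent by blast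
  define G where "G z = exp (of_real p * Ln (f' z))" for z
  have nz: "f' z \<noteq> 0" if "Im z > 0" for z using sec(1)[OF that] by auto
  have Ghol: "G holomorphic_on upper_half_plane"
    unfolding G_def
  proof (intro holomorphic_intros hol)
    fix z assume "z \<in> upper_half_plane"
    then show "f' z \<notin> \<real>\<^sub>\<le>\<^sub>0" using sec(1)[of z] complex_nonpos_Reals_iff by force
  qed
  have Gpos: "Re (G z) > 0" if "Im z > 0" for z
  proof -
    have "\<bar>p * Im (Ln (f' z))\<bar> \<le> p * arctan L"
      using p Im_Ln_le_of_sector[OF sec[OF that]] by (simp add: abs_mult)
    also note p(2)
    finally have "cos (p * Im (Ln (f' z))) > 0" by (intro cos_gt_zero_pi) (auto simp: abs_less_iff)
    then show ?thesis by (simp add: G_def Re_exp)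
  qed
  have normG: "norm (f' z) = norm (G z) powr (1 / p)" if "Im z > 0" for z
    using nz[OF that] p by (simp add: G_def powr_def)
  define q where "q = 1 - 1 / p"
  have q: "0 < q" "q < 1" using p by (auto simp: q_def)
  define K where "K = (norm (G \<i>) * (\<bar>R\<bar> + 2)\<^sup>2) powr (1 / p)"
  have K: "norm (f' (Complex x y)) \<le> K * y powr (q - 1)" if "\<bar>x\<bar> \<le> R" "0 < y" "y \<le> 1" for x y
  proof -
    have "norm (Complex x y + \<i>) \<le> \<bar>R\<bar> + 2"
      using cmod_le[of "Complex x y + \<i>"] that by simp
    then have "norm (G (Complex x y)) \<le> norm (G \<i>) * (\<bar>R\<bar> + 2)\<^sup>2 / y"
      using that by (intro order_trans[OF Re_pos_growth[OF Ghol Gpos]]) (auto intro!: divide_right_mono mult_left_mono power_mono)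
    then have "norm (G (Complex x y)) powr (1 / p) \<le> (norm (G \<i>) * (\<bar>R\<bar> + 2)\<^sup>2 / y) powr (1 / p)"
      using p by (intro powr_mono2) auto
    also have "\<dots> = K * y powr (q - 1)"
      using that by (simp add: K_def q_def powr_divide powr_minus_divide)
    finally show ?thesis using normG that by simp
  qed
  show thesis
  proof (rule that[OF q(1)])
    fix x y y' :: real assume x: "\<bar>x\<bar> \<le> R" and y: "0 < y" "y \<le> y'" "y' \<le> 1"
    show "norm (f (Complex x y') - f (Complex x y)) \<le> K / q * y' powr q"
    proof (cases "y = y'")
      case False
      have fv: "((\<lambda>t. f (Complex x t)) has_vector_derivative \<i> * f' (Complex x t)) (at t)" if "0 < t" for t
        using that by (intro has_vector_derivative_vertical_line f) simp
      have pv: "((\<lambda>t. K / q * t powr q) has_vector_derivative K * t powr (q - 1)) (at t)" if "0 < t" for t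
      proof -
        have "((\<lambda>t. K / q * t powr q) has_real_derivative K / q * (q * t powr (q - 1))) (at t)"
          using has_real_derivative_powr[OF that, of q] by (intro DERIV_cmult)
        then show ?thesis using q by (simp add: has_real_derivative_iff_has_vector_derivative)
      qed
      have "norm (f (Complex x y') - f (Complex x y)) \<le> K / q * y' powr q - K / q * y powr q"
      proof (rule differentiable_bound_general)
        show "y < y'" using False y by simp
        show "continuous_on {y..y'} (\<lambda>t. f (Complex x t))" "continuous_on {y..y'} (\<lambda>t. K / q * t powr q)"
          by (intro continuous_at_imp_continuous_on ballI has_vector_derivative_continuous[OF fv]
                has_vector_derivative_continuous[OF pv]; use y in simp)+
        fix t assume t: "y < t" "t < y'"
        then have "0 < t" "t \<le> 1" using y by auto
        show "((\<lambda>t. f (Complex x t)) has_vector_derivative \<i> * f' (Complex x t)) (at t)"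
          by (rule fv[OF \<open>0 < t\<close>])
        show "((\<lambda>t. K / q * t powr q) has_vector_derivative K * t powr (q - 1)) (at t)"
          by (rule pv[OF \<open>0 < t\<close>])
        show "norm (\<i> * f' (Complex x t)) \<le> K * t powr (q - 1)"
          using K[OF x \<open>0 < t\<close> \<open>t \<le> 1\<close>] by (simp add: norm_mult)
      qed
      also have "\<dots> \<le> K / q * y' powr q" using q by (simp add: K_def)
      finally show ?thesis .
    qed (use q in \<open>simp add: K_def\<close>)
  qed
qed

text \<open>The vertical estimate is uniform in \<open>x\<close>, so \<open>f\<close> near the real
  point is compared with \<open>f\<close> at a fixed small height, where it is continuous. This
  gives an unrestricted limit from within the half-plane, not merely a vertical one.\<close>

lemma boundary_limit_of_sector_derivative:
  assumes f: "\<And>z. Im z > 0 \<Longrightarrow> (f has_field_derivative f' z) (at z)"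
    and hol: "f' holomorphic_on upper_half_plane"
    and sec: "\<And>z. Im z > 0 \<Longrightarrow> 0 < Re (f' z)" "\<And>z. Im z > 0 \<Longrightarrow> \<bar>Im (f' z)\<bar> \<le> L * Re (f' z)"
  shows "\<exists>l. (f \<longlongrightarrow> l) (at (of_real x0) within upper_half_plane)"
proof -
  obtain C q where q: "0 < q" and C: "\<And>x y y'. \<bar>x\<bar> \<le> \<bar>x0\<bar> + 1 \<Longrightarrow> 0 < y \<Longrightarrow> y \<le> y' \<Longrightarrow> y' \<le> 1 \<Longrightarrow>
      norm (f (Complex x y') - f (Complex x y)) \<le> C * y' powr q"
    by (rule vertical_holder_of_sector_derivative[OF f hol sec, of "\<bar>x0\<bar> + 1"]) (assumption | rule that)+
  define u where "u n = f (Complex x0 (1 / (1 + real n)))" for n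
  have "(\<lambda>n. C * (1 / (1 + real n)) powr q) \<longlonglongrightarrow> 0" using q by real_asymp
  note small = this
  have "Cauchy u"
  proof (rule metric_CauchyI)
    fix e :: real assume e: "e > 0"
    obtain N where N: "C * (1 / (1 + real N)) powr q < e / 2"
      using order_tendstoD(2)[OF small, of "e / 2"] e by (auto simp: eventually_sequentially)
    have uN: "norm (u N - u n) < e / 2" if "n \<ge> N" for n
      unfolding u_def by (rule le_less_trans[OF C N]) (use that in \<open>auto simp: divide_simps\<close>)
    show "\<exists>M. \<forall>m\<ge>M. \<forall>n\<ge>M. dist (u m) (u n) < e"
    proof (intro exI[of _ N] allI impI)
      fix m n assume "m \<ge> N" "n \<ge> N"
      then show "dist (u m) (u n) < e"
        using uN[of m] uN[of n] norm_triangle_ineq4[of "u N - u n" "u N - u m"] by (simp add: dist_norm)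
    qed
  qed
  then obtain l where l: "u \<longlonglongrightarrow> l" using Cauchy_convergent convergentD by blast
  have lim0: "norm (f (Complex x0 y) - l) \<le> C * y powr q" if y: "0 < y" "y \<le> 1" for y
  proof (rule tendsto_upperbound)
    show "(\<lambda>n. norm (f (Complex x0 y) - u n)) \<longlonglongrightarrow> norm (f (Complex x0 y) - l)" by (intro tendsto_intros l)
    have "(\<lambda>n. 1 / (1 + real n)) \<longlonglongrightarrow> 0" by real_asymp
    then have "eventually (\<lambda>n. 1 / (1 + real n) < y) sequentially" using y by (intro order_tendstoD(2)) auto
    then show "eventually (\<lambda>n. norm (f (Complex x0 y) - u n) \<le> C * y powr q) sequentially"
      unfolding u_def by eventually_elim (intro C; use y in simp)
  qed simp
  have "(f \<longlongrightarrow> l) (at (of_real x0) within upper_half_plane)"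
  proof (rule tendstoI)
    fix e :: real assume e: "e > 0"
    \<comment> \<open>The vertical estimate is spent twice, once at \<open>Re z\<close> and once at
      \<open>x0\<close>; the horizontal move at height \<open>y\<close> takes the last
      third.\<close>
    obtain N where N: "C * (1 / (1 + real N)) powr q < e / 3"
      using order_tendstoD(2)[OF small, of "e / 3"] e by (auto simp: eventually_sequentially)
    define y where "y = 1 / (1 + real N)"
    have y: "0 < y" "y \<le> 1" by (auto simp: y_def)
    have "isCont f (Complex x0 y)" using f[of "Complex x0 y"] y by (auto intro: DERIV_isCont)
    then have "((\<lambda>x. f (Complex x y)) \<longlongrightarrow> f (Complex x0 y)) (at x0)"
      by (rule isCont_tendsto_compose) (intro tendsto_intros)
    then have "eventually (\<lambda>x. dist (f (Complex x y)) (f (Complex x0 y)) < e / 3) (at x0)"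
      using e by (intro tendstoD) auto
    then obtain d where d: "d > 0" "\<And>x. x \<noteq> x0 \<Longrightarrow> dist x x0 < d \<Longrightarrow> dist (f (Complex x y)) (f (Complex x0 y)) < e / 3"
      unfolding eventually_at by blast
    show "eventually (\<lambda>z. dist (f z) l < e) (at (of_real x0) within upper_half_plane)"
      unfolding eventually_at
    proof (intro exI[of _ "min (min d y) 1"] conjI ballI impI)
      show "0 < min (min d y) 1" using d y by simp
      fix z assume zH: "z \<in> upper_half_plane" and z: "z \<noteq> of_real x0 \<and> dist z (of_real x0) < min (min d y) 1"
      have re: "\<bar>Re z - x0\<bar> < min (min d y) 1" and im: "Im z < min (min d y) 1"
        using abs_Re_le_cmod[of "z - of_real x0"] abs_Im_le_cmod[of "z - of_real x0"] z by (auto simp: dist_norm)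
      have 1: "norm (f (Complex (Re z) y) - f (Complex (Re z) (Im z))) \<le> C * y powr q"
        using re im zH y by (intro C) auto
      have 2: "norm (f (Complex (Re z) y) - f (Complex x0 y)) < e / 3"
        using d(2)[of "Re z"] re e by (cases "Re z = x0") (auto simp: dist_norm)
      have 3: "norm (f (Complex x0 y) - l) \<le> C * y powr q" by (rule lim0[OF y])
      have "norm (f z - l) \<le> norm (f (Complex (Re z) y) - f z) + norm (f (Complex (Re z) y) - f (Complex x0 y)) + norm (f (Complex x0 y) - l)"
        by norm
      then show "dist (f z) l < e" using 1 2 3 N by (simp add: dist_norm y_def)
    qed
  qed
  then show ?thesis by blast
qed

lemma filterlim_vertical_within_upper_half_plane:
  "filterlim (\<lambda>n. Complex x (1 / (1 + real n))) (at (complex_of_real x) within upper_half_plane) sequentially"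
  unfolding filterlim_at
proof (intro conjI always_eventually allI)
  have "(\<lambda>n. 1 / (1 + real n)) \<longlonglongrightarrow> 0" by real_asymp
  then show "(\<lambda>n. Complex x (1 / (1 + real n))) \<longlonglongrightarrow> complex_of_real x"
    using tendsto_Complex[OF tendsto_const, of _ 0 sequentially x] by (simp add: complex_of_real_def)
qed (auto simp: complex_eq_iff)

lemma at_real_within_upper_half_plane_nontrivial:
  "at (complex_of_real x) within upper_half_plane \<noteq> bot"
  using filterlim_vertical_within_upper_half_plane[of x]
  by (auto simp: filterlim_def bot_unique filtermap_bot_iff)

text \<open>If the preimages \<open>w n\<close> accumulated at a real point \<open>p\<close>, then \<open>\<lambda>u. \<Phi> (p - 1 / u)\<close> would have a
  sector-valued derivative and so a finite limit at \<open>0\<close>, contradicting \<open>\<Phi>(\<infinity>) = \<infinity>\<close>.\<close>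

lemma sector_derivative:
  assumes lip: "L-lipschitz_on UNIV \<gamma>" and L: "L > 0" and conf: "associated_conformal_map \<gamma> \<Phi>"
    and z: "Im z > 0"
  shows "0 < Re (1 / deriv \<Phi> z)" "\<bar>Im (1 / deriv \<Phi> z)\<bar> \<le> L * Re (1 / deriv \<Phi> z)"
proof -
  let ?H = upper_half_plane and ?\<Omega> = "graph_domain \<gamma>"
  have hol: "\<Phi> holomorphic_on ?H" and bij: "bij_betw \<Phi> ?H ?\<Omega>"
    and inf: "filterlim \<Phi> at_infinity (inf at_infinity (principal ?H))"
    using conf by (auto simp: associated_conformal_map_def)
  have img: "\<Phi> ` ?H = ?\<Omega>" using bij by (auto simp: bij_betw_def)
  have "\<exists>w. Im w > 0 \<and> \<Phi> w = Complex 0 (\<gamma> 0 + (1 + real n))" for n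
  proof -
    have "Complex 0 (\<gamma> 0 + (1 + real n)) \<in> ?\<Omega>" by (simp add: graph_domain_def)
    then show ?thesis using img by (metis (no_types, lifting) imageE upper_half_plane_iff)
  qed
  then obtain w where w: "\<And>n. Im (w n) > 0" "\<And>n. \<Phi> (w n) = Complex 0 (\<gamma> 0 + (1 + real n))" by metis
  have r: "filterlim (\<lambda>n. 1 + real n) at_top sequentially" by real_asymp
  have "filterlim (\<lambda>n. norm (w n)) at_top sequentially"
  proof (rule ccontr)
    assume "\<not> filterlim (\<lambda>n. norm (w n)) at_top sequentially"
    then obtain B where B: "\<exists>\<^sub>F n in sequentially. norm (w n) < B"
      unfolding filterlim_at_top by (auto simp: not_eventually not_le)
    then have "infinite {n. norm (w n) < B}" by (simp add: frequently_cofinite cofinite_eq_sequentially[symmetric])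
    from infinite_enumerate[OF this] obtain s0 :: "nat \<Rightarrow> nat" where s0: "strict_mono s0" "\<And>n. norm (w (s0 n)) < B"
      by auto
    have "compact (cball (0::complex) B)" by simp
    then obtain p s1 where p: "p \<in> cball 0 B" and s1: "strict_mono (s1::nat\<Rightarrow>nat)" and lim: "((\<lambda>n. w (s0 n)) \<circ> s1) \<longlonglongrightarrow> p"
      using s0(2) unfolding compact_def by (metis (no_types, lifting) less_imp_le mem_cball_0)
    define s where "s = s0 \<circ> s1"
    have s: "strict_mono s" unfolding s_def using s0(1) s1 by (rule strict_mono_o)
    have ws: "(\<lambda>n. w (s n)) \<longlonglongrightarrow> p" using lim by (simp add: s_def o_def)
    have rs: "filterlim (\<lambda>n. 1 + real (s n)) at_top sequentially"
      using filterlim_compose[OF r filterlim_subseq[OF s]] .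
    have "Im p \<ge> 0" 
      by (rule tendsto_lowerbound[OF tendsto_Im[OF ws]]) (auto intro!: always_eventually less_imp_le w(1))
    \<comment> \<open>At an interior point \<open>\<Phi>\<close> is continuous, while
      \<open>\<Phi> (w (s n))\<close> is unbounded.\<close>
    moreover have "\<not> Im p > 0"
    proof
      assume "Im p > 0"
      then have "isCont \<Phi> p" using holomorphic_on_imp_continuous_on[OF hol] by (simp add: continuous_on_eq_continuous_at)
      then have "(\<lambda>n. Im (\<Phi> (w (s n)))) \<longlonglongrightarrow> Im (\<Phi> p)" by (intro tendsto_Im isCont_tendsto_compose[OF _ ws])
      then have "(\<lambda>n. (1 + real (s n))) \<longlonglongrightarrow> Im (\<Phi> p) - \<gamma> 0" 
        using tendsto_diff[OF _ tendsto_const, of "\<lambda>n. Im (\<Phi> (w (s n)))" "Im (\<Phi> p)" sequentially "\<gamma> 0"] by (simp add: w)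
      then show False using rs not_tendsto_and_filterlim_at_infinity[OF _ _ filterlim_at_top_imp_at_infinity] by (metis sequentially_bot)
    qed
    ultimately have Imp: "Im p = 0" by simp
    \<comment> \<open>A Moebius automorphism of the half-plane taking 0 to infinity and infinity to
      \<open>p\<close>; \<open>\<nu>\<close> is its inverse.\<close>
    define \<mu> where "\<mu> u = p - 1 / u" for u :: complex
    have \<mu>: "Im (\<mu> u) > 0" if "Im u > 0" for u
    proof -
      have "(Re u)\<^sup>2 + (Im u)\<^sup>2 > 0" using that by (simp add: add_nonneg_pos)
      then show ?thesis using that Imp by (simp add: \<mu>_def Im_divide)
    qed
    define \<nu> where "\<nu> u = - 1 / (u - p)" for u :: complex
    have \<nu>: "Im (\<nu> u) > 0" if "Im u > 0" for u
    proof -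
      have "(Re u - Re p)\<^sup>2 + (Im u)\<^sup>2 > 0" using that by (simp add: add_nonneg_pos)
      then show ?thesis using that Imp by (simp add: \<nu>_def Im_divide)
    qed
    have \<mu>\<nu>: "\<mu> (\<nu> u) = u" "\<nu> (\<mu> u) = u" if "Im u > 0" for u
    proof -
      have "u \<noteq> p" "u \<noteq> 0" using that Imp by auto
      then show "\<mu> (\<nu> u) = u" "\<nu> (\<mu> u) = u" by (simp_all add: \<mu>_def \<nu>_def)
    qed
    have "bij_betw \<mu> ?H ?H"
      by (rule bij_betw_byWitness[where f'=\<nu>]) (use \<mu> \<nu> \<mu>\<nu> in auto)
    then have bij2: "bij_betw (\<Phi> \<circ> \<mu>) ?H ?\<Omega>" using bij by (rule bij_betw_trans)
    have hol2: "\<Phi> \<circ> \<mu> holomorphic_on ?H"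
    proof (rule holomorphic_on_compose_gen[OF _ hol])
      show "\<mu> holomorphic_on ?H" unfolding \<mu>_def by (intro holomorphic_intros) auto
    qed (use \<mu> in auto)
    have winf: "filterlim (\<lambda>n. norm (\<nu> (w (s n)))) at_top sequentially"
    proof -
      have "(\<lambda>n. norm (w (s n) - p)) \<longlonglongrightarrow> 0" using tendsto_norm[OF LIM_zero[OF ws]] by simp
      moreover have "norm (w (s n) - p) > 0" for n using w(1)[of "s n"] Imp by auto
      ultimately have "filterlim (\<lambda>n. inverse (norm (w (s n) - p))) at_top sequentially"
        by (intro filterlim_inverse_at_top always_eventually allI)
      then show ?thesis by (simp add: \<nu>_def norm_divide inverse_eq_divide)
    qed
    \<comment> \<open>After the change of variable the preimages \<open>\<nu> (w (s n))\<close> do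
      tend to infinity, so the sector estimate holds for
      \<open>\<Phi> \<circ> \<mu>\<close>.\<close>
    note sec = sector_derivative_aux[OF lip L hol2 bij2 rs, where w="\<lambda>n. \<nu> (w (s n))", OF _ _ _ winf]
    have w2: "Im (\<nu> (w (s n))) > 0" "(\<Phi> \<circ> \<mu>) (\<nu> (w (s n))) = Complex 0 (\<gamma> 0 + (1 + real (s n)))" for n
      using \<nu> \<mu>\<nu> w by auto
    have sec1: "0 < Re (1 / deriv (\<Phi> \<circ> \<mu>) z)" "\<bar>Im (1 / deriv (\<Phi> \<circ> \<mu>) z)\<bar> \<le> L * Re (1 / deriv (\<Phi> \<circ> \<mu>) z)" if "Im z > 0" for z
      using sec[of z] w2 that by auto
    obtain l where l: "((\<Phi> \<circ> \<mu>) \<longlongrightarrow> l) (at (of_real 0) within ?H)"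
      using boundary_limit_of_sector_derivative[where f="\<Phi> \<circ> \<mu>" and f'="deriv (\<Phi> \<circ> \<mu>)" and L=L and ?x0.0=0]
        sector_inverse[OF sec1] holomorphic_derivI[OF hol2 open_upper_half_plane] holomorphic_deriv[OF hol2 open_upper_half_plane]
      by (metis upper_half_plane_iff)
    have "filterlim \<mu> (inf at_infinity (principal ?H)) (at (of_real 0) within ?H)"
    proof (rule filterlim_inf[THEN iffD2], intro conjI)
      have "filterlim uminus (at 0) (at (0 :: complex))"
        by (intro filterlim_atI tendsto_eq_intros) (auto simp: eventually_at_filter)
      then have "filterlim (\<lambda>u. p + inverse (- u)) at_infinity (at 0)"
        by (intro tendsto_add_filterlim_at_infinity[OF tendsto_const] filterlim_compose[OF filterlim_inverse_at_infinity])
      moreover have "\<mu> = (\<lambda>u. p + inverse (- u))" by (simp add: fun_eq_iff \<mu>_def inverse_eq_divide)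
      ultimately show "filterlim \<mu> at_infinity (at (of_real 0) within ?H)"
        unfolding of_real_0 using filterlim_mono[OF _ order_refl at_le[OF subset_UNIV]] by metis
      show "filterlim \<mu> (principal ?H) (at (of_real 0) within ?H)"
        unfolding filterlim_principal by (auto simp: eventually_at_filter \<mu>)
    qed
    from filterlim_compose[OF inf this] have "filterlim (\<Phi> \<circ> \<mu>) at_infinity (at (of_real 0) within ?H)" by (simp add: o_def)
    then show False
      using not_tendsto_and_filterlim_at_infinity[OF at_real_within_upper_half_plane_nontrivial l] by blast
  qed
  from sector_derivative_aux[OF lip L hol bij r _ w this z]
  show "0 < Re (1 / deriv \<Phi> z)" "\<bar>Im (1 / deriv \<Phi> z)\<bar> \<le> L * Re (1 / deriv \<Phi> z)" by auto
qed

section \<open>Boundary values of sector-valued functions\<close>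

text \<open>The limit is taken along a sequence, so that \<open>vertical_limit F\<close> is Borel
  measurable for every holomorphic \<open>F\<close>, with no prior knowledge of where the limit
  exists.\<close>

definition vertical_limit :: "(complex \<Rightarrow> complex) \<Rightarrow> real \<Rightarrow> complex" where
  "vertical_limit F x = lim (\<lambda>n. F (Complex x (1 / (1 + real n))))"

lemma filterlim_inverse_Suc_at_right: "filterlim (\<lambda>n. 1 / (1 + real n)) (at_right 0) sequentially"
  by real_asymp

lemma vertical_limit_eqI:
  assumes "((\<lambda>y. F (Complex x y)) \<longlongrightarrow> l) (at_right 0)"
  shows "vertical_limit F x = l" "(\<lambda>n. F (Complex x (1 / (1 + real n)))) \<longlonglongrightarrow> l"
proof -
  show "(\<lambda>n. F (Complex x (1 / (1 + real n)))) \<longlonglongrightarrow> l"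
    by (rule filterlim_compose[OF assms filterlim_inverse_Suc_at_right])
  then show "vertical_limit F x = l" unfolding vertical_limit_def by (rule limI)
qed

lemma borel_measurable_vertical_limit [measurable]:
  assumes "F holomorphic_on upper_half_plane"
  shows "vertical_limit F \<in> borel_measurable borel"
  unfolding vertical_limit_def[abs_def]
  by (intro borel_measurable_lim_metric borel_measurable_upper_horizontal assms) simp

text \<open>The kernel \<open>1 / (1 + t\<^sup>2)\<close> is the Poisson kernel of the point at
  height 1 above the line. The bounds come from the points
  \<open>Complex 0 (1 + 1 / (1 + real n))\<close>, which converge inside the half-plane.\<close>

lemma nn_integral_exp_horizontal_bounded:
  assumes hol: "\<Lambda> holomorphic_on upper_half_plane" and th: "\<theta> < pi / 2"
    and bd: "\<And>z. Im z > 0 \<Longrightarrow> \<bar>Im (\<Lambda> z)\<bar> \<le> \<theta>"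
  shows "\<exists>C. \<forall>n. (\<integral>\<^sup>+t. ennreal (1 / (1 + t\<^sup>2) * exp (Re (\<Lambda> (Complex t (1 / (1 + real n)))))) \<partial>lborel) \<le> ennreal C"
proof -
  define u where "u n = pi / cos \<theta> * exp (Re (\<Lambda> (Complex 0 (1 + 1 / (1 + real n)))))" for n
  have "u \<longlonglongrightarrow> pi / cos \<theta> * exp (Re (\<Lambda> (Complex 0 1)))"
    unfolding u_def by (intro tendsto_intros LIMSEQ_holomorphic_upper_vertical hol) simp
  then have "Bseq u" by (rule convergent_imp_Bseq[OF convergentI])
  then obtain C where C: "\<And>n. norm (u n) \<le> C" by (auto simp: Bseq_def)
  have "(\<integral>\<^sup>+t. ennreal (1 / (1 + t\<^sup>2) * exp (Re (\<Lambda> (Complex t (1 / (1 + real n)))))) \<partial>lborel) \<le> ennreal C" for n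
  proof -
    have "(\<integral>\<^sup>+t. ennreal (1 / ((t - 0)\<^sup>2 + 1\<^sup>2) * exp (Re (\<Lambda> (Complex t (1 / (1 + real n)))))) \<partial>lborel)
       \<le> ennreal (pi / cos \<theta> * exp (Re (\<Lambda> (Complex 0 (1 / (1 + real n) + 1)))))"
      by (rule nn_integral_exp_le[OF hol th bd]) auto
    also have "pi / cos \<theta> * exp (Re (\<Lambda> (Complex 0 (1 / (1 + real n) + 1)))) = u n" by (simp add: u_def add.commute)
    also have "ennreal (u n) \<le> ennreal C" using C[of n] by (intro ennreal_leI) auto
    finally show ?thesis by (simp add: add.commute)
  qed
  then show ?thesis by blast
qed

lemma sector_Ln_holomorphic:
  assumes hol: "F holomorphic_on upper_half_plane" and pos: "\<And>z. Im z > 0 \<Longrightarrow> 0 < Re (F z)"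
  shows "(\<lambda>z. Ln (F z)) holomorphic_on upper_half_plane"
proof (intro holomorphic_intros hol)
  fix z assume "z \<in> upper_half_plane"
  then show "F z \<notin> \<real>\<^sub>\<le>\<^sub>0" using pos[of z] complex_nonpos_Reals_iff by force
qed

lemma nn_integral_sector_powr_bounded:
  assumes hol: "F holomorphic_on upper_half_plane"
    and sec: "\<And>z. Im z > 0 \<Longrightarrow> 0 < Re (F z)" "\<And>z. Im z > 0 \<Longrightarrow> \<bar>Im (F z)\<bar> \<le> L * Re (F z)"
    and p: "0 < p" "p * arctan L < pi / 2"
  shows "\<exists>C. \<forall>n. (\<integral>\<^sup>+t. ennreal (1 / (1 + t\<^sup>2) * norm (F (Complex t (1 / (1 + real n)))) powr p) \<partial>lborel) \<le> ennreal C"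
proof -
  have bd: "\<bar>Im (of_real p * Ln (F z))\<bar> \<le> p * arctan L" if "Im z > 0" for z
    using p Im_Ln_le_of_sector[OF sec[OF that]] by (simp add: abs_mult)
  have hol': "(\<lambda>z. of_real p * Ln (F z)) holomorphic_on upper_half_plane"
    by (intro holomorphic_intros sector_Ln_holomorphic hol sec)
  have "exp (Re (of_real p * Ln (F z))) = norm (F z) powr p" if "Im z > 0" for z
  proof -
    have "F z \<noteq> 0" using sec(1)[OF that] by auto
    then show ?thesis by (simp add: powr_def)
  qed
  then have "exp (Re (of_real p * Ln (F (Complex t (1 / (1 + real n)))))) = norm (F (Complex t (1 / (1 + real n)))) powr p" for t n
    by simp
  then show ?thesis using nn_integral_exp_horizontal_bounded[OF hol' p(2)] bd by simp
qed

lemma norm_le_of_sector: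
  assumes "0 < Re u" "\<bar>Im u\<bar> \<le> L * Re u"
  shows "norm u \<le> (1 + L) * Re u"
proof -
  have "norm u \<le> \<bar>Re u\<bar> + \<bar>Im u\<bar>" by (rule cmod_le)
  also have "\<dots> \<le> Re u + L * Re u" using assms by simp
  finally show ?thesis by (simp add: algebra_simps)
qed

text \<open>In the sector the modulus is at most \<open>1 + L\<close> times the real part, also for
  the boundary values, and Poisson integrals of the real part are controlled by
  \<open>poisson_liminf_le\<close>.\<close>

lemma poisson_vertical_limit_le:
  assumes hol: "F holomorphic_on upper_half_plane"
    and sec: "\<And>z. Im z > 0 \<Longrightarrow> 0 < Re (F z)" "\<And>z. Im z > 0 \<Longrightarrow> \<bar>Im (F z)\<bar> \<le> L * Re (F z)"
    and y: "0 < y"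
  shows "(\<integral>\<^sup>+t. ennreal (poisson x y t * norm (vertical_limit F t)) \<partial>lborel) \<le> ennreal (pi * (1 + L) * Re (F (Complex x y)))"
proof -
  have L: "0 \<le> 1 + L"
  proof -
    have "0 \<le> L * Re (F \<i>)" using sec(2)[of \<i>] by simp
    then show ?thesis using sec(1)[of \<i>] by (simp add: zero_le_mult_iff)
  qed
  have pos: "0 \<le> Re (F z)" if "Im z > 0" for z using sec(1)[OF that] by simp
  have "AE t in lborel. ennreal (norm (vertical_limit F t)) \<le> ennreal (1 + L) * liminf (\<lambda>n. ennreal (Re (F (Complex t (1 / (1 + real n))))))"
    using AE_vertical_limit_Re_nonneg[OF hol, OF pos, simplified]
  proof eventually_elim
    case (elim t)
    then obtain l where l: "((\<lambda>y. F (Complex t y)) \<longlongrightarrow> l) (at_right 0)" by blast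
    note l' = vertical_limit_eqI[OF l]
    have "norm l \<le> (1 + L) * Re l"
      by (rule LIMSEQ_le[OF tendsto_norm[OF l'(2)] tendsto_mult[OF tendsto_const tendsto_Re[OF l'(2)]]])
         (auto intro!: norm_le_of_sector sec)
    moreover have "liminf (\<lambda>n. ennreal (Re (F (Complex t (1 / (1 + real n)))))) = ennreal (Re l)"
      by (intro lim_imp_Liminf tendsto_ennrealI tendsto_Re l'(2)) simp
    ultimately show ?case using L by (simp add: l'(1) ennreal_mult'[symmetric] ennreal_leI)
  qed
  then have "(\<integral>\<^sup>+t. ennreal (poisson x y t * norm (vertical_limit F t)) \<partial>lborel) \<le>
    (\<integral>\<^sup>+t. ennreal (1 + L) * (ennreal (poisson x y t) * liminf (\<lambda>n. ennreal (Re (F (Complex t (1 / (1 + real n))))))) \<partial>lborel)"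
  proof (intro nn_integral_mono_AE, eventually_elim)
    case (elim t)
    have "ennreal (poisson x y t * norm (vertical_limit F t)) = ennreal (poisson x y t) * ennreal (norm (vertical_limit F t))"
      using y by (intro ennreal_mult) auto
    also have "\<dots> \<le> ennreal (poisson x y t) * (ennreal (1 + L) * liminf (\<lambda>n. ennreal (Re (F (Complex t (1 / (1 + real n)))))))"
      by (intro mult_left_mono elim) simp
    finally show ?case by (simp add: mult_ac)
  qed
  also have "\<dots> = ennreal (1 + L) * (\<integral>\<^sup>+t. ennreal (poisson x y t) * liminf (\<lambda>n. ennreal (Re (F (Complex t (1 / (1 + real n)))))) \<partial>lborel)"
  proof (rule nn_integral_cmult)
    have [measurable]: "(\<lambda>t. F (Complex t (1 / (1 + real n)))) \<in> borel_measurable borel" for n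
      by (intro borel_measurable_upper_horizontal hol) simp
    show "(\<lambda>t. ennreal (poisson x y t) * liminf (\<lambda>n. ennreal (Re (F (Complex t (1 / (1 + real n))))))) \<in> borel_measurable lborel"
      by measurable
  qed
  also have "\<dots> \<le> ennreal (1 + L) * ennreal (pi * Re (F (Complex x y)))"
    by (intro mult_left_mono poisson_liminf_le hol y pos) auto
  also have "\<dots> = ennreal (pi * (1 + L) * Re (F (Complex x y)))"
    using L by (simp add: ennreal_mult'[symmetric] mult_ac)
  finally show ?thesis .
qed

section \<open>Limits of integrals on the line under a weighted \<open>L\<^sup>p\<close> bound, and
  the boundary derivative\<close>

definition cauchy_measure :: "real measure" where
  "cauchy_measure = density lborel (\<lambda>t. ennreal (1 / (1 + t\<^sup>2)))"

lemma sets_cauchy_measure [simp, measurable_cong]: "sets cauchy_measure = sets borel"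
  by (simp add: cauchy_measure_def)

lemma space_cauchy_measure [simp]: "space cauchy_measure = UNIV"
  by (simp add: cauchy_measure_def)

lemma finite_measure_cauchy_measure: "finite_measure cauchy_measure"
proof
  have "emeasure cauchy_measure (space cauchy_measure) = (\<integral>\<^sup>+t. ennreal (1 / (1 + t\<^sup>2)) \<partial>lborel)"
    by (simp add: cauchy_measure_def emeasure_density)
  also have "\<dots> = ennreal pi"
    using has_bochner_integral_inverse_1_plus_square
    by (subst nn_integral_eq_integral) (auto simp: has_bochner_integral_iff)
  finally show "emeasure cauchy_measure (space cauchy_measure) \<noteq> \<infinity>" by simp
qed

lemma AE_cauchy_measure: "AE x in lborel. P x \<Longrightarrow> AE x in cauchy_measure. P x"
  unfolding cauchy_measure_def by (subst AE_density) auto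

lemma nn_integral_cauchy_measure:
  assumes "f \<in> borel_measurable borel"
  shows "(\<integral>\<^sup>+t. f t \<partial>cauchy_measure) = (\<integral>\<^sup>+t. ennreal (1 / (1 + t\<^sup>2)) * f t \<partial>lborel)"
  using assms unfolding cauchy_measure_def by (subst nn_integral_density) auto

text \<open>Boundedness in \<open>L\<^sup>p (dt / (1 + t\<^sup>2))\<close> for some \<open>p > 1\<close> takes the place of a dominating function.\<close>

lemma tendsto_integral_lborel_of_bounded_powr:
  fixes a :: "nat \<Rightarrow> real \<Rightarrow> complex"
  assumes [measurable]: "\<And>n. a n \<in> borel_measurable borel" "b \<in> borel_measurable borel"
    and lim: "AE x in lborel. (\<lambda>n. a n x) \<longlonglongrightarrow> b x" and p: "1 < p"
    and bd: "\<And>n. (\<integral>\<^sup>+t. ennreal (1 / (1 + t\<^sup>2) * norm ((1 + t\<^sup>2) *\<^sub>R a n t) powr p) \<partial>lborel) \<le> ennreal C"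
  shows "integrable lborel b" "(\<lambda>n. \<integral>x. a n x \<partial>lborel) \<longlonglongrightarrow> (\<integral>x. b x \<partial>lborel)"
proof -
  interpret finite_measure cauchy_measure by (rule finite_measure_cauchy_measure)
  have pos: "1 + t\<^sup>2 \<noteq> 0" "0 \<le> 1 / (1 + t\<^sup>2)" for t :: real
    by (simp_all add: add_nonneg_eq_0_iff)
  have lim': "AE x in cauchy_measure. (\<lambda>n. (1 + x\<^sup>2) *\<^sub>R a n x) \<longlonglongrightarrow> (1 + x\<^sup>2) *\<^sub>R b x"
    by (rule AE_mp[OF AE_cauchy_measure[OF lim]]) (auto intro!: tendsto_intros)
  have bd': "(\<integral>\<^sup>+t. ennreal (norm ((1 + t\<^sup>2) *\<^sub>R a n t) powr p) \<partial>cauchy_measure) \<le> ennreal C" for n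
  proof -
    have "(\<integral>\<^sup>+t. ennreal (norm ((1 + t\<^sup>2) *\<^sub>R a n t) powr p) \<partial>cauchy_measure)
      = (\<integral>\<^sup>+t. ennreal (1 / (1 + t\<^sup>2)) * ennreal (norm ((1 + t\<^sup>2) *\<^sub>R a n t) powr p) \<partial>lborel)"
      by (rule nn_integral_cauchy_measure) measurable
    also have "\<dots> = (\<integral>\<^sup>+t. ennreal (1 / (1 + t\<^sup>2) * norm ((1 + t\<^sup>2) *\<^sub>R a n t) powr p) \<partial>lborel)"
      by (intro nn_integral_cong ennreal_mult[symmetric] pos) simp
    finally show ?thesis using bd by simp
  qed
  have m: "(\<lambda>t. (1 + t\<^sup>2) *\<^sub>R a n t) \<in> borel_measurable cauchy_measure" "(\<lambda>t. (1 + t\<^sup>2) *\<^sub>R b t) \<in> borel_measurable cauchy_measure" for n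
    by measurable
  note U = tendsto_integral_of_bounded_powr[OF m lim' p bd']
  have conv: "integrable cauchy_measure (\<lambda>t. (1 + t\<^sup>2) *\<^sub>R u t) \<longleftrightarrow> integrable lborel u"
    "(\<integral>t. (1 + t\<^sup>2) *\<^sub>R u t \<partial>cauchy_measure) = (\<integral>t. u t \<partial>lborel)"
    if [measurable]: "u \<in> borel_measurable borel" for u :: "real \<Rightarrow> complex"
    unfolding cauchy_measure_def using pos
    by (subst integrable_density integral_density; simp add: divide_inverse)+
  show "integrable lborel b" using U(1) conv(1)[of b] by simp
  show "(\<lambda>n. \<integral>x. a n x \<partial>lborel) \<longlonglongrightarrow> (\<integral>x. b x \<partial>lborel)" using U(3) by (simp add: conv(2))
qed

text \<open>The fundamental theorem of calculus on horizontal segments passes to the real line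
  thanks to the \<open>L\<^sup>p\<close> bound on \<open>deriv \<Phi>\<close>. Hence the boundary
  map is an indefinite integral of the vertical limit, which is recovered as its derivative at
  Lebesgue points. In particular the boundary map is locally absolutely continuous.\<close>

lemma AE_boundary_deriv_eq:
  assumes hol: "\<Phi> holomorphic_on upper_half_plane"
    and sec: "\<And>z. Im z > 0 \<Longrightarrow> 0 < Re (deriv \<Phi> z)" "\<And>z. Im z > 0 \<Longrightarrow> \<bar>Im (deriv \<Phi> z)\<bar> \<le> L * Re (deriv \<Phi> z)"
  shows "AE x in lborel. boundary_deriv \<Phi> x = vertical_limit (deriv \<Phi>) x"
proof -
  let ?c = "\<lambda>n. 1 / (1 + real n)"
  have d: "(\<Phi> has_field_derivative deriv \<Phi> z) (at z)" if "Im z > 0" for z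
    using holomorphic_derivI[OF hol open_upper_half_plane] that by simp
  have hol': "deriv \<Phi> holomorphic_on upper_half_plane" by (rule holomorphic_deriv[OF hol open_upper_half_plane])
  obtain p where p: "1 < p" "p * arctan L < pi / 2" using sector_exponent by blast
  have "\<exists>C. \<forall>n. (\<integral>\<^sup>+t. ennreal (1 / (1 + t\<^sup>2) * norm (deriv \<Phi> (Complex t (?c n))) powr p) \<partial>lborel) \<le> ennreal C"
    by (rule nn_integral_sector_powr_bounded[OF hol' sec]) (use p in auto)
  then obtain C where C: "\<And>n. (\<integral>\<^sup>+t. ennreal (1 / (1 + t\<^sup>2) * norm (deriv \<Phi> (Complex t (?c n))) powr p) \<partial>lborel) \<le> ennreal C"
    by blast
  have pos: "0 \<le> Re (deriv \<Phi> z)" if "Im z > 0" for z using sec(1)[OF that] by simp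
  define \<phi> where "\<phi> = vertical_limit (deriv \<Phi>)"
  have [measurable]: "\<phi> \<in> borel_measurable borel" unfolding \<phi>_def by (rule borel_measurable_vertical_limit[OF hol'])
  have [measurable]: "(\<lambda>t. deriv \<Phi> (Complex t (?c n))) \<in> borel_measurable borel" for n
    by (intro borel_measurable_upper_horizontal hol') simp
  define b where "b = boundary_map \<Phi>"
  have b: "(\<lambda>n. \<Phi> (Complex x (?c n))) \<longlonglongrightarrow> b x" for x
  proof -
    obtain l where l: "(\<Phi> \<longlongrightarrow> l) (at (of_real x) within upper_half_plane)"
      using boundary_limit_of_sector_derivative[OF d hol' sec, of x] by auto
    then have "b x = l" unfolding b_def boundary_map_def
      by (rule tendsto_Lim[OF at_real_within_upper_half_plane_nontrivial])
    with filterlim_compose[OF l filterlim_vertical_within_upper_half_plane] show ?thesis by simp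
  qed
  have ftc: "integrable lborel (\<lambda>t. indicator {x1..x2} t *\<^sub>R \<phi> t)"
     "b x2 - b x1 = (\<integral>t. indicator {x1..x2} t *\<^sub>R \<phi> t \<partial>lborel)" if le: "x1 \<le> x2" for x1 x2
  proof -
    \<comment> \<open>An upper bound for \<open>1 + t\<^sup>2\<close> on the interval
      \<open>{x1..x2}\<close>, used to remove this weight.\<close>
    define R where "R = 1 + x1\<^sup>2 + x2\<^sup>2"
    have R: "R \<ge> 0" by (simp add: R_def)
    have lim: "AE t in lborel. (\<lambda>n. indicator {x1..x2} t *\<^sub>R deriv \<Phi> (Complex t (?c n))) \<longlonglongrightarrow> indicator {x1..x2} t *\<^sub>R \<phi> t"
      using AE_vertical_limit_Re_nonneg[OF hol', OF pos, simplified]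
    proof eventually_elim
      case (elim t)
      then obtain l where l: "((\<lambda>y. deriv \<Phi> (Complex t y)) \<longlongrightarrow> l) (at_right 0)" by blast
      show ?case unfolding \<phi>_def vertical_limit_eqI(1)[OF l] by (intro tendsto_intros vertical_limit_eqI(2)[OF l])
    qed
    have bd: "(\<integral>\<^sup>+t. ennreal (1 / (1 + t\<^sup>2) * norm ((1 + t\<^sup>2) *\<^sub>R (indicator {x1..x2} t *\<^sub>R deriv \<Phi> (Complex t (?c n)))) powr p) \<partial>lborel) \<le> ennreal (R powr p * \<bar>C\<bar>)" for n
    proof -
      have "(\<integral>\<^sup>+t. ennreal (1 / (1 + t\<^sup>2) * norm ((1 + t\<^sup>2) *\<^sub>R (indicator {x1..x2} t *\<^sub>R deriv \<Phi> (Complex t (?c n)))) powr p) \<partial>lborel)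
        \<le> (\<integral>\<^sup>+t. ennreal (R powr p) * ennreal (1 / (1 + t\<^sup>2) * norm (deriv \<Phi> (Complex t (?c n))) powr p) \<partial>lborel)"
      proof (rule nn_integral_mono)
        fix t
        let ?N = "norm (deriv \<Phi> (Complex t (?c n)))"
        have "norm ((1 + t\<^sup>2) *\<^sub>R (indicator {x1..x2} t *\<^sub>R deriv \<Phi> (Complex t (?c n)))) \<le> R * ?N"
        proof (cases "t \<in> {x1..x2}")
          case True
          then have "\<bar>t\<bar> \<le> \<bar>x1\<bar> \<or> \<bar>t\<bar> \<le> \<bar>x2\<bar>" by auto
          then have "t\<^sup>2 \<le> x1\<^sup>2 \<or> t\<^sup>2 \<le> x2\<^sup>2" by (simp add: abs_le_square_iff)
          then have "1 + t\<^sup>2 \<le> R" unfolding R_def using zero_le_power2[of x1] zero_le_power2[of x2] by linarith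
          then show ?thesis using True by (simp add: mult_right_mono abs_of_nonneg)
        qed (use R in simp)
        then have "norm ((1 + t\<^sup>2) *\<^sub>R (indicator {x1..x2} t *\<^sub>R deriv \<Phi> (Complex t (?c n)))) powr p \<le> (R * ?N) powr p"
          using p by (intro powr_mono2) auto
        also have "\<dots> = R powr p * ?N powr p" using R by (simp add: powr_mult)
        finally have "1 / (1 + t\<^sup>2) * norm ((1 + t\<^sup>2) *\<^sub>R (indicator {x1..x2} t *\<^sub>R deriv \<Phi> (Complex t (?c n)))) powr p
          \<le> 1 / (1 + t\<^sup>2) * (R powr p * ?N powr p)" by (intro mult_left_mono) auto
        also have "\<dots> = R powr p * (1 / (1 + t\<^sup>2) * ?N powr p)" by simp
        finally show "ennreal (1 / (1 + t\<^sup>2) * norm ((1 + t\<^sup>2) *\<^sub>R (indicator {x1..x2} t *\<^sub>R deriv \<Phi> (Complex t (?c n)))) powr p)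
           \<le> ennreal (R powr p) * ennreal (1 / (1 + t\<^sup>2) * ?N powr p)"
          by (subst ennreal_mult[symmetric]) (auto intro!: ennreal_leI)
      qed
      also have "\<dots> = ennreal (R powr p) * (\<integral>\<^sup>+t. ennreal (1 / (1 + t\<^sup>2) * norm (deriv \<Phi> (Complex t (?c n))) powr p) \<partial>lborel)"
        by (rule nn_integral_cmult) measurable
      also have "\<dots> \<le> ennreal (R powr p) * ennreal \<bar>C\<bar>"
        by (intro mult_left_mono order_trans[OF C] ennreal_leI) auto
      finally show ?thesis by (simp add: ennreal_mult'[symmetric])
    qed
    have m: "(\<lambda>t. indicator {x1..x2} t *\<^sub>R deriv \<Phi> (Complex t (?c n))) \<in> borel_measurable borel"
      "(\<lambda>t. indicator {x1..x2} t *\<^sub>R \<phi> t) \<in> borel_measurable borel" for n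
      by measurable
    note U = tendsto_integral_lborel_of_bounded_powr[OF m lim p(1) bd]
    show "integrable lborel (\<lambda>t. indicator {x1..x2} t *\<^sub>R \<phi> t)" by (rule U)
    have "(\<integral>t. indicator {x1..x2} t *\<^sub>R deriv \<Phi> (Complex t (?c n)) \<partial>lborel) = \<Phi> (Complex x2 (?c n)) - \<Phi> (Complex x1 (?c n))" for n
      by (rule integral_FTC_Icc[OF le])
         (auto intro!: has_vector_derivative_at_within has_vector_derivative_horizontal_line d continuous_on_upper_horizontal[OF hol'])
    then have "(\<lambda>n. \<Phi> (Complex x2 (?c n)) - \<Phi> (Complex x1 (?c n))) \<longlonglongrightarrow> (\<integral>t. indicator {x1..x2} t *\<^sub>R \<phi> t \<partial>lborel)"
      using U(2) by simp
    moreover have "(\<lambda>n. \<Phi> (Complex x2 (?c n)) - \<Phi> (Complex x1 (?c n))) \<longlonglongrightarrow> b x2 - b x1" by (intro tendsto_intros b)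
    ultimately show "b x2 - b x1 = (\<integral>t. indicator {x1..x2} t *\<^sub>R \<phi> t \<partial>lborel)" by (rule LIMSEQ_unique[rotated])
  qed
  have intR: "set_integrable lborel {x1..x2} (\<lambda>t. Re (\<phi> t))" and intI: "set_integrable lborel {x1..x2} (\<lambda>t. Im (\<phi> t))" for x1 x2
    using integrable_Re[OF ftc(1)[of x1 x2]] integrable_Im[OF ftc(1)[of x1 x2]]
    by (cases "x1 \<le> x2"; simp add: set_integrable_def)+
  have R: "Re (b x2) - Re (b x1) = (LBINT t:{x1..x2}. Re (\<phi> t))" and I: "Im (b x2) - Im (b x1) = (LBINT t:{x1..x2}. Im (\<phi> t))" if "x1 \<le> x2" for x1 x2
    using arg_cong[OF ftc(2)[OF that], of Re] arg_cong[OF ftc(2)[OF that], of Im] ftc(1)[OF that]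
    by (simp_all add: set_lebesgue_integral_def flip: integral_Re integral_Im)
  have "AE x in lborel. vanishes_in_mean_at (\<lambda>t. Re (\<phi> t) - Re (\<phi> x)) x"
  proof (rule AE_lebesgue_point)
    show "set_integrable lborel {-a<..<a} (\<lambda>t. Re (\<phi> t))" for a
      by (rule set_integrable_subset[OF intR[of "-a" a]]) auto
  qed measurable
  moreover have "AE x in lborel. vanishes_in_mean_at (\<lambda>t. Im (\<phi> t) - Im (\<phi> x)) x"
  proof (rule AE_lebesgue_point)
    show "set_integrable lborel {-a<..<a} (\<lambda>t. Im (\<phi> t))" for a
      by (rule set_integrable_subset[OF intI[of "-a" a]]) auto
  qed measurable
  ultimately show ?thesis
  proof eventually_elim
    case (elim x)
    have "((\<lambda>x. Re (b x)) has_real_derivative Re (\<phi> x)) (at x)"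
      by (rule indefinite_integral_has_derivative[OF _ intR R elim(1)]) auto
    moreover have "((\<lambda>x. Im (b x)) has_real_derivative Im (\<phi> x)) (at x)"
      by (rule indefinite_integral_has_derivative[OF _ intI I elim(2)]) auto
    ultimately have "(b has_vector_derivative \<phi> x) (at x)"
      by (simp add: has_vector_derivative_complex_iff)
    then show ?case unfolding boundary_deriv_def b_def[symmetric] \<phi>_def[symmetric] by (rule vector_derivative_at)
  qed
qed

section \<open>Cauchy transform and Hilbert transform\<close>

text \<open>The factor \<open>\<i> / pi\<close> makes the real part the normalised Poisson integral
  of \<open>f\<close> and the imaginary part its conjugate Poisson integral, with the sign belonging
  to \<open>1 / (x - t)\<close>.\<close>

definition cauchy_transform :: "(real \<Rightarrow> real) \<Rightarrow> complex \<Rightarrow> complex" where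
  "cauchy_transform f z = (\<integral>t. f t *\<^sub>R (\<i> / (complex_of_real pi * (z - complex_of_real t))) \<partial>lborel)"

text \<open>With a constant depending on \<open>z\<close> the kernel is compared with
  \<open>1 / (1 + \<bar>t\<bar>)\<close>, so that one integrability condition on \<open>f\<close>
  serves all points of the half-plane.\<close>

lemma cauchy_kernel_bound:
  assumes "Im z > 0"
  shows "1 / norm (z - complex_of_real t) \<le> ((1 + norm z) / Im z + 1) * (1 / (1 + \<bar>t\<bar>))"
proof -
  have n: "norm (z - complex_of_real t) \<ge> Im z" using abs_Im_le_cmod[of "z - complex_of_real t"] assms by simp
  then have n0: "norm (z - complex_of_real t) > 0" using assms by linarith
  have "norm (complex_of_real t) \<le> norm z + norm (z - complex_of_real t)"
    by (metis norm_minus_commute norm_triangle_sub)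
  then have "1 + \<bar>t\<bar> \<le> (1 + norm z) + norm (z - complex_of_real t)" by simp
  also have "1 + norm z \<le> (1 + norm z) / Im z * norm (z - complex_of_real t)"
    using mult_left_mono[OF n, of "(1 + norm z) / Im z"] assms by (simp add: add_nonneg_nonneg)
  finally have "1 + \<bar>t\<bar> \<le> ((1 + norm z) / Im z + 1) * norm (z - complex_of_real t)" by (simp add: algebra_simps)
  then show ?thesis using n0 by (simp add: field_simps)
qed

lemma norm_cauchy_kernel_le:
  assumes "Im z > 0"
  shows "norm (f t *\<^sub>R (\<i> / (complex_of_real pi * (z - complex_of_real t)))) \<le> ((1 + norm z) / Im z + 1) / pi * \<bar>f t / (1 + \<bar>t\<bar>)\<bar>"
proof -
  have "norm (f t *\<^sub>R (\<i> / (complex_of_real pi * (z - complex_of_real t)))) = \<bar>f t\<bar> / pi * (1 / norm (z - complex_of_real t))"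
    by (simp add: norm_divide norm_mult)
  also have "\<dots> \<le> \<bar>f t\<bar> / pi * (((1 + norm z) / Im z + 1) * (1 / (1 + \<bar>t\<bar>)))"
    by (intro mult_left_mono cauchy_kernel_bound assms) auto
  finally show ?thesis by (simp add: abs_divide mult_ac)
qed

context
  fixes f :: "real \<Rightarrow> real"
  assumes f [measurable]: "f \<in> borel_measurable borel"
    and int: "integrable lborel (\<lambda>t. f t / (1 + \<bar>t\<bar>))"
begin

lemma integrable_cauchy_kernel:
  assumes "Im z > 0"
  shows "integrable lborel (\<lambda>t. f t *\<^sub>R (\<i> / (complex_of_real pi * (z - complex_of_real t))))"
proof (rule Bochner_Integration.integrable_bound)
  show "integrable lborel (\<lambda>t. ((1 + norm z) / Im z + 1) / pi * \<bar>f t / (1 + \<bar>t\<bar>)\<bar>)"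
    using int by (intro integrable_mult_right integrable_abs)
  have "((1 + norm z) / Im z + 1) / pi \<ge> 0" using assms by simp
  then show "AE t in lborel. norm (f t *\<^sub>R (\<i> / (complex_of_real pi * (z - complex_of_real t)))) \<le> norm (((1 + norm z) / Im z + 1) / pi * \<bar>f t / (1 + \<bar>t\<bar>)\<bar>)"
    using norm_cauchy_kernel_le[OF assms, of f] by (intro AE_I2) (simp only: real_norm_def abs_mult abs_abs abs_of_nonneg)
qed measurable

text \<open>Differentiation under the integral, done with an explicit error. The difference quotient
  of the kernel deviates from its derivative by a term with a factor \<open>w - z\<close>, the rest
  being dominated by a multiple of \<open>\<bar>f t\<bar> / (1 + \<bar>t\<bar>)\<close>.\<close>

lemma holomorphic_cauchy_transform: "cauchy_transform f holomorphic_on upper_half_plane"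
proof -
  have "\<exists>D. (cauchy_transform f has_field_derivative D) (at z)" if z: "Im z > 0" for z
  proof -
    define y where "y = Im z"
    have y: "y > 0" using z by (simp add: y_def)
    define J where "J = (\<integral>t. \<bar>f t / (1 + \<bar>t\<bar>)\<bar> \<partial>lborel)"
    define M where "M = ((1 + norm z) / y + 1) / pi"
    define k where "k w t = \<i> / (complex_of_real pi * (w - complex_of_real t))" for w t
    define k' where "k' t = - \<i> / (complex_of_real pi * (z - complex_of_real t)\<^sup>2)" for t
    have nz: "norm (w - complex_of_real t) \<ge> y / 2" if "norm (w - z) < y / 2" for w t
    proof -
      have "\<bar>Im (w - z)\<bar> < y / 2" using abs_Im_le_cmod[of "w - z"] that by linarith
      then have "Im w \<ge> y / 2" unfolding y_def by (simp add: abs_if split: if_splits)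
      then show ?thesis using abs_Im_le_cmod[of "w - complex_of_real t"] by simp
    qed
    have nz': "norm (z - complex_of_real t) \<ge> y" for t
      using abs_Im_le_cmod[of "z - complex_of_real t"] y by (simp add: y_def)
    have ne: "z - complex_of_real t \<noteq> 0" for t using nz'[of t] y by auto
    have Mt: "\<bar>f t\<bar> / pi * (1 / norm (z - complex_of_real t)) \<le> M * \<bar>f t / (1 + \<bar>t\<bar>)\<bar>" for t
      using norm_cauchy_kernel_le[OF z, of f t] by (simp add: norm_divide norm_mult M_def y_def)
    have intk: "integrable lborel (\<lambda>t. f t *\<^sub>R k w t)" if "Im w > 0" for w
      unfolding k_def by (rule integrable_cauchy_kernel[OF that])
    have intk': "integrable lborel (\<lambda>t. f t *\<^sub>R k' t)"
    proof (rule Bochner_Integration.integrable_bound)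
      show "integrable lborel (\<lambda>t. 1 / y * (M * \<bar>f t / (1 + \<bar>t\<bar>)\<bar>))"
        using int by (intro integrable_mult_right integrable_abs)
      show "AE t in lborel. norm (f t *\<^sub>R k' t) \<le> norm (1 / y * (M * \<bar>f t / (1 + \<bar>t\<bar>)\<bar>))"
      proof (rule AE_I2)
        fix t
        have "norm (f t *\<^sub>R k' t) = 1 / norm (z - complex_of_real t) * (\<bar>f t\<bar> / pi * (1 / norm (z - complex_of_real t)))"
          by (simp add: k'_def norm_divide norm_mult norm_power power2_eq_square)
        also have "\<dots> \<le> 1 / y * (M * \<bar>f t / (1 + \<bar>t\<bar>)\<bar>)"
          using y nz'[of t] ne[of t] by (intro mult_mono Mt divide_left_mono) auto
        finally show "norm (f t *\<^sub>R k' t) \<le> norm (1 / y * (M * \<bar>f t / (1 + \<bar>t\<bar>)\<bar>))"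
          unfolding real_norm_def by (rule order_trans[OF _ abs_ge_self])
      qed
      show "(\<lambda>t. f t *\<^sub>R k' t) \<in> borel_measurable lborel" unfolding k'_def by measurable
    qed
    define D where "D = (\<integral>t. f t *\<^sub>R k' t \<partial>lborel)"
    have "((\<lambda>w. (cauchy_transform f w - cauchy_transform f z) / (w - z) - D) \<longlongrightarrow> 0) (at z)"
    proof (rule Lim_null_comparison)
      show "((\<lambda>w. norm (w - z) * (2 / y * (1 / y) * (M * J))) \<longlongrightarrow> 0) (at z)"
        by (intro tendsto_mult_left_zero tendsto_norm_zero LIM_zero tendsto_ident_at)
      show "eventually (\<lambda>w. norm ((cauchy_transform f w - cauchy_transform f z) / (w - z) - D) \<le> norm (w - z) * (2 / y * (1 / y) * (M * J))) (at z)"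
        unfolding eventually_at
      proof (intro exI[of _ "y / 2"] conjI ballI impI)
        show "0 < y / 2" using y by simp
        fix w assume w: "w \<noteq> z \<and> dist w z < y / 2"
        then have w': "norm (w - z) < y / 2" by (simp add: dist_norm)
        have "\<bar>Im (w - z)\<bar> < y / 2" using abs_Im_le_cmod[of "w - z"] w' by linarith
        then have Imw: "Im w > 0" using y unfolding y_def by (simp add: abs_if split: if_splits)
        have wne: "w - complex_of_real t \<noteq> 0" for t using nz[OF w', of t] y by auto
        have id: "(k w t - k z t) / (w - z) - k' t = (w - z) * (\<i> / (complex_of_real pi * ((w - complex_of_real t) * (z - complex_of_real t)\<^sup>2)))" for t
        proof -
          define a where "a = w - complex_of_real t"
          define b where "b = z - complex_of_real t"
          have ab: "a \<noteq> 0" "b \<noteq> 0" "a - b \<noteq> 0" "w - z = a - b" using wne ne w by (auto simp: a_def b_def)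
          show ?thesis unfolding k_def k'_def a_def[symmetric] b_def[symmetric] ab(4) using ab(1-3)
            by (simp add: divide_simps) (simp add: power2_eq_square algebra_simps)
        qed
        have "(cauchy_transform f w - cauchy_transform f z) / (w - z) - D = (\<integral>t. f t *\<^sub>R ((k w t - k z t) / (w - z) - k' t) \<partial>lborel)"
        proof -
          have "(\<integral>t. f t *\<^sub>R ((k w t - k z t) / (w - z) - k' t) \<partial>lborel) = (\<integral>t. (f t *\<^sub>R k w t - f t *\<^sub>R k z t) / (w - z) - f t *\<^sub>R k' t \<partial>lborel)"
            by (intro Bochner_Integration.integral_cong) (auto simp: scaleR_conv_of_real algebra_simps diff_divide_distrib)
          also have "\<dots> = (cauchy_transform f w - cauchy_transform f z) / (w - z) - D"
            unfolding D_def cauchy_transform_def k_def[symmetric]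
            using intk[OF Imw] intk[OF z] intk' by simp
          finally show ?thesis ..
        qed
        also have "norm \<dots> \<le> (\<integral>t. norm (w - z) * (2 / y * (1 / y)) * (M * \<bar>f t / (1 + \<bar>t\<bar>)\<bar>) \<partial>lborel)"
        proof (rule order_trans[OF integral_norm_bound], rule integral_mono')
          show "integrable lborel (\<lambda>t. norm (w - z) * (2 / y * (1 / y)) * (M * \<bar>f t / (1 + \<bar>t\<bar>)\<bar>))"
            using int by (intro integrable_mult_right integrable_abs)
          fix t
          have "norm (f t *\<^sub>R ((k w t - k z t) / (w - z) - k' t)) =
            norm (w - z) * (1 / norm (w - complex_of_real t) * (1 / norm (z - complex_of_real t))) * (\<bar>f t\<bar> / pi * (1 / norm (z - complex_of_real t)))"
            unfolding id by (simp add: norm_divide norm_mult norm_power power2_eq_square mult_ac)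
          also have "\<dots> \<le> norm (w - z) * (2 / y * (1 / y)) * (M * \<bar>f t / (1 + \<bar>t\<bar>)\<bar>)"
          proof (rule mult_mono[OF _ Mt])
            have "0 < norm (w - complex_of_real t)" using nz[OF w', of t] y by linarith
            then have "1 / norm (w - complex_of_real t) \<le> 1 / (y / 2)" using nz[OF w', of t] y by (intro divide_left_mono mult_pos_pos) auto
            then have "1 / norm (w - complex_of_real t) \<le> 2 / y" by simp
            moreover have "1 / norm (z - complex_of_real t) \<le> 1 / y" using nz'[of t] ne[of t] y by (intro divide_left_mono mult_pos_pos) auto
            ultimately show "norm (w - z) * (1 / norm (w - complex_of_real t) * (1 / norm (z - complex_of_real t))) \<le> norm (w - z) * (2 / y * (1 / y))"
              using y by (intro mult_left_mono mult_mono) auto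
          qed (use y in auto)
          finally show "norm (f t *\<^sub>R ((k w t - k z t) / (w - z) - k' t)) \<le> norm (w - z) * (2 / y * (1 / y)) * (M * \<bar>f t / (1 + \<bar>t\<bar>)\<bar>)" .
          show "0 \<le> norm (w - z) * (2 / y * (1 / y)) * (M * \<bar>f t / (1 + \<bar>t\<bar>)\<bar>)"
            using y by (simp add: M_def)
        qed
        also have "\<dots> = norm (w - z) * (2 / y * (1 / y)) * (M * J)"
          unfolding J_def by (simp only: integral_mult_right_zero)
        finally show "norm ((cauchy_transform f w - cauchy_transform f z) / (w - z) - D) \<le> norm (w - z) * (2 / y * (1 / y) * (M * J))"
          by (simp add: mult.assoc)
      qed
    qed
    then have "(cauchy_transform f has_field_derivative D) (at z)"
      unfolding has_field_derivative_iff by (simp add: LIM_zero_iff)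
    then show ?thesis by blast
  qed
  then show ?thesis
    unfolding holomorphic_on_def field_differentiable_def
    by (metis has_field_derivative_at_within upper_half_plane_iff)
qed

lemma cauchy_kernel_parts:
  "Re (\<i> / (complex_of_real pi * (Complex x y - complex_of_real t))) = poisson x y t / pi"
  "Im (\<i> / (complex_of_real pi * (Complex x y - complex_of_real t))) = (x - t) / ((t - x)\<^sup>2 + y\<^sup>2) / pi"
proof -
  have e: "\<i> / (complex_of_real pi * (Complex x y - complex_of_real t)) = \<i> / (Complex x y - complex_of_real t) / of_real pi" by simp
  have "(x - t)\<^sup>2 = (t - x)\<^sup>2" by (rule power2_commute)
  then show "Re (\<i> / (complex_of_real pi * (Complex x y - complex_of_real t))) = poisson x y t / pi"
    "Im (\<i> / (complex_of_real pi * (Complex x y - complex_of_real t))) = (x - t) / ((t - x)\<^sup>2 + y\<^sup>2) / pi"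
    unfolding e by (simp_all only: Re_divide_of_real Im_divide_of_real) (simp_all add: Re_divide Im_divide)
qed

lemma cauchy_transform_parts:
  assumes y: "y > 0"
  shows "integrable lborel (\<lambda>t. poisson x y t * f t)"
    "Re (cauchy_transform f (Complex x y)) = (\<integral>t. poisson x y t * f t \<partial>lborel) / pi"
    "integrable lborel (\<lambda>t. (x - t) / ((t - x)\<^sup>2 + y\<^sup>2) * f t)"
    "Im (cauchy_transform f (Complex x y)) = (\<integral>t. (x - t) / ((t - x)\<^sup>2 + y\<^sup>2) * f t \<partial>lborel) / pi"
proof -
  have i: "integrable lborel (\<lambda>t. f t *\<^sub>R (\<i> / (complex_of_real pi * (Complex x y - complex_of_real t))))"
    using y by (intro integrable_cauchy_kernel) simp
  have R: "pi * Re (f t *\<^sub>R (\<i> / (complex_of_real pi * (Complex x y - complex_of_real t)))) = poisson x y t * f t"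
   and I: "pi * Im (f t *\<^sub>R (\<i> / (complex_of_real pi * (Complex x y - complex_of_real t)))) = (x - t) / ((t - x)\<^sup>2 + y\<^sup>2) * f t" for t
    unfolding scaleR_complex.sel cauchy_kernel_parts by simp_all
  have iR: "integrable lborel (\<lambda>t. pi * Re (f t *\<^sub>R (\<i> / (complex_of_real pi * (Complex x y - complex_of_real t)))))"
   and iI: "integrable lborel (\<lambda>t. pi * Im (f t *\<^sub>R (\<i> / (complex_of_real pi * (Complex x y - complex_of_real t)))))"
    by (intro integrable_mult_right integrable_Re integrable_Im i)+
  show "integrable lborel (\<lambda>t. poisson x y t * f t)" using iR unfolding R .
  show "integrable lborel (\<lambda>t. (x - t) / ((t - x)\<^sup>2 + y\<^sup>2) * f t)" using iI unfolding I .
  have "pi * Re (cauchy_transform f (Complex x y)) = (\<integral>t. pi * Re (f t *\<^sub>R (\<i> / (complex_of_real pi * (Complex x y - complex_of_real t)))) \<partial>lborel)"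
    unfolding cauchy_transform_def integral_mult_right_zero integral_Re[OF i] ..
  then show "Re (cauchy_transform f (Complex x y)) = (\<integral>t. poisson x y t * f t \<partial>lborel) / pi"
    unfolding R by (simp add: field_simps)
  have "pi * Im (cauchy_transform f (Complex x y)) = (\<integral>t. pi * Im (f t *\<^sub>R (\<i> / (complex_of_real pi * (Complex x y - complex_of_real t)))) \<partial>lborel)"
    unfolding cauchy_transform_def integral_mult_right_zero integral_Im[OF i] ..
  then show "Im (cauchy_transform f (Complex x y)) = (\<integral>t. (x - t) / ((t - x)\<^sup>2 + y\<^sup>2) * f t \<partial>lborel) / pi"
    unfolding I by (simp add: field_simps)
qed

lemma integrable_over_1_plus_square: "integrable lborel (\<lambda>t. f t / (1 + t\<^sup>2))"
proof (rule Bochner_Integration.integrable_bound)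
  show "integrable lborel (\<lambda>t. 2 * (f t / (1 + \<bar>t\<bar>)))" by (intro integrable_mult_right int)
  show "AE t in lborel. norm (f t / (1 + t\<^sup>2)) \<le> norm (2 * (f t / (1 + \<bar>t\<bar>)))"
  proof (rule AE_I2)
    fix t :: real
    have "0 \<le> (\<bar>t\<bar> - 1)\<^sup>2" by simp
    then have "2 * \<bar>t\<bar> \<le> 1 + t\<^sup>2" unfolding power2_diff by (simp add: algebra_simps)
    note le = this
    have "1 + a \<le> 2 * (1 + b)" if "2 * a \<le> 1 + b" "0 \<le> b" for a b :: real using that by simp
    from this[OF le] have "1 + \<bar>t\<bar> \<le> 2 * (1 + t\<^sup>2)" by simp
    moreover have "1 + t\<^sup>2 > 0" "1 + \<bar>t\<bar> > 0" by (simp_all add: add_pos_nonneg)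
    ultimately have "1 / (1 + t\<^sup>2) \<le> 2 / (1 + \<bar>t\<bar>)" by (simp add: field_simps)
    from mult_left_mono[OF this, of "\<bar>f t\<bar>"]
    show "norm (f t / (1 + t\<^sup>2)) \<le> norm (2 * (f t / (1 + \<bar>t\<bar>)))"
      using \<open>1 + t\<^sup>2 > 0\<close> by (simp add: abs_divide abs_mult mult.commute)
  qed
qed measurable

lemma set_integrable_interval: "set_integrable lborel {-a<..<a} f"
  unfolding set_integrable_def
proof (rule Bochner_Integration.integrable_bound)
  show "integrable lborel (\<lambda>t. (1 + \<bar>a\<bar>) * (f t / (1 + \<bar>t\<bar>)))" by (intro integrable_mult_right int)
  show "AE t in lborel. norm (indicator {-a<..<a} t *\<^sub>R f t) \<le> norm ((1 + \<bar>a\<bar>) * (f t / (1 + \<bar>t\<bar>)))"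
  proof (rule AE_I2)
    fix t :: real
    show "norm (indicator {-a<..<a} t *\<^sub>R f t) \<le> norm ((1 + \<bar>a\<bar>) * (f t / (1 + \<bar>t\<bar>)))"
    proof (cases "t \<in> {-a<..<a}")
      case True
      then have "1 * \<bar>f t\<bar> \<le> (1 + \<bar>a\<bar>) / (1 + \<bar>t\<bar>) * \<bar>f t\<bar>" by (intro mult_right_mono) (auto simp: field_simps)
      then show ?thesis using True by (simp add: abs_divide abs_mult)
    qed simp
  qed
qed measurable

lemma AE_lebesgue_point_poisson:
  "AE x in lborel. ((\<lambda>y. \<integral>t. poisson x y t * \<bar>f t - f x\<bar> \<partial>lborel) \<longlongrightarrow> 0) (at_right 0)"
  using AE_lebesgue_point[OF f set_integrable_interval]
proof eventually_elim
  case (elim x)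
  have "integrable lborel (\<lambda>t. (f t - f x) / (1 + t\<^sup>2))"
  proof -
    have "integrable lborel (\<lambda>t. f t / (1 + t\<^sup>2) - f x * (1 / (1 + t\<^sup>2)))"
      using has_bochner_integral_inverse_1_plus_square
      by (intro Bochner_Integration.integrable_diff integrable_over_1_plus_square integrable_mult_right) (simp add: has_bochner_integral_iff)
    then show ?thesis by (simp add: diff_divide_distrib)
  qed
  then show ?case by (intro poisson_tendsto_zero elim) measurable
qed

lemma poisson_diff_integrable:
  assumes "y > 0"
  shows "integrable lborel (\<lambda>t. poisson x y t * (f t - c))"
proof -
  have "integrable lborel (\<lambda>t. poisson x y t * f t - poisson x y t * c)"
    using cauchy_transform_parts(1)[OF assms] has_bochner_integral_poisson[OF assms, of x]
    by (intro Bochner_Integration.integrable_diff integrable_mult_left) (auto simp: has_bochner_integral_iff)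
  then show ?thesis by (simp only: right_diff_distrib)
qed

lemma AE_Re_cauchy_transform:
  "AE x in lborel. ((\<lambda>y. Re (cauchy_transform f (Complex x y))) \<longlongrightarrow> f x) (at_right 0)"
  using AE_lebesgue_point_poisson
proof eventually_elim
  case (elim x)
  have "((\<lambda>y. Re (cauchy_transform f (Complex x y)) - f x) \<longlongrightarrow> 0) (at_right 0)"
  proof (rule Lim_null_comparison)
    show "((\<lambda>y. 1 / pi * (\<integral>t. poisson x y t * \<bar>f t - f x\<bar> \<partial>lborel)) \<longlongrightarrow> 0) (at_right 0)"
      by (rule tendsto_mult_right_zero[OF elim])
    show "eventually (\<lambda>y. norm (Re (cauchy_transform f (Complex x y)) - f x) \<le> 1 / pi * (\<integral>t. poisson x y t * \<bar>f t - f x\<bar> \<partial>lborel)) (at_right 0)"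
      unfolding eventually_at_right_field
    proof (intro exI[of _ 1] conjI allI impI)
      fix y :: real assume y: "0 < y"
      have h: "has_bochner_integral lborel (\<lambda>t. poisson x y t * f x) (pi * f x)"
        by (intro has_bochner_integral_mult_left has_bochner_integral_poisson y)
      have "(\<integral>t. poisson x y t * (f t - f x) \<partial>lborel) = (\<integral>t. poisson x y t * f t \<partial>lborel) - pi * f x"
        unfolding right_diff_distrib using cauchy_transform_parts(1)[OF y] h
        by (subst Bochner_Integration.integral_diff) (auto simp: has_bochner_integral_iff)
      then have "Re (cauchy_transform f (Complex x y)) - f x = 1 / pi * (\<integral>t. poisson x y t * (f t - f x) \<partial>lborel)"
        by (simp add: cauchy_transform_parts(2)[OF y] field_simps)
      then have "norm (Re (cauchy_transform f (Complex x y)) - f x) = 1 / pi * norm (\<integral>t. poisson x y t * (f t - f x) \<partial>lborel)"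
        by (simp add: abs_mult)
      also have "norm (\<integral>t. poisson x y t * (f t - f x) \<partial>lborel) \<le> (\<integral>t. norm (poisson x y t * (f t - f x)) \<partial>lborel)"
        by (rule integral_norm_bound)
      also have "(\<lambda>t. norm (poisson x y t * (f t - f x))) = (\<lambda>t. poisson x y t * \<bar>f t - f x\<bar>)"
        using y by (auto simp: abs_mult fun_eq_iff)
      finally show "norm (Re (cauchy_transform f (Complex x y)) - f x) \<le> 1 / pi * (\<integral>t. poisson x y t * \<bar>f t - f x\<bar> \<partial>lborel)"
        by (simp add: divide_right_mono)
    qed simp
  qed
  then show ?case by (simp add: LIM_zero_iff)
qed


lemma odd_integral_eq_zero:
  fixes m :: "real \<Rightarrow> real"
  assumes "\<And>s. m (- s) = - m s"
  shows "(\<integral>t. m (x - t) \<partial>lborel) = 0"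
proof -
  have "(\<integral>t. m (x - t) \<partial>lborel) = (\<integral>s. m s \<partial>lborel)"
    by (subst lborel_integral_real_affine[where c="-1" and t=x]) auto
  moreover have "(\<integral>t. m (x - t) \<partial>lborel) = (\<integral>s. m (- s) \<partial>lborel)"
    by (subst lborel_integral_real_affine[where c=1 and t=x]) auto
  ultimately show ?thesis using assms by simp
qed

lemma integrable_truncated:
  assumes e: "e > 0"
  shows "integrable lborel (\<lambda>t. indicator {t. \<bar>x - t\<bar> > e} t *\<^sub>R (f t / (x - t)))"
proof (rule Bochner_Integration.integrable_bound)
  define K where "K = (1 + \<bar>x\<bar>) / e + 1"
  show "integrable lborel (\<lambda>t. K * (f t / (1 + \<bar>t\<bar>)))" by (intro integrable_mult_right int)
  show "AE t in lborel. norm (indicator {t. \<bar>x - t\<bar> > e} t *\<^sub>R (f t / (x - t))) \<le> norm (K * (f t / (1 + \<bar>t\<bar>)))"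
  proof (rule AE_I2)
    fix t
    have K: "K \<ge> 0" using e by (simp add: K_def)
    show "norm (indicator {t. \<bar>x - t\<bar> > e} t *\<^sub>R (f t / (x - t))) \<le> norm (K * (f t / (1 + \<bar>t\<bar>)))"
    proof (cases "\<bar>x - t\<bar> > e")
      case True
      have "1 + \<bar>x\<bar> \<le> (1 + \<bar>x\<bar>) / e * \<bar>x - t\<bar>"
        using mult_left_mono[of e "\<bar>x - t\<bar>" "(1 + \<bar>x\<bar>) / e"] True e by simp
      then have "1 + \<bar>t\<bar> \<le> K * \<bar>x - t\<bar>" by (simp add: K_def algebra_simps)
      then have "1 / \<bar>x - t\<bar> \<le> K / (1 + \<bar>t\<bar>)" using True e by (simp add: field_simps)
      from mult_left_mono[OF this, of "\<bar>f t\<bar>"] True K show ?thesis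
        by (simp add: abs_divide abs_mult mult_ac)
    qed simp
  qed
qed measurable

lemma truncated_hilbert_eq:
  "truncated_hilbert e f x = (\<integral>t. indicator {t. \<bar>x - t\<bar> > e} t *\<^sub>R (f t / (x - t)) \<partial>lborel)"
  unfolding truncated_hilbert_def set_lebesgue_integral_def
  by (rule integral_completion) measurable

text \<open>Truncation length and height are both \<open>y\<close>. The difference \<open>m\<close>
  of the truncated kernel and the conjugate Poisson kernel is at most the Poisson kernel in modulus;
  being odd, it also has integral 0.\<close>

lemma truncated_hilbert_poisson_bound:
  assumes y: "y > 0"
  shows "\<bar>truncated_hilbert y f x - pi * Im (cauchy_transform f (Complex x y))\<bar>
    \<le> (\<integral>t. poisson x y t * \<bar>f t - f x\<bar> \<partial>lborel)"
proof -
  define m where "m s = (if \<bar>s\<bar> > y then 1 / s else 0) - s / (s\<^sup>2 + y\<^sup>2)" for s :: real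
  have m_odd: "m (- s) = - m s" for s by (simp add: m_def)
  have [measurable]: "m \<in> borel_measurable borel" unfolding m_def by measurable
  have mb: "\<bar>m (x - t)\<bar> \<le> poisson x y t" for t
  proof -
    define s where "s = x - t"
    have den: "s\<^sup>2 + y\<^sup>2 > 0" using y by (simp add: add_nonneg_pos)
    have "\<bar>m s\<bar> \<le> y / (s\<^sup>2 + y\<^sup>2)"
    proof (cases "\<bar>s\<bar> > y")
      case True
      then have s0: "s \<noteq> 0" using y by auto
      have "m s = y\<^sup>2 / (s * (s\<^sup>2 + y\<^sup>2))"
        using True s0 den by (simp add: m_def field_simps power2_eq_square)
      then have "\<bar>m s\<bar> = y\<^sup>2 / (\<bar>s\<bar> * (s\<^sup>2 + y\<^sup>2))" using den by (simp add: abs_divide abs_mult)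
      also have "\<dots> \<le> y\<^sup>2 / (y * (s\<^sup>2 + y\<^sup>2))"
        using True y den by (intro divide_left_mono mult_right_mono mult_pos_pos) auto
      also have "\<dots> = y / (s\<^sup>2 + y\<^sup>2)" using y by (simp add: power2_eq_square)
      finally show ?thesis .
    next
      case False
      then show ?thesis using den by (simp add: m_def abs_divide divide_right_mono)
    qed
    then show ?thesis by (simp add: s_def power2_commute)
  qed
  have im: "integrable lborel (\<lambda>t. m (x - t))"
  proof (rule Bochner_Integration.integrable_bound)
    show "integrable lborel (\<lambda>t. poisson x y t)"
      using has_bochner_integral_poisson[OF y, of x] by (simp add: has_bochner_integral_iff)
    show "AE t in lborel. norm (m (x - t)) \<le> norm (poisson x y t)"
      using mb y by (intro AE_I2) (simp add: abs_of_nonneg)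
  qed measurable
  have mf: "indicator {t. \<bar>x - t\<bar> > y} t *\<^sub>R (f t / (x - t)) - (x - t) / ((t - x)\<^sup>2 + y\<^sup>2) * f t = m (x - t) * f t" for t
    by (simp add: m_def indicator_def power2_commute[of t x] left_diff_distrib)
  have imf: "integrable lborel (\<lambda>t. m (x - t) * f t)"
    unfolding mf[symmetric] by (intro Bochner_Integration.integrable_diff integrable_truncated cauchy_transform_parts y)
  have "truncated_hilbert y f x - pi * Im (cauchy_transform f (Complex x y)) = (\<integral>t. m (x - t) * f t \<partial>lborel)"
    unfolding mf[symmetric] truncated_hilbert_eq cauchy_transform_parts(4)[OF y]
    by (subst Bochner_Integration.integral_diff[OF integrable_truncated[OF y] cauchy_transform_parts(3)[OF y]]) simp
  \<comment> \<open>By oddness the constant \<open>f x\<close> can be subtracted from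
    \<open>f\<close> at no cost.\<close>
  also have "\<dots> = (\<integral>t. m (x - t) * f t - m (x - t) * f x \<partial>lborel)"
    using imf im odd_integral_eq_zero[of m x, OF m_odd] by simp
  finally have "\<bar>truncated_hilbert y f x - pi * Im (cauchy_transform f (Complex x y))\<bar> = norm (\<integral>t. m (x - t) * (f t - f x) \<partial>lborel)"
    by (simp add: right_diff_distrib)
  also have "\<dots> \<le> (\<integral>t. poisson x y t * \<bar>f t - f x\<bar> \<partial>lborel)"
  proof (rule order_trans[OF integral_norm_bound], rule integral_mono')
    show "integrable lborel (\<lambda>t. poisson x y t * \<bar>f t - f x\<bar>)"
      using integrable_abs[OF poisson_diff_integrable[OF y, of x "f x"]] y by (simp add: abs_mult)
    show "norm (m (x - t) * (f t - f x)) \<le> poisson x y t * \<bar>f t - f x\<bar>" for t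
      unfolding real_norm_def abs_mult by (intro mult_right_mono mb) simp
  qed (use y in simp)
  finally show ?thesis .
qed

text \<open>At Lebesgue points the truncated integrals and \<open>pi\<close> times the conjugate
  Poisson integrals have the same limit behaviour, so the principal value exists as soon as the
  Cauchy transform has a vertical limit.\<close>

lemma AE_hilbert_of_vertical_limit:
  assumes lim: "AE x in lborel. \<exists>l. ((\<lambda>y. cauchy_transform f (Complex x y)) \<longlongrightarrow> l) (at_right 0)"
  shows "AE x in lborel. hilbert_exists_at f x \<and>
     ((\<lambda>y. cauchy_transform f (Complex x y)) \<longlongrightarrow> Complex (f x) (hilbert_transform f x)) (at_right 0)"
  using lim AE_Re_cauchy_transform AE_lebesgue_point_poisson
proof eventually_elim
  case (elim x)
  then obtain l where l: "((\<lambda>y. cauchy_transform f (Complex x y)) \<longlongrightarrow> l) (at_right 0)" by blast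
  have Rel: "Re l = f x" using tendsto_unique[OF _ tendsto_Re[OF l] elim(2)] by simp
  have "((\<lambda>y. truncated_hilbert y f x - pi * Im (cauchy_transform f (Complex x y))) \<longlongrightarrow> 0) (at_right 0)"
  proof (rule Lim_null_comparison[OF _ elim(3)])
    show "eventually (\<lambda>y. norm (truncated_hilbert y f x - pi * Im (cauchy_transform f (Complex x y)))
      \<le> (\<integral>t. poisson x y t * \<bar>f t - f x\<bar> \<partial>lborel)) (at_right 0)"
      unfolding eventually_at_right_field
      by (intro exI[of _ 1] conjI allI impI) (simp_all only: real_norm_def truncated_hilbert_poisson_bound zero_less_one)
  qed
  from tendsto_add[OF this tendsto_mult[OF tendsto_const tendsto_Im[OF l], of pi]]
  have T: "((\<lambda>y. truncated_hilbert y f x) \<longlongrightarrow> pi * Im l) (at_right 0)" by simp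
  then have "hilbert_transform f x = Im l"
    unfolding hilbert_transform_def by (subst tendsto_Lim[OF _ T]) auto
  then have "l = Complex (f x) (hilbert_transform f x)" using Rel by (simp add: complex_eq_iff)
  moreover have "set_integrable lebesgue {y. \<bar>x - y\<bar> > e} (\<lambda>y. f y / (x - y))" if "e > 0" for e
    unfolding set_integrable_def
    by (rule integrable_completion[THEN iffD2, OF _ integrable_truncated[OF that]]) measurable
  ultimately show ?case using l T unfolding hilbert_exists_at_def by blast
qed

end

lemma cauchy_transform_diff:
  assumes [measurable]: "f \<in> borel_measurable borel" "g \<in> borel_measurable borel"
    and "integrable lborel (\<lambda>t. f t / (1 + \<bar>t\<bar>))" "integrable lborel (\<lambda>t. g t / (1 + \<bar>t\<bar>))" and z: "Im z > 0"
  shows "cauchy_transform (\<lambda>t. f t - g t) z = cauchy_transform f z - cauchy_transform g z"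
  unfolding cauchy_transform_def scaleR_left_diff_distrib
  by (intro Bochner_Integration.integral_diff integrable_cauchy_kernel assms)

lemma AE_vertical_limit_cauchy_transform_nonneg:
  assumes f: "f \<in> borel_measurable borel" "integrable lborel (\<lambda>t. f t / (1 + \<bar>t\<bar>))" and nonneg: "\<And>t. 0 \<le> f t"
  shows "AE x in lborel. \<exists>l. ((\<lambda>y. cauchy_transform f (Complex x y)) \<longlongrightarrow> l) (at_right 0)"
proof (rule AE_vertical_limit_Re_nonneg[OF holomorphic_cauchy_transform[OF f]])
  fix z :: complex assume "Im z > 0"
  then show "0 \<le> Re (cauchy_transform f z)"
    using cauchy_transform_parts(2)[OF f, of "Im z" "Re z"] nonneg
    by (simp add: integral_nonneg_AE)
qed

text \<open>For nonnegative data the Cauchy transform has nonnegative real part and therefore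
  vertical limits almost everywhere; the general case is a difference of two such transforms. No
  maximal function enters.\<close>

lemma AE_hilbert_transform:
  assumes f: "f \<in> borel_measurable borel" "integrable lborel (\<lambda>t. f t / (1 + \<bar>t\<bar>))"
  shows "AE x in lborel. hilbert_exists_at f x \<and>
     ((\<lambda>y. cauchy_transform f (Complex x y)) \<longlongrightarrow> Complex (f x) (hilbert_transform f x)) (at_right 0)"
proof (rule AE_hilbert_of_vertical_limit[OF f])
  define f1 where "f1 t = max 0 (f t)" for t
  define f2 where "f2 t = max 0 (- f t)" for t
  note [measurable] = f(1)
  have m[measurable]: "f1 \<in> borel_measurable borel" "f2 \<in> borel_measurable borel"
    unfolding f1_def f2_def by measurable
  have i: "integrable lborel (\<lambda>t. f1 t / (1 + \<bar>t\<bar>))" "integrable lborel (\<lambda>t. f2 t / (1 + \<bar>t\<bar>))"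
  proof -
    show "integrable lborel (\<lambda>t. f1 t / (1 + \<bar>t\<bar>))" "integrable lborel (\<lambda>t. f2 t / (1 + \<bar>t\<bar>))"
      by (rule Bochner_Integration.integrable_bound[OF f(2)], measurable,
          auto simp: f1_def f2_def abs_divide intro!: divide_right_mono)+
  qed
  have f12: "f = (\<lambda>t. f1 t - f2 t)" by (auto simp: f1_def f2_def fun_eq_iff max_def)
  have eq: "cauchy_transform f z = cauchy_transform f1 z - cauchy_transform f2 z" if "Im z > 0" for z
    by (subst f12) (rule cauchy_transform_diff[OF m i that])
  have "AE x in lborel. \<exists>l. ((\<lambda>y. cauchy_transform f1 (Complex x y)) \<longlongrightarrow> l) (at_right 0)"
    "AE x in lborel. \<exists>l. ((\<lambda>y. cauchy_transform f2 (Complex x y)) \<longlongrightarrow> l) (at_right 0)"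
    by (intro AE_vertical_limit_cauchy_transform_nonneg m i; simp add: f1_def f2_def)+
  then show "AE x in lborel. \<exists>l. ((\<lambda>y. cauchy_transform f (Complex x y)) \<longlongrightarrow> l) (at_right 0)"
  proof eventually_elim
    case (elim x)
    then obtain l1 l2 where "((\<lambda>y. cauchy_transform f1 (Complex x y)) \<longlongrightarrow> l1) (at_right 0)"
      "((\<lambda>y. cauchy_transform f2 (Complex x y)) \<longlongrightarrow> l2) (at_right 0)" by blast
    from tendsto_diff[OF this]
    have "((\<lambda>y. cauchy_transform f (Complex x y)) \<longlongrightarrow> l1 - l2) (at_right 0)"
    proof (rule Lim_transform_eventually)
      show "eventually (\<lambda>y. cauchy_transform f1 (Complex x y) - cauchy_transform f2 (Complex x y) = cauchy_transform f (Complex x y)) (at_right 0)"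
        unfolding eventually_at_right_field by (intro exI[of _ 1]) (simp add: eq)
    qed
    then show ?case by blast
  qed
qed

section \<open>Weighted estimates\<close>

text \<open>Here \<open>S\<close> stands for \<open>1 / \<Phi>'\<close> and \<open>G\<close> for
  \<open>\<Phi>'\<close>; the weighted estimates depend on the domain only through the sector. The
  condition on \<open>p\<close> says that \<open>S\<^sup>p\<close> still has positive real
  part.\<close>

locale sector_weight =
  fixes S :: "complex \<Rightarrow> complex" and L p :: real
  assumes holS: "S holomorphic_on upper_half_plane"
    and ReS: "\<And>z. Im z > 0 \<Longrightarrow> 0 < Re (S z)"
    and ImS: "\<And>z. Im z > 0 \<Longrightarrow> \<bar>Im (S z)\<bar> \<le> L * Re (S z)"
    and L: "0 < L" and p: "1 < p" "p * arctan L < pi / 2"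
begin

definition G :: "complex \<Rightarrow> complex" where "G z = 1 / S z"
definition s :: "real \<Rightarrow> complex" where "s = vertical_limit S"
definition g :: "real \<Rightarrow> complex" where "g = vertical_limit G"

lemma S_nz: "Im z > 0 \<Longrightarrow> S z \<noteq> 0" using ReS by force

lemma norm_S_le: "Im z > 0 \<Longrightarrow> norm (S z) \<le> (1 + L) * Re (S z)"
  by (intro norm_le_of_sector ReS ImS)

lemma holG: "G holomorphic_on upper_half_plane"
  unfolding G_def by (intro holomorphic_intros holS) (use S_nz in auto)

lemma ReG: "Im z > 0 \<Longrightarrow> 0 < Re (G z)" and ImG: "Im z > 0 \<Longrightarrow> \<bar>Im (G z)\<bar> \<le> L * Re (G z)"
  using sector_inverse[of "G z" L] ReS[of z] ImS[of z] by (simp_all add: G_def)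

lemma measurable_s [measurable]: "s \<in> borel_measurable borel"
  unfolding s_def by (rule borel_measurable_vertical_limit[OF holS])

lemma measurable_g [measurable]: "g \<in> borel_measurable borel"
  unfolding g_def by (rule borel_measurable_vertical_limit[OF holG])

text \<open>Vertical limits exist for \<open>S\<close> and for \<open>G\<close> separately; passing
  to the limit in \<open>S * G = 1\<close> shows that neither boundary value vanishes.\<close>

lemma AE_s:
  "AE x in lborel. ((\<lambda>n. S (Complex x (1 / (1 + real n)))) \<longlonglongrightarrow> s x) \<and> s x * g x = 1 \<and>
     norm (s x) \<le> (1 + L) * Re (s x) \<and> \<bar>Im (s x)\<bar> \<le> L * Re (s x)"
proof -
  have "AE x in lborel. \<exists>l. ((\<lambda>y. S (Complex x y)) \<longlongrightarrow> l) (at_right 0)"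
    by (rule AE_vertical_limit_Re_nonneg[OF holS]) (use ReS less_imp_le in blast)
  moreover have "AE x in lborel. \<exists>l. ((\<lambda>y. G (Complex x y)) \<longlongrightarrow> l) (at_right 0)"
    by (rule AE_vertical_limit_Re_nonneg[OF holG]) (use ReG less_imp_le in blast)
  ultimately show ?thesis
  proof eventually_elim
    case (elim x)
    then obtain l m where l: "((\<lambda>y. S (Complex x y)) \<longlongrightarrow> l) (at_right 0)" and m: "((\<lambda>y. G (Complex x y)) \<longlongrightarrow> m) (at_right 0)"
      by blast
    note l' = vertical_limit_eqI[OF l] and m' = vertical_limit_eqI[OF m]
    have "(\<lambda>n. S (Complex x (1 / (1 + real n))) * G (Complex x (1 / (1 + real n)))) \<longlonglongrightarrow> l * m"
      by (intro tendsto_mult l' m')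
    moreover have "S (Complex x (1 / (1 + real n))) * G (Complex x (1 / (1 + real n))) = 1" for n
      using S_nz[of "Complex x (1 / (1 + real n))"] by (simp add: G_def)
    ultimately have "l * m = 1" by (simp add: LIMSEQ_const_iff)
    moreover have "norm l \<le> (1 + L) * Re l"
      by (rule LIMSEQ_le[OF tendsto_norm[OF l'(2)] tendsto_mult[OF tendsto_const tendsto_Re[OF l'(2)]]])
         (auto intro!: norm_S_le)
    moreover have "\<bar>Im l\<bar> \<le> L * Re l"
      by (rule LIMSEQ_le[OF tendsto_rabs[OF tendsto_Im[OF l'(2)]] tendsto_mult[OF tendsto_const tendsto_Re[OF l'(2)]]])
         (auto intro!: ImS)
    ultimately show ?case using l' m' by (simp add: s_def g_def)
  qed
qed

definition weighted_square :: "(real \<Rightarrow> real) \<Rightarrow> ennreal" where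
  "weighted_square f = (\<integral>\<^sup>+t. ennreal ((f t)\<^sup>2 * norm (s t)) \<partial>lborel)"

text \<open>Cauchy--Schwarz with the weights \<open>\<bar>s\<bar>\<close> and
  \<open>1 / \<bar>s\<bar> = \<bar>g\<bar>\<close>. The second integral is the Poisson integral of
  \<open>\<bar>g\<bar>\<close> at the point \<open>\<i>\<close>, finite by the sector condition for
  \<open>G\<close>.\<close>

lemma integrable_over_1_plus_abs:
  assumes [measurable]: "f \<in> borel_measurable borel" and fin: "weighted_square f < \<infinity>"
  shows "integrable lborel (\<lambda>t. f t / (1 + \<bar>t\<bar>))"
  unfolding integrable_iff_bounded
proof
  show "(\<lambda>t. f t / (1 + \<bar>t\<bar>)) \<in> borel_measurable lborel" by measurable
  have "(\<integral>\<^sup>+t. ennreal (norm (f t / (1 + \<bar>t\<bar>))) \<partial>lborel) \<le>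
     (\<integral>\<^sup>+t. ennreal ((f t)\<^sup>2 * norm (s t)) + ennreal (1 / ((t - 0)\<^sup>2 + 1\<^sup>2) * norm (g t)) \<partial>lborel)"
    using AE_s
  proof (intro nn_integral_mono_AE, eventually_elim)
    case (elim t)
    define a where "a = \<bar>f t\<bar>"
    define b where "b = 1 / (1 + \<bar>t\<bar>)"
    define u where "u = norm (s t)"
    have u: "u > 0" "norm (g t) = 1 / u"
    proof -
      have "norm (s t * g t) = 1" using elim by simp
      then have "u * norm (g t) = 1" by (simp add: u_def norm_mult)
      moreover have "u \<ge> 0" by (simp add: u_def)
      ultimately show "u > 0" "norm (g t) = 1 / u" by (auto simp: field_simps order_le_less)
    qed
    have b: "0 \<le> b" "b\<^sup>2 \<le> 1 / (t\<^sup>2 + 1)"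
    proof -
      have "t\<^sup>2 + 1 \<le> (1 + \<bar>t\<bar>)\<^sup>2" by (simp add: power2_eq_square algebra_simps)
      then show "b\<^sup>2 \<le> 1 / (t\<^sup>2 + 1)" unfolding b_def power_divide one_power2
        by (intro divide_left_mono mult_pos_pos) (auto simp: add_nonneg_pos)
    qed (simp add: b_def)
    \<comment> \<open>The pointwise form of Cauchy--Schwarz:
      \<open>2 * a * b \<le> a\<^sup>2 * u + b\<^sup>2 / u\<close>.\<close>
    have "0 \<le> (a * u - b)\<^sup>2 / u" using u by simp
    also have "(a * u - b)\<^sup>2 / u = a\<^sup>2 * u - 2 * (a * b) + b\<^sup>2 / u"
      using u by (simp add: power2_eq_square field_simps)
    finally have "2 * (a * b) \<le> a\<^sup>2 * u + b\<^sup>2 / u" by simp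
    moreover have "b\<^sup>2 / u \<le> 1 / (t\<^sup>2 + 1) * (1 / u)" using b u by (simp add: divide_right_mono mult_imp_div_pos_le flip: times_divide_eq_right) 
    moreover have "0 \<le> a * b" using b by (simp add: a_def)
    ultimately have "a * b \<le> a\<^sup>2 * u + 1 / (t\<^sup>2 + 1) * (1 / u)" by linarith
    moreover have "norm (f t / (1 + \<bar>t\<bar>)) = a * b" by (simp add: a_def b_def)
    moreover have "a\<^sup>2 = (f t)\<^sup>2" by (simp add: a_def)
    ultimately have "norm (f t / (1 + \<bar>t\<bar>)) \<le> (f t)\<^sup>2 * norm (s t) + 1 / ((t - 0)\<^sup>2 + 1\<^sup>2) * norm (g t)"
      using u by (simp add: u_def)
    then have "ennreal (norm (f t / (1 + \<bar>t\<bar>))) \<le> ennreal ((f t)\<^sup>2 * norm (s t) + 1 / ((t - 0)\<^sup>2 + 1\<^sup>2) * norm (g t))"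
      by (rule ennreal_leI)
    also have "\<dots> = ennreal ((f t)\<^sup>2 * norm (s t)) + ennreal (1 / ((t - 0)\<^sup>2 + 1\<^sup>2) * norm (g t))"
      by (rule ennreal_plus) auto
    finally show ?case .
  qed
  also have "\<dots> = weighted_square f + (\<integral>\<^sup>+t. ennreal (1 / ((t - 0)\<^sup>2 + 1\<^sup>2) * norm (g t)) \<partial>lborel)"
    unfolding weighted_square_def by (rule nn_integral_add) measurable
  also have "\<dots> \<le> weighted_square f + ennreal (pi * (1 + L) * Re (G (Complex 0 1)))"
    unfolding g_def by (intro add_left_mono poisson_vertical_limit_le holG ReG ImG) auto
  also have "\<dots> < \<infinity>" using fin by simp
  finally show "(\<integral>\<^sup>+t. ennreal (norm (f t / (1 + \<bar>t\<bar>))) \<partial>lborel) < \<infinity>" .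
qed

text \<open>By Cauchy--Schwarz for the Poisson kernel \<open>P\<close>, the squared Poisson integral
  of \<open>f\<close> is at most that of \<open>(f t)\<^sup>2 * \<bar>s t\<bar>\<close> times that
  of \<open>\<bar>g\<bar>\<close>. The latter is at most a multiple of \<open>Re (G z)\<close>,
  which the weight \<open>Re (S z)\<close> cancels. Fubini's theorem then integrates
  \<open>P\<close> in \<open>x\<close> to \<open>pi\<close>.\<close>

lemma Re_cauchy_transform_weighted_le:
  assumes f[measurable]: "f \<in> borel_measurable borel" and fin: "weighted_square f < \<infinity>" and y: "0 < y"
  shows "(\<integral>\<^sup>+x. ennreal ((Re (cauchy_transform f (Complex x y)))\<^sup>2 * Re (S (Complex x y))) \<partial>lborel) \<le> ennreal (1 + L) * weighted_square f"
proof -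
  note int = integrable_over_1_plus_abs[OF f fin]
  define P where "P x t = poisson x y t" for x t :: real
  have P0: "P x t \<ge> 0" for x t using y by (simp add: P_def)
  have [measurable]: "(\<lambda>t. P x t) \<in> borel_measurable borel" for x unfolding P_def by measurable
  have pw: "ennreal ((Re (cauchy_transform f (Complex x y)))\<^sup>2 * Re (S (Complex x y))) \<le>
     ennreal ((1 + L) / pi) * (\<integral>\<^sup>+t. ennreal (P x t * ((f t)\<^sup>2 * norm (s t))) \<partial>lborel)" for x
  proof -
    define A where "A = (\<integral>\<^sup>+t. ennreal (P x t * ((f t)\<^sup>2 * norm (s t))) \<partial>lborel)"
    define B where "B = (\<integral>\<^sup>+t. ennreal (P x t * norm (g t)) \<partial>lborel)"
    define u where "u = Re (cauchy_transform f (Complex x y))"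
    define z where "z = Complex x y"
    have z: "Im z > 0" using y by (simp add: z_def)
    have B: "B \<le> ennreal (pi * (1 + L) * Re (G z))"
      unfolding B_def P_def g_def z_def by (intro poisson_vertical_limit_le holG ReG ImG y)
    have "ennreal (pi * \<bar>u\<bar>) = ennreal (norm (\<integral>t. P x t * f t \<partial>lborel))"
      unfolding u_def cauchy_transform_parts(2)[OF f int y] P_def by (simp add: abs_divide)
    also have "\<dots> \<le> (\<integral>\<^sup>+t. ennreal (norm (P x t * f t)) \<partial>lborel)"
      unfolding P_def by (rule integral_norm_bound_ennreal[OF cauchy_transform_parts(1)[OF f int y]])
    also have "\<dots> = (\<integral>\<^sup>+t. ennreal (sqrt (P x t * ((f t)\<^sup>2 * norm (s t)))) * ennreal (sqrt (P x t * norm (g t))) \<partial>lborel)"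
      using AE_s
    proof (intro nn_integral_cong_AE, eventually_elim)
      case (elim t)
      have "norm (s t) * norm (g t) = 1" using elim by (metis norm_mult norm_one)
      then have "sqrt (P x t * ((f t)\<^sup>2 * norm (s t))) * sqrt (P x t * norm (g t)) = sqrt ((P x t * f t)\<^sup>2)"
        by (simp add: real_sqrt_mult[symmetric] power2_eq_square mult_ac)
      then show ?case by (simp add: ennreal_mult[symmetric] P0)
    qed
    finally have "(ennreal (pi * \<bar>u\<bar>))\<^sup>2 \<le> (\<integral>\<^sup>+t. ennreal (sqrt (P x t * ((f t)\<^sup>2 * norm (s t)))) * ennreal (sqrt (P x t * norm (g t))) \<partial>lborel)\<^sup>2"
      by (rule power_mono) simp
    also have "\<dots> \<le> (\<integral>\<^sup>+t. (ennreal (sqrt (P x t * ((f t)\<^sup>2 * norm (s t)))))\<^sup>2 \<partial>lborel) * (\<integral>\<^sup>+t. (ennreal (sqrt (P x t * norm (g t))))\<^sup>2 \<partial>lborel)"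
      by (rule Cauchy_Schwarz_nn_integral) measurable
    also have "\<dots> = A * B"
      unfolding A_def B_def by (simp add: ennreal_power P0)
    finally have 1: "ennreal ((pi * \<bar>u\<bar>)\<^sup>2) \<le> A * B" by (simp add: ennreal_power)
    \<comment> \<open>The one place in this estimate where it matters, beyond the two sector
      conditions, that \<open>G\<close> and \<open>S\<close> are reciprocal in the interior.\<close>
    have GS: "Re (G z) * Re (S z) \<le> 1"
    proof -
      have "Re (G z) * Re (S z) \<le> norm (G z) * norm (S z)"
        using complex_Re_le_cmod[of "G z"] complex_Re_le_cmod[of "S z"] ReG[OF z] ReS[OF z] by (intro mult_mono) auto
      also have "\<dots> = 1" using S_nz[OF z] by (simp add: G_def norm_divide)
      finally show ?thesis .
    qed
    have "ennreal (u\<^sup>2 * Re (S z)) = ennreal (Re (S z) / pi\<^sup>2) * ennreal ((pi * \<bar>u\<bar>)\<^sup>2)"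
      using ReS[OF z] by (simp add: ennreal_mult'[symmetric] power_mult_distrib)
    also have "\<dots> \<le> ennreal (Re (S z) / pi\<^sup>2) * (A * ennreal (pi * (1 + L) * Re (G z)))"
      using 1 mult_left_mono[OF B, of A] by (intro mult_left_mono) (auto intro: order_trans)
    also have "\<dots> = ennreal (Re (S z) / pi\<^sup>2 * (pi * (1 + L) * Re (G z))) * A"
      using ReS[OF z] by (simp only: ennreal_mult' divide_nonneg_nonneg less_imp_le zero_le_power2) (simp add: mult_ac)
    also have "Re (S z) / pi\<^sup>2 * (pi * (1 + L) * Re (G z)) = (1 + L) / pi * (Re (G z) * Re (S z))"
      by (simp add: power2_eq_square)
    also have "ennreal \<dots> * A \<le> ennreal ((1 + L) / pi) * A"
    proof (intro mult_right_mono ennreal_leI)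
      have "(1 + L) / pi * (Re (G z) * Re (S z)) \<le> (1 + L) / pi * 1" by (intro mult_left_mono GS) (use L in auto)
      then show "(1 + L) / pi * (Re (G z) * Re (S z)) \<le> (1 + L) / pi" by simp
    qed simp
    finally show ?thesis unfolding u_def z_def A_def .
  qed
  have [measurable]: "case_prod P \<in> borel_measurable (borel \<Otimes>\<^sub>M borel)" unfolding P_def by measurable
  have "(\<integral>\<^sup>+x. ennreal ((Re (cauchy_transform f (Complex x y)))\<^sup>2 * Re (S (Complex x y))) \<partial>lborel) \<le>
     (\<integral>\<^sup>+x. ennreal ((1 + L) / pi) * (\<integral>\<^sup>+t. ennreal (P x t * ((f t)\<^sup>2 * norm (s t))) \<partial>lborel) \<partial>lborel)"
    by (intro nn_integral_mono pw)
  also have "\<dots> = ennreal ((1 + L) / pi) * (\<integral>\<^sup>+x. (\<integral>\<^sup>+t. ennreal (P x t * ((f t)\<^sup>2 * norm (s t))) \<partial>lborel) \<partial>lborel)"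
    by (rule nn_integral_cmult) measurable
  also have "(\<integral>\<^sup>+x. (\<integral>\<^sup>+t. ennreal (P x t * ((f t)\<^sup>2 * norm (s t))) \<partial>lborel) \<partial>lborel) =
    (\<integral>\<^sup>+t. (\<integral>\<^sup>+x. ennreal (P x t * ((f t)\<^sup>2 * norm (s t))) \<partial>lborel) \<partial>lborel)"
    by (rule lborel_pair.Fubini') measurable
  also have "\<dots> = (\<integral>\<^sup>+t. ennreal pi * ennreal ((f t)\<^sup>2 * norm (s t)) \<partial>lborel)"
  proof (rule nn_integral_cong)
    fix t
    have "(\<integral>\<^sup>+x. ennreal (P x t) \<partial>lborel) = ennreal pi"
    proof -
      have "P x t = y / ((x - t)\<^sup>2 + y\<^sup>2)" for x by (simp add: P_def power2_commute[of t x])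
      then have "(\<integral>\<^sup>+x. ennreal (P x t) \<partial>lborel) = (\<integral>\<^sup>+x. ennreal (y / ((x - t)\<^sup>2 + y\<^sup>2)) \<partial>lborel)" by simp
      also have "\<dots> = ennreal pi"
        using has_bochner_integral_poisson[OF y, of t] y
        by (subst nn_integral_eq_integral) (auto simp: has_bochner_integral_iff)
      finally show ?thesis .
    qed
    then show "(\<integral>\<^sup>+x. ennreal (P x t * ((f t)\<^sup>2 * norm (s t))) \<partial>lborel) = ennreal pi * ennreal ((f t)\<^sup>2 * norm (s t))"
      by (simp add: ennreal_mult P0 nn_integral_multc)
  qed
  also have "\<dots> = ennreal pi * weighted_square f"
    unfolding weighted_square_def by (rule nn_integral_cmult) measurable
  also have "ennreal ((1 + L) / pi) * (ennreal pi * weighted_square f) = ennreal (1 + L) * weighted_square f"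
    using L by (simp add: mult.assoc[symmetric] ennreal_mult'[symmetric])
  finally show ?thesis .
qed


section \<open>Bounded data with bounded support\<close>

lemma cauchy_transform_bounded_support:
  assumes f[measurable]: "f \<in> borel_measurable borel" and M: "\<And>t. \<bar>f t\<bar> \<le> M" and N: "\<And>t. \<bar>t\<bar> > N \<Longrightarrow> f t = 0"
    and M0: "0 < M" and N0: "0 < N"
  shows "integrable lborel (\<lambda>t. f t / (1 + \<bar>t\<bar>))"
    and "\<And>z d. Im z > 0 \<Longrightarrow> d > 0 \<Longrightarrow> (\<And>t. \<bar>t\<bar> \<le> N \<Longrightarrow> d \<le> norm (z - complex_of_real t)) \<Longrightarrow> norm (cauchy_transform f z) \<le> 2 * N * M / d"
    and "\<And>z. Im z > 0 \<Longrightarrow> \<bar>Re (cauchy_transform f z)\<bar> \<le> M"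
proof -
  have hN: "has_bochner_integral lborel (\<lambda>t. c * indicator {-N..N} t) (c * (2 * N))" for c :: real
  proof -
    have "has_bochner_integral lborel (indicator {-N..N} :: real \<Rightarrow> real) (measure lborel {-N..N})"
      by (rule has_bochner_integral_real_indicator) (use N0 in auto)
    then have "has_bochner_integral lborel (indicator {-N..N} :: real \<Rightarrow> real) (2 * N)" using N0 by simp
    then show ?thesis by (rule has_bochner_integral_mult_right)
  qed
  have iN: "integrable lborel (\<lambda>t. c * indicator {-N..N} t)" "(\<integral>t. c * indicator {-N..N} t \<partial>lborel) = c * (2 * N)" for c :: real
    using hN[of c] by (simp_all only: has_bochner_integral_iff)
  have fb: "\<bar>f t\<bar> \<le> M * indicator {-N..N} t" for t
    using M[of t] N[of t] by (cases "\<bar>t\<bar> \<le> N") (auto simp: indicator_def abs_le_iff)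
  show int: "integrable lborel (\<lambda>t. f t / (1 + \<bar>t\<bar>))"
  proof (rule Bochner_Integration.integrable_bound)
    show "integrable lborel (\<lambda>t. M * indicator {-N..N} t)" by (rule iN)
    show "AE t in lborel. norm (f t / (1 + \<bar>t\<bar>)) \<le> norm (M * indicator {-N..N} t)"
    proof (rule AE_I2)
      fix t
      have "\<bar>f t\<bar> / (1 + \<bar>t\<bar>) \<le> \<bar>f t\<bar> / 1" by (intro divide_left_mono) auto
      then show "norm (f t / (1 + \<bar>t\<bar>)) \<le> norm (M * indicator {-N..N} t)"
        using fb[of t] by (simp add: abs_divide)
    qed
  qed measurable
  show "norm (cauchy_transform f z) \<le> 2 * N * M / d" if z: "Im z > 0" and d: "d > 0"
     and dist: "\<And>t. \<bar>t\<bar> \<le> N \<Longrightarrow> d \<le> norm (z - complex_of_real t)" for z d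
  proof -
    have "norm (cauchy_transform f z) \<le> (\<integral>t. M / d * indicator {-N..N} t \<partial>lborel)"
      unfolding cauchy_transform_def
    proof (rule order_trans[OF integral_norm_bound], rule integral_mono')
      show "integrable lborel (\<lambda>t. M / d * indicator {-N..N} t)" by (rule iN)
      show "0 \<le> M / d * indicator {-N..N} t" for t using M0 d by simp
      show "norm (f t *\<^sub>R (\<i> / (complex_of_real pi * (z - complex_of_real t)))) \<le> M / d * indicator {-N..N} t" for t
      proof (cases "\<bar>t\<bar> \<le> N")
        case True
        have "norm (f t *\<^sub>R (\<i> / (complex_of_real pi * (z - complex_of_real t)))) = \<bar>f t\<bar> / (pi * norm (z - complex_of_real t))"
          by (simp add: norm_divide norm_mult)
        also have "\<dots> \<le> M / (1 * d)"
          using pi_gt3 d dist[OF True] M M0 by (intro frac_le mult_mono) auto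
        finally show ?thesis using True by (auto simp: indicator_def abs_le_iff)
      qed (use M0 d in \<open>simp add: N\<close>)
    qed
    also have "\<dots> = 2 * N * M / d" unfolding iN by simp
    finally show ?thesis .
  qed
  show "\<bar>Re (cauchy_transform f z)\<bar> \<le> M" if z: "Im z > 0" for z
  proof -
    define x where "x = Re z"
    define y where "y = Im z"
    have y: "y > 0" and zxy: "z = Complex x y" using z by (auto simp: x_def y_def)
    note P = has_bochner_integral_mult_left[OF has_bochner_integral_poisson[OF y, of x], of M]
    have "\<bar>\<integral>t. poisson x y t * f t \<partial>lborel\<bar> \<le> (\<integral>t. poisson x y t * M \<partial>lborel)"
      unfolding real_norm_def[symmetric]
    proof (rule order_trans[OF integral_norm_bound], rule integral_mono')
      show "integrable lborel (\<lambda>t. poisson x y t * M)" using P by (simp only: has_bochner_integral_iff)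
      show "0 \<le> poisson x y t * M" for t using y M0 by simp
      have "\<bar>poisson x y t\<bar> = poisson x y t" for t using y by simp
      then show "norm (poisson x y t * f t) \<le> poisson x y t * M" for t
        unfolding real_norm_def abs_mult using y M[of t] by (simp only:) (intro mult_left_mono; simp)
    qed
    also have "\<dots> = pi * M" using P by (simp only: has_bochner_integral_iff)
    finally show ?thesis
      unfolding zxy cauchy_transform_parts(2)[OF f int y] by (simp add: abs_divide field_simps)
  qed
qed

lemma integrable_S_horizontal:
  assumes c: "0 < c"
  shows "integrable lborel (\<lambda>t. 1 / (1 + t\<^sup>2) * norm (S (Complex t c)))"
  unfolding integrable_iff_bounded
proof
  have [measurable]: "(\<lambda>t. S (Complex t c)) \<in> borel_measurable borel"
    by (rule borel_measurable_upper_horizontal[OF holS c])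
  show "(\<lambda>t. 1 / (1 + t\<^sup>2) * norm (S (Complex t c))) \<in> borel_measurable lborel" by measurable
  have "(\<integral>\<^sup>+t. ennreal (norm (1 / (1 + t\<^sup>2) * norm (S (Complex t c)))) \<partial>lborel) \<le>
    (\<integral>\<^sup>+t. ennreal (1 + L) * ennreal (1 / ((t - 0)\<^sup>2 + 1\<^sup>2) * Re (S (Complex t c))) \<partial>lborel)"
  proof (rule nn_integral_mono)
    fix t :: real
    have n: "\<bar>1 / (1 + t\<^sup>2)\<bar> = 1 / (1 + t\<^sup>2)" by simp
    have "1 / (1 + t\<^sup>2) * norm (S (Complex t c)) \<le> 1 / (1 + t\<^sup>2) * ((1 + L) * Re (S (Complex t c)))"
      using c by (intro mult_left_mono norm_S_le) auto
    then have "norm (1 / (1 + t\<^sup>2) * norm (S (Complex t c))) \<le> (1 + L) * (1 / ((t - 0)\<^sup>2 + 1\<^sup>2) * Re (S (Complex t c)))"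
      unfolding real_norm_def abs_mult n by (simp add: mult_ac add.commute)
    then show "ennreal (norm (1 / (1 + t\<^sup>2) * norm (S (Complex t c)))) \<le> ennreal (1 + L) * ennreal (1 / ((t - 0)\<^sup>2 + 1\<^sup>2) * Re (S (Complex t c)))"
      using L by (subst ennreal_mult'[symmetric]) (auto intro: ennreal_leI)
  qed
  also have "\<dots> = ennreal (1 + L) * (\<integral>\<^sup>+t. ennreal (1 / ((t - 0)\<^sup>2 + 1\<^sup>2) * Re (S (Complex t c))) \<partial>lborel)"
    by (rule nn_integral_cmult) measurable
  also have "\<dots> \<le> ennreal (1 + L) * ennreal (pi * Re (S (Complex 0 (c + 1))))"
    using ReS less_imp_le by (intro mult_left_mono poisson_positive_le holS c) auto
  also have "\<dots> < \<infinity>" by (simp add: ennreal_mult_less_top)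
  finally show "(\<integral>\<^sup>+t. ennreal (norm (1 / (1 + t\<^sup>2) * norm (S (Complex t c)))) \<partial>lborel) < \<infinity>" .
qed

context
  fixes f :: "real \<Rightarrow> real" and M N :: real
  assumes f [measurable]: "f \<in> borel_measurable borel" and M: "\<And>t. \<bar>f t\<bar> \<le> M"
    and N: "\<And>t. \<bar>t\<bar> > N \<Longrightarrow> f t = 0" and M0: "0 < M" and N0: "0 < N"
begin

abbreviation F where "F \<equiv> cauchy_transform f"

lemma bounded_support:
  "integrable lborel (\<lambda>t. f t / (1 + \<bar>t\<bar>))"
  "Im z > 0 \<Longrightarrow> d > 0 \<Longrightarrow> (\<And>t. \<bar>t\<bar> \<le> N \<Longrightarrow> d \<le> norm (z - complex_of_real t)) \<Longrightarrow> norm (F z) \<le> 2 * N * M / d"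
  "Im z > 0 \<Longrightarrow> \<bar>Re (F z)\<bar> \<le> M"
  by (rule cauchy_transform_bounded_support[where M=M and N=N]; simp add: f M N M0 N0)+

lemma holF: "F holomorphic_on upper_half_plane"
  by (rule holomorphic_cauchy_transform[OF f bounded_support(1)])

lemma F_far: "Im z > 0 \<Longrightarrow> norm z \<ge> 2 * N \<Longrightarrow> norm (F z) \<le> 4 * N * M / norm z"
proof -
  assume z: "Im z > 0" "norm z \<ge> 2 * N"
  have nz: "norm z > 0" using z N0 by linarith
  have "norm (F z) \<le> 2 * N * M / (norm z / 2)"
  proof (rule bounded_support(2))
    fix t assume "\<bar>t\<bar> \<le> N"
    then show "norm z / 2 \<le> norm (z - complex_of_real t)"
      using norm_triangle_ineq2[of z "complex_of_real t"] z by simp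
  qed (use z nz in auto)
  then show ?thesis by simp
qed

lemma F_above: "Im z \<ge> c \<Longrightarrow> c > 0 \<Longrightarrow> norm (F z) \<le> 2 * N * M / c"
proof (rule bounded_support(2))
  fix t assume "Im z \<ge> c"
  then show "c \<le> norm (z - complex_of_real t)" using abs_Im_le_cmod[of "z - complex_of_real t"] by simp
qed auto

text \<open>Beyond this radius the decay estimate \<open>F_far\<close> applies, and
  \<open>1 + x\<^sup>2\<close> is at most \<open>2 * \<bar>z\<bar>\<^sup>2\<close>.\<close>

definition R0 where "R0 = max 1 (2 * N)"

lemma F_square_far:
  assumes "y > 0" "norm (Complex x y) \<ge> R0" "y \<le> 1"
  shows "(norm (F (Complex x y)))\<^sup>2 * (1 + x\<^sup>2) \<le> 2 * (4 * N * M)\<^sup>2"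
proof -
  let ?z = "Complex x y"
  have n: "norm ?z \<ge> 1" "norm ?z \<ge> 2 * N" using assms by (auto simp: R0_def)
  have "1\<^sup>2 \<le> (norm ?z)\<^sup>2" using n(1) by (intro power_mono) auto
  moreover have "x\<^sup>2 \<le> (norm ?z)\<^sup>2" by (simp add: cmod_power2)
  ultimately have x: "1 + x\<^sup>2 \<le> 2 * (norm ?z)\<^sup>2" by simp
  have "norm (F ?z) \<le> 4 * N * M / norm ?z" using n assms by (intro F_far) auto
  then have "(norm (F ?z))\<^sup>2 \<le> (4 * N * M / norm ?z)\<^sup>2" by (intro power_mono) auto
  then have "(norm (F ?z))\<^sup>2 * (1 + x\<^sup>2) \<le> (4 * N * M / norm ?z)\<^sup>2 * (2 * (norm ?z)\<^sup>2)"
    using x by (intro mult_mono) auto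
  also have "\<dots> = 2 * (4 * N * M)\<^sup>2"
  proof -
    have "norm ?z \<noteq> 0" using n(1) by linarith
    then show ?thesis by (simp only: power_divide) simp
  qed
  finally show ?thesis .
qed

lemma F_square_near:
  assumes "norm (Complex x y) < R0" shows "1 + x\<^sup>2 \<le> 1 + R0\<^sup>2"
proof -
  have "\<bar>x\<bar> \<le> R0" using abs_Re_le_cmod[of "Complex x y"] assms by simp
  then show ?thesis using power_mono[of "\<bar>x\<bar>" R0 2] by simp
qed

lemma integrable_F_square_S:
  assumes c: "0 < c" "c \<le> 1"
  shows "integrable lborel (\<lambda>x. (norm (F (Complex x c)))\<^sup>2 * norm (S (Complex x c)))"
proof -
  define C where "C = 2 * (4 * N * M)\<^sup>2 + (2 * N * M / c)\<^sup>2 * (1 + R0\<^sup>2)"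
  have C0: "C \<ge> 0" by (simp add: C_def)
  have C: "(norm (F (Complex x c)))\<^sup>2 * (1 + x\<^sup>2) \<le> C" for x
  proof (cases "norm (Complex x c) \<ge> R0")
    case True
    have "(norm (F (Complex x c)))\<^sup>2 * (1 + x\<^sup>2) \<le> 2 * (4 * N * M)\<^sup>2"
      using c True by (intro F_square_far) auto
    then show ?thesis unfolding C_def by (simp add: add_increasing2)
  next
    case False
    have "norm (F (Complex x c)) \<le> 2 * N * M / c" using c by (intro F_above) auto
    then have "(norm (F (Complex x c)))\<^sup>2 * (1 + x\<^sup>2) \<le> (2 * N * M / c)\<^sup>2 * (1 + R0\<^sup>2)"
      using False F_square_near[of x c] by (intro mult_mono power_mono) auto
    then show ?thesis unfolding C_def by (simp add: add_increasing)
  qed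
  have [measurable]: "(\<lambda>t. S (Complex t c)) \<in> borel_measurable borel" "(\<lambda>t. F (Complex t c)) \<in> borel_measurable borel"
    by (rule borel_measurable_upper_horizontal[OF holS c(1)], rule borel_measurable_upper_horizontal[OF holF c(1)])
  show ?thesis
  proof (rule Bochner_Integration.integrable_bound)
    show "integrable lborel (\<lambda>t. C * (1 / (1 + t\<^sup>2) * norm (S (Complex t c))))"
      by (intro integrable_mult_right integrable_S_horizontal c)
    show "AE t in lborel. norm ((norm (F (Complex t c)))\<^sup>2 * norm (S (Complex t c))) \<le> norm (C * (1 / (1 + t\<^sup>2) * norm (S (Complex t c))))"
    proof (rule AE_I2)
      fix t :: real
      have pos: "1 + t\<^sup>2 > 0" by (simp add: add_pos_nonneg)
      have "(norm (F (Complex t c)))\<^sup>2 \<le> C * (1 / (1 + t\<^sup>2))" using C[of t] pos by (simp add: field_simps)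
      then have "(norm (F (Complex t c)))\<^sup>2 * norm (S (Complex t c)) \<le> C * (1 / (1 + t\<^sup>2)) * norm (S (Complex t c))"
        by (intro mult_right_mono) auto
      then show "norm ((norm (F (Complex t c)))\<^sup>2 * norm (S (Complex t c))) \<le> norm (C * (1 / (1 + t\<^sup>2) * norm (S (Complex t c))))"
        using C0 by (simp add: abs_mult)
    qed
  qed measurable
qed

text \<open>\<open>S\<close> may grow, so \<open>F\<^sup>2 * S\<close> lacks the quadratic decay
  required for Cauchy's theorem. The quotient \<open>S / (1 + d * S)\<close> is bounded by
  \<open>1 / d\<close> and also by \<open>\<bar>S\<bar>\<close>; the first bound gives a vanishing
  integral for each \<open>d\<close>, the second lets \<open>d\<close> tend to 0.\<close>

lemma integral_F_square_S_horizontal: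
  assumes c: "0 < c" "c \<le> 1"
  shows "(\<integral>x. (F (Complex x c))\<^sup>2 * S (Complex x c) \<partial>lborel) = 0"
proof -
  define d where "d n = 1 / (1 + real n)" for n
  have d: "d n > 0" for n by (simp add: d_def)
  have dlim: "d \<longlonglongrightarrow> 0" unfolding d_def by real_asymp
  define K where "K n z = (F z)\<^sup>2 * (S z / (1 + d n * S z))" for n z
  have re: "norm (1 + d n * S z) \<ge> 1" "norm (1 + d n * S z) \<ge> d n * norm (S z)" if "Im z > 0" for n z
  proof -
    have "1 \<le> Re (1 + d n * S z)" using ReS[OF that] d[of n] by simp
    then show "norm (1 + d n * S z) \<ge> 1" using complex_Re_le_cmod order_trans by blast
    have "(norm (d n * S z))\<^sup>2 \<le> (norm (1 + d n * S z))\<^sup>2"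
    proof -
      have "(d n * Re (S z))\<^sup>2 \<le> (1 + d n * Re (S z))\<^sup>2" using ReS[OF that] d[of n] by (intro power_mono) auto
      then show ?thesis unfolding cmod_power2 by simp
    qed
    then have "norm (d n * S z) \<le> norm (1 + d n * S z)" by (rule power2_le_imp_le) simp
    then show "norm (1 + d n * S z) \<ge> d n * norm (S z)" using d[of n] by (simp add: norm_mult)
  qed
  have ne: "1 + d n * S z \<noteq> 0" if "Im z > 0" for n z using re(1)[OF that, of n] by auto
  have qb: "norm (S z / (1 + d n * S z)) \<le> 1 / d n" "norm (S z / (1 + d n * S z)) \<le> norm (S z)" if "Im z > 0" for n z
  proof -
    have pos: "norm (1 + d n * S z) > 0" using ne[OF that, of n] by simp
    show "norm (S z / (1 + d n * S z)) \<le> 1 / d n"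
      using re(2)[OF that, of n] pos d[of n] by (simp add: norm_divide field_simps)
    have "norm (S z) / norm (1 + d n * S z) \<le> norm (S z) / 1"
      using re(1)[OF that, of n] by (intro divide_left_mono) auto
    then show "norm (S z / (1 + d n * S z)) \<le> norm (S z)" by (simp add: norm_divide)
  qed
  have holK: "K n holomorphic_on upper_half_plane" for n
    unfolding K_def by (intro holomorphic_intros holS holF) (use ne in auto)
  have z: "has_bochner_integral lborel (\<lambda>t. K n (Complex t c)) 0" for n
  proof (rule horizontal_integral_eq_zero[OF _ c(1) c(1)])
    show "K n holomorphic_on {z. 0 < Im z}" using holK by (simp add: upper_half_plane_def)
    fix z assume z: "Im z \<ge> c" "norm z \<ge> 2 * N"
    have zi: "Im z > 0" using z c by simp
    have "norm (K n z) \<le> (4 * N * M / norm z)\<^sup>2 * (1 / d n)"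
      unfolding K_def norm_mult norm_power using F_far[OF zi z(2)] qb[OF zi] by (intro mult_mono power_mono) auto
    then show "norm (K n z) \<le> (4 * N * M)\<^sup>2 * (1 / d n) / (norm z)\<^sup>2" by (simp add: power_divide mult.commute)
  qed
  have [measurable]: "(\<lambda>t. S (Complex t c)) \<in> borel_measurable borel" "(\<lambda>t. F (Complex t c)) \<in> borel_measurable borel"
    by (rule borel_measurable_upper_horizontal[OF holS c(1)], rule borel_measurable_upper_horizontal[OF holF c(1)])
  have "(\<lambda>n. \<integral>t. K n (Complex t c) \<partial>lborel) \<longlonglongrightarrow> (\<integral>t. (F (Complex t c))\<^sup>2 * S (Complex t c) \<partial>lborel)"
  proof (rule integral_dominated_convergence[where w="\<lambda>x. (norm (F (Complex x c)))\<^sup>2 * norm (S (Complex x c))"])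
    show "integrable lborel (\<lambda>x. (norm (F (Complex x c)))\<^sup>2 * norm (S (Complex x c)))" by (rule integrable_F_square_S[OF c])
    show "(\<lambda>t. K n (Complex t c)) \<in> borel_measurable lborel" for n unfolding K_def by measurable
    show "AE t in lborel. (\<lambda>n. K n (Complex t c)) \<longlonglongrightarrow> (F (Complex t c))\<^sup>2 * S (Complex t c)"
    proof (rule AE_I2)
      fix t
      have "(\<lambda>n. (F (Complex t c))\<^sup>2 * (S (Complex t c) / (1 + of_real (d n) * S (Complex t c)))) \<longlonglongrightarrow>
        (F (Complex t c))\<^sup>2 * (S (Complex t c) / (1 + of_real 0 * S (Complex t c)))"
        by (intro tendsto_intros dlim) auto
      then show "(\<lambda>n. K n (Complex t c)) \<longlonglongrightarrow> (F (Complex t c))\<^sup>2 * S (Complex t c)" by (simp add: K_def)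
    qed
    show "AE t in lborel. norm (K n (Complex t c)) \<le> (norm (F (Complex t c)))\<^sup>2 * norm (S (Complex t c))" for n
    proof (rule AE_I2)
      fix t
      show "norm (K n (Complex t c)) \<le> (norm (F (Complex t c)))\<^sup>2 * norm (S (Complex t c))"
        unfolding K_def norm_mult[of "(F (Complex t c))\<^sup>2"] norm_power by (intro mult_left_mono qb) (use c in auto)
    qed
  qed measurable
  then show ?thesis using z by (simp add: has_bochner_integral_iff LIMSEQ_const_iff)
qed

text \<open>With \<open>F = u + \<i> * v\<close> and \<open>S = a + \<i> * b\<close>, the real part
  of \<open>F\<^sup>2 * S\<close> is \<open>(u\<^sup>2 - v\<^sup>2) * a - 2 * u * v * b\<close> and
  integrates to 0. The mixed term is at most \<open>2 * L * \<bar>u * v\<bar> * a\<close> and half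
  of \<open>v\<^sup>2 * a\<close> absorbs it; finiteness of all integrals, known for these data,
  makes the absorption legitimate.\<close>

lemma Im_F_weighted_le_Re_F:
  assumes c: "0 < c" "c \<le> 1"
  shows "(\<integral>\<^sup>+x. ennreal ((Im (F (Complex x c)))\<^sup>2 * Re (S (Complex x c))) \<partial>lborel) \<le>
     ennreal (2 + 4 * L\<^sup>2) * (\<integral>\<^sup>+x. ennreal ((Re (F (Complex x c)))\<^sup>2 * Re (S (Complex x c))) \<partial>lborel)"
proof -
  define u where "u x = Re (F (Complex x c))" for x
  define v where "v x = Im (F (Complex x c))" for x
  define a where "a x = Re (S (Complex x c))" for x
  define b where "b x = Im (S (Complex x c))" for x
  have a: "a x > 0" "\<bar>b x\<bar> \<le> L * a x" for x using ReS[of "Complex x c"] ImS[of "Complex x c"] c by (auto simp: a_def b_def)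
  have mS: "(\<lambda>t. S (Complex t c)) \<in> borel_measurable borel" and mF: "(\<lambda>t. F (Complex t c)) \<in> borel_measurable borel"
    by (rule borel_measurable_upper_horizontal[OF holS c(1)], rule borel_measurable_upper_horizontal[OF holF c(1)])
  have [measurable]: "u \<in> borel_measurable borel" "v \<in> borel_measurable borel" "a \<in> borel_measurable borel"
    unfolding u_def v_def a_def using mS mF by measurable
  have i: "integrable lborel (\<lambda>x. (u x)\<^sup>2 * a x)" "integrable lborel (\<lambda>x. (v x)\<^sup>2 * a x)"
  proof -
    have uv: "(u x)\<^sup>2 \<le> (norm (F (Complex x c)))\<^sup>2" "(v x)\<^sup>2 \<le> (norm (F (Complex x c)))\<^sup>2"
      "a x \<le> norm (S (Complex x c))" for x
      using complex_Re_le_cmod[of "S (Complex x c)"] by (simp_all add: u_def v_def a_def cmod_power2)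
    have "norm ((u x)\<^sup>2 * a x) \<le> norm ((norm (F (Complex x c)))\<^sup>2 * norm (S (Complex x c)))"
      "norm ((v x)\<^sup>2 * a x) \<le> norm ((norm (F (Complex x c)))\<^sup>2 * norm (S (Complex x c)))" for x
      using uv[of x] a(1)[of x] by (simp_all add: abs_mult mult_mono)
    then show "integrable lborel (\<lambda>x. (u x)\<^sup>2 * a x)" "integrable lborel (\<lambda>x. (v x)\<^sup>2 * a x)"
      by (intro Bochner_Integration.integrable_bound[OF integrable_F_square_S[OF c]] AE_I2; measurable)+
  qed
  have iFS: "integrable lborel (\<lambda>x. (F (Complex x c))\<^sup>2 * S (Complex x c))"
    by (rule Bochner_Integration.integrable_bound[OF integrable_F_square_S[OF c]])
       (use mS mF in \<open>auto simp: norm_mult norm_power\<close>)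
  have R0: "(\<integral>x. Re ((F (Complex x c))\<^sup>2 * S (Complex x c)) \<partial>lborel) = 0"
    using integral_F_square_S_horizontal[OF c] integral_Re[OF iFS] by simp
  have pw: "(v x)\<^sup>2 * a x \<le> (2 + 4 * L\<^sup>2) * ((u x)\<^sup>2 * a x) - 2 * Re ((F (Complex x c))\<^sup>2 * S (Complex x c))" for x
  proof -
    have R: "Re ((F (Complex x c))\<^sup>2 * S (Complex x c)) = ((u x)\<^sup>2 - (v x)\<^sup>2) * a x - 2 * (u x * v x * b x)"
      by (simp add: u_def v_def a_def b_def power2_eq_square algebra_simps)
    have "- (u x * v x * b x) \<le> \<bar>u x\<bar> * \<bar>v x\<bar> * \<bar>b x\<bar>" by (metis abs_ge_minus_self abs_mult)
    also have "\<dots> \<le> \<bar>u x\<bar> * \<bar>v x\<bar> * (L * a x)" using a[of x] by (intro mult_left_mono) auto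
    finally have 1: "- (u x * v x * b x) \<le> \<bar>u x\<bar> * \<bar>v x\<bar> * L * a x" by simp
    \<comment> \<open>The coefficient \<open>2 * L\<close> is chosen so that the mixed term costs
      half of \<open>v\<^sup>2 * a\<close>. Doubling the resulting inequality gives the constant
      \<open>2 + 4 * L\<^sup>2\<close>.\<close>
    have "0 \<le> (\<bar>v x\<bar> - 2 * L * \<bar>u x\<bar>)\<^sup>2 * a x" using a[of x] by simp
    also have "\<dots> = (v x)\<^sup>2 * a x - 4 * (\<bar>u x\<bar> * \<bar>v x\<bar> * L * a x) + 4 * L\<^sup>2 * ((u x)\<^sup>2 * a x)"
      by (simp add: power2_eq_square algebra_simps)
    finally have 2: "4 * (\<bar>u x\<bar> * \<bar>v x\<bar> * L * a x) \<le> (v x)\<^sup>2 * a x + 4 * L\<^sup>2 * ((u x)\<^sup>2 * a x)" by simp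
    have "(2 + 4 * L\<^sup>2) * ((u x)\<^sup>2 * a x) - 2 * Re ((F (Complex x c))\<^sup>2 * S (Complex x c))
      = 4 * L\<^sup>2 * ((u x)\<^sup>2 * a x) + 2 * ((v x)\<^sup>2 * a x) + 4 * (u x * v x * b x)"
      unfolding R by (simp add: algebra_simps)
    then show ?thesis using 1 2 by linarith
  qed
  have "(\<integral>x. (v x)\<^sup>2 * a x \<partial>lborel) \<le> (\<integral>x. (2 + 4 * L\<^sup>2) * ((u x)\<^sup>2 * a x) - 2 * Re ((F (Complex x c))\<^sup>2 * S (Complex x c)) \<partial>lborel)"
    by (intro integral_mono i pw Bochner_Integration.integrable_diff integrable_mult_right integrable_Re iFS)
  also have "\<dots> = (2 + 4 * L\<^sup>2) * (\<integral>x. (u x)\<^sup>2 * a x \<partial>lborel)"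
    using R0 by (subst Bochner_Integration.integral_diff) (auto intro!: integrable_mult_right i integrable_Re iFS simp: integral_mult_right_zero simp del: times_complex.sel)
  finally have le: "(\<integral>x. (v x)\<^sup>2 * a x \<partial>lborel) \<le> (2 + 4 * L\<^sup>2) * (\<integral>x. (u x)\<^sup>2 * a x \<partial>lborel)" .
  have "(\<integral>\<^sup>+x. ennreal ((v x)\<^sup>2 * a x) \<partial>lborel) = ennreal (\<integral>x. (v x)\<^sup>2 * a x \<partial>lborel)"
    by (intro nn_integral_eq_integral i AE_I2) (use a in \<open>simp add: less_imp_le\<close>)
  moreover have "(\<integral>\<^sup>+x. ennreal ((u x)\<^sup>2 * a x) \<partial>lborel) = ennreal (\<integral>x. (u x)\<^sup>2 * a x \<partial>lborel)"
    by (intro nn_integral_eq_integral i AE_I2) (use a in \<open>simp add: less_imp_le\<close>)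
  ultimately have "(\<integral>\<^sup>+x. ennreal ((v x)\<^sup>2 * a x) \<partial>lborel) \<le> ennreal (2 + 4 * L\<^sup>2) * (\<integral>\<^sup>+x. ennreal ((u x)\<^sup>2 * a x) \<partial>lborel)"
    using ennreal_leI[OF le] ennreal_mult'[of "2 + 4 * L\<^sup>2" "\<integral>x. (u x)\<^sup>2 * a x \<partial>lborel"]
    by (simp del: ennreal_plus)
  then show ?thesis by (simp add: u_def v_def a_def)
qed

text \<open>As \<open>Re F\<close> is bounded, \<open>exp (\<plusminus> \<i> \<kappa> F) * S\<close> takes values in a proper sector for small \<open>\<kappa>\<close>,
  so that \<open>exp \<bar>\<kappa> * Im F\<bar> * \<bar>S\<bar>\<close> is controlled near the real line.\<close>

lemma boundary_integral_F_square_S: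
  "integrable lborel (\<lambda>x. (vertical_limit F x)\<^sup>2 * s x)" "(\<integral>x. (vertical_limit F x)\<^sup>2 * s x \<partial>lborel) = 0"
proof -
  let ?c = "\<lambda>n. 1 / (1 + real n)"
  \<comment> \<open>Spends half of the room between \<open>p * arctan L\<close> and
    \<open>pi / 2\<close>, so that \<open>\<theta>\<close> below is the midpoint of the two.\<close>
  define \<kappa> where "\<kappa> = (pi / 2 - p * arctan L) / (2 * p * M)"
  have \<kappa>: "\<kappa> > 0" using p M0 by (simp add: \<kappa>_def)
  define \<theta> where "\<theta> = p * (\<kappa> * M + arctan L)"
  have \<theta>: "\<theta> < pi / 2"
  proof -
    have "p * (\<kappa> * M) = (pi / 2 - p * arctan L) / 2" using p M0 by (simp add: \<kappa>_def)
    then show ?thesis using p by (simp add: \<theta>_def distrib_left)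
  qed
  \<comment> \<open>A logarithm of the \<open>p\<close>-th power of
    \<open>exp (\<sigma> * \<kappa> * \<i> * F) * S\<close>. It is used with
    \<open>\<sigma> = 1\<close> and \<open>\<sigma> = -1\<close>, since \<open>Im F\<close> may be
    large with either sign.\<close>
  define \<Lambda> where "\<Lambda> \<sigma> z = of_real p * (of_real (\<sigma> * \<kappa>) * (\<i> * F z) + Ln (S z))" for \<sigma> :: real and z
  have hol\<Lambda>: "\<Lambda> \<sigma> holomorphic_on upper_half_plane" for \<sigma>
    unfolding \<Lambda>_def by (intro holomorphic_intros holF sector_Ln_holomorphic holS ReS)
  have Im\<Lambda>: "\<bar>Im (\<Lambda> \<sigma> z)\<bar> \<le> \<theta>" if "Im z > 0" "\<bar>\<sigma>\<bar> = 1" for \<sigma> z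
  proof -
    have "\<bar>\<sigma> * \<kappa> * Re (F z) + Im (Ln (S z))\<bar> \<le> \<bar>\<sigma> * \<kappa> * Re (F z)\<bar> + \<bar>Im (Ln (S z))\<bar>" by (rule abs_triangle_ineq)
    also have "\<bar>\<sigma> * \<kappa> * Re (F z)\<bar> \<le> \<kappa> * M"
      using that \<kappa> bounded_support(3)[OF that(1)] by (simp add: abs_mult mult_left_mono)
    also have "\<bar>Im (Ln (S z))\<bar> \<le> arctan L" using that by (intro Im_Ln_le_of_sector ReS ImS)
    finally have "p * \<bar>\<sigma> * \<kappa> * Re (F z) + Im (Ln (S z))\<bar> \<le> \<theta>" unfolding \<theta>_def using p by (intro mult_left_mono) auto
    moreover have "Im (\<Lambda> \<sigma> z) = p * (\<sigma> * \<kappa> * Re (F z) + Im (Ln (S z)))" by (simp add: \<Lambda>_def)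
    ultimately show ?thesis using p by (simp add: abs_mult)
  qed
  have exp\<Lambda>: "exp (Re (\<Lambda> \<sigma> z)) = (exp (- \<sigma> * \<kappa> * Im (F z)) * norm (S z)) powr p" if "Im z > 0" for \<sigma> z
  proof -
    have "(exp (- \<sigma> * \<kappa> * Im (F z)) * norm (S z)) powr p = exp (p * ln (exp (- \<sigma> * \<kappa> * Im (F z)) * norm (S z)))"
      using S_nz[OF that] by (simp add: powr_def)
    also have "ln (exp (- \<sigma> * \<kappa> * Im (F z)) * norm (S z)) = - \<sigma> * \<kappa> * Im (F z) + ln (norm (S z))"
      using S_nz[OF that] by (simp add: ln_mult)
    finally show ?thesis using S_nz[OF that] by (simp add: \<Lambda>_def)
  qed
  obtain C1 where C1: "\<And>n. (\<integral>\<^sup>+t. ennreal (1 / (1 + t\<^sup>2) * exp (Re (\<Lambda> 1 (Complex t (?c n))))) \<partial>lborel) \<le> ennreal C1"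
    using nn_integral_exp_horizontal_bounded[OF hol\<Lambda> \<theta> Im\<Lambda>, of 1] by auto
  obtain C2 where C2: "\<And>n. (\<integral>\<^sup>+t. ennreal (1 / (1 + t\<^sup>2) * exp (Re (\<Lambda> (-1) (Complex t (?c n))))) \<partial>lborel) \<le> ennreal C2"
    using nn_integral_exp_horizontal_bounded[OF hol\<Lambda> \<theta> Im\<Lambda>, of "-1"] by auto
  \<comment> \<open>Adds the bounds for the two regions: far away \<open>F\<close> decays, and near
    the origin \<open>Re F\<close> is bounded by \<open>M\<close>. Only the size of
    \<open>Im F\<close> remains.\<close>
  define B where "B = 2 * (4 * N * M)\<^sup>2 + (M\<^sup>2 + 1) * (1 + R0\<^sup>2)"
  have B0: "B \<ge> 0" by (simp add: B_def)
  have FB: "(norm (F (Complex t y)))\<^sup>2 * (1 + t\<^sup>2) \<le> B * (1 + (Im (F (Complex t y)))\<^sup>2)" if y: "0 < y" "y \<le> 1" for t y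
  proof (cases "norm (Complex t y) \<ge> R0")
    case True
    have "(norm (F (Complex t y)))\<^sup>2 * (1 + t\<^sup>2) \<le> 2 * (4 * N * M)\<^sup>2" by (rule F_square_far[OF y(1) True y(2)])
    also have "\<dots> \<le> B * 1" by (simp add: B_def)
    also have "\<dots> \<le> B * (1 + (Im (F (Complex t y)))\<^sup>2)" using B0 by (intro mult_left_mono) auto
    finally show ?thesis .
  next
    case False
    have "(Re (F (Complex t y)))\<^sup>2 \<le> M\<^sup>2"
      using power_mono[OF bounded_support(3)[of "Complex t y"], of 2] y by simp
    then have "(norm (F (Complex t y)))\<^sup>2 \<le> M\<^sup>2 + (Im (F (Complex t y)))\<^sup>2" by (simp add: cmod_power2)
    also have "\<dots> \<le> (M\<^sup>2 + 1) * (1 + (Im (F (Complex t y)))\<^sup>2)" by (simp add: algebra_simps)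
    finally have "(norm (F (Complex t y)))\<^sup>2 * (1 + t\<^sup>2) \<le> (M\<^sup>2 + 1) * (1 + (Im (F (Complex t y)))\<^sup>2) * (1 + R0\<^sup>2)"
      using F_square_near[of t y] False by (intro mult_mono) auto
    also have "\<dots> = (M\<^sup>2 + 1) * (1 + R0\<^sup>2) * (1 + (Im (F (Complex t y)))\<^sup>2)" by simp
    also have "\<dots> \<le> B * (1 + (Im (F (Complex t y)))\<^sup>2)" by (intro mult_right_mono) (auto simp: B_def)
    finally show ?thesis .
  qed
  define A where "A = B * (1 + 2 / \<kappa>\<^sup>2)"
  have A0: "A \<ge> 0" using B0 by (simp add: A_def)
  \<comment> \<open>The quadratic growth in \<open>Im F\<close> is dominated by the two
    exponentials, whatever the size of \<open>\<kappa>\<close>.\<close>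
  have expb: "1 + v\<^sup>2 \<le> (1 + 2 / \<kappa>\<^sup>2) * (exp (\<kappa> * v) + exp (- \<kappa> * v))" for v :: real
  proof -
    have "1 + \<bar>\<kappa> * v\<bar> + \<bar>\<kappa> * v\<bar>\<^sup>2 / 2 \<le> exp \<bar>\<kappa> * v\<bar>" by (rule exp_lower_Taylor_quadratic) simp
    also have "exp \<bar>\<kappa> * v\<bar> \<le> exp (\<kappa> * v) + exp (- \<kappa> * v)" by (cases "\<kappa> * v \<ge> 0") auto
    finally have e: "1 + \<bar>\<kappa> * v\<bar> + (\<kappa> * v)\<^sup>2 / 2 \<le> exp (\<kappa> * v) + exp (- \<kappa> * v)" by simp
    have "1 \<le> exp (\<kappa> * v) + exp (- \<kappa> * v)" using e zero_le_power2[of "\<kappa> * v"] abs_ge_zero[of "\<kappa> * v"] by linarith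
    moreover have "(\<kappa> * v)\<^sup>2 / 2 \<le> exp (\<kappa> * v) + exp (- \<kappa> * v)" using e abs_ge_zero[of "\<kappa> * v"] by linarith
    then have "2 / \<kappa>\<^sup>2 * ((\<kappa> * v)\<^sup>2 / 2) \<le> 2 / \<kappa>\<^sup>2 * (exp (\<kappa> * v) + exp (- \<kappa> * v))" by (intro mult_left_mono) auto
    then have "v\<^sup>2 \<le> 2 / \<kappa>\<^sup>2 * (exp (\<kappa> * v) + exp (- \<kappa> * v))" using \<kappa> by (simp add: power_mult_distrib)
    ultimately show ?thesis unfolding distrib_right mult_1_left by (rule add_mono)
  qed
  have pb: "(u + v) powr p \<le> 2 powr p * (u powr p + v powr p)" if "0 \<le> u" "0 \<le> v" for u v :: real
  proof -
    have "(u + v) powr p \<le> (2 * max u v) powr p" using that p by (intro powr_mono2) auto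
    also have "\<dots> = 2 powr p * (max u v powr p)" using that by (simp add: powr_mult)
    also have "max u v powr p \<le> u powr p + v powr p" by (simp add: max_def add_increasing add_increasing2)
    finally show ?thesis by simp
  qed
  have [measurable]: "(\<lambda>t. S (Complex t (?c n))) \<in> borel_measurable borel" "(\<lambda>t. F (Complex t (?c n))) \<in> borel_measurable borel"
     "(\<lambda>t. \<Lambda> \<sigma> (Complex t (?c n))) \<in> borel_measurable borel" for n \<sigma>
    by (intro borel_measurable_upper_horizontal holS holF hol\<Lambda>; simp)+
  have [measurable]: "vertical_limit F \<in> borel_measurable borel" by (rule borel_measurable_vertical_limit[OF holF])
  define E where "E \<sigma> n t = 1 / (1 + t\<^sup>2) * exp (Re (\<Lambda> \<sigma> (Complex t (?c n))))" for \<sigma> n t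
  have [measurable]: "E \<sigma> n \<in> borel_measurable borel" for \<sigma> n unfolding E_def by measurable
  have pw: "1 / (1 + t\<^sup>2) * norm ((1 + t\<^sup>2) *\<^sub>R ((F (Complex t (?c n)))\<^sup>2 * S (Complex t (?c n)))) powr p
     \<le> A powr p * 2 powr p * (E 1 n t + E (-1) n t)" for n t
  proof -
    let ?z = "Complex t (?c n)" and ?v = "Im (F (Complex t (?c n)))"
    have z: "Im ?z > 0" by simp
    have "norm ((1 + t\<^sup>2) *\<^sub>R ((F ?z)\<^sup>2 * S ?z)) = (norm (F ?z))\<^sup>2 * (1 + t\<^sup>2) * norm (S ?z)"
      by (simp add: norm_mult norm_power abs_of_nonneg)
    also have "\<dots> \<le> B * (1 + ?v\<^sup>2) * norm (S ?z)" by (intro mult_right_mono FB) auto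
    also have "\<dots> \<le> B * ((1 + 2 / \<kappa>\<^sup>2) * (exp (\<kappa> * ?v) + exp (- \<kappa> * ?v))) * norm (S ?z)"
      using B0 by (intro mult_right_mono mult_left_mono expb) auto
    also have "\<dots> = A * (exp (- 1 * \<kappa> * ?v) * norm (S ?z) + exp (- (- 1) * \<kappa> * ?v) * norm (S ?z))"
      by (simp add: A_def algebra_simps)
    finally have "norm ((1 + t\<^sup>2) *\<^sub>R ((F ?z)\<^sup>2 * S ?z)) powr p \<le>
       (A * (exp (- 1 * \<kappa> * ?v) * norm (S ?z) + exp (- (- 1) * \<kappa> * ?v) * norm (S ?z))) powr p"
      using p by (intro powr_mono2) auto
    also have "\<dots> = A powr p * (exp (- 1 * \<kappa> * ?v) * norm (S ?z) + exp (- (- 1) * \<kappa> * ?v) * norm (S ?z)) powr p"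
      by (rule powr_mult)
    also have "\<dots> \<le> A powr p * (2 powr p * (exp (Re (\<Lambda> 1 ?z)) + exp (Re (\<Lambda> (-1) ?z))))"
      unfolding exp\<Lambda>[OF z] by (intro mult_left_mono pb) auto
    finally have "1 / (1 + t\<^sup>2) * norm ((1 + t\<^sup>2) *\<^sub>R ((F ?z)\<^sup>2 * S ?z)) powr p \<le>
       1 / (1 + t\<^sup>2) * (A powr p * (2 powr p * (exp (Re (\<Lambda> 1 ?z)) + exp (Re (\<Lambda> (-1) ?z)))))"
      by (intro mult_left_mono) auto
    also have "\<dots> = A powr p * 2 powr p * (E 1 n t + E (-1) n t)" by (simp add: E_def algebra_simps add_divide_distrib)
    finally show ?thesis .
  qed
  have bd: "(\<integral>\<^sup>+t. ennreal (1 / (1 + t\<^sup>2) * norm ((1 + t\<^sup>2) *\<^sub>R ((F (Complex t (?c n)))\<^sup>2 * S (Complex t (?c n)))) powr p) \<partial>lborel)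
     \<le> ennreal (A powr p * 2 powr p * (\<bar>C1\<bar> + \<bar>C2\<bar>))" for n
  proof -
    have E0: "E \<sigma> n t \<ge> 0" for \<sigma> t by (simp add: E_def)
    have "(\<integral>\<^sup>+t. ennreal (1 / (1 + t\<^sup>2) * norm ((1 + t\<^sup>2) *\<^sub>R ((F (Complex t (?c n)))\<^sup>2 * S (Complex t (?c n)))) powr p) \<partial>lborel)
      \<le> (\<integral>\<^sup>+t. ennreal (A powr p * 2 powr p) * (ennreal (E 1 n t) + ennreal (E (-1) n t)) \<partial>lborel)"
    proof (rule nn_integral_mono)
      fix t
      have "ennreal (A powr p * 2 powr p) * (ennreal (E 1 n t) + ennreal (E (-1) n t)) = ennreal (A powr p * 2 powr p * (E 1 n t + E (-1) n t))"
        by (simp add: ennreal_mult' E0)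
      then show "ennreal (1 / (1 + t\<^sup>2) * norm ((1 + t\<^sup>2) *\<^sub>R ((F (Complex t (?c n)))\<^sup>2 * S (Complex t (?c n)))) powr p)
        \<le> ennreal (A powr p * 2 powr p) * (ennreal (E 1 n t) + ennreal (E (-1) n t))"
        using ennreal_leI[OF pw[of t n]] by simp
    qed
    also have "\<dots> = ennreal (A powr p * 2 powr p) * ((\<integral>\<^sup>+t. ennreal (E 1 n t) \<partial>lborel) + (\<integral>\<^sup>+t. ennreal (E (-1) n t) \<partial>lborel))"
      by (subst nn_integral_cmult, measurable, subst nn_integral_add, measurable)
    also have "\<dots> \<le> ennreal (A powr p * 2 powr p) * (ennreal \<bar>C1\<bar> + ennreal \<bar>C2\<bar>)"
      unfolding E_def by (intro mult_left_mono add_mono order_trans[OF C1] order_trans[OF C2] ennreal_leI) auto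
    also have "\<dots> = ennreal (A powr p * 2 powr p * (\<bar>C1\<bar> + \<bar>C2\<bar>))" by (simp add: ennreal_mult')
    finally show ?thesis .
  qed
  have lim: "AE x in lborel. (\<lambda>n. (F (Complex x (?c n)))\<^sup>2 * S (Complex x (?c n))) \<longlonglongrightarrow> (vertical_limit F x)\<^sup>2 * s x"
    using AE_s AE_hilbert_transform[OF f bounded_support(1)]
  proof eventually_elim
    case (elim x)
    then have "((\<lambda>y. F (Complex x y)) \<longlongrightarrow> Complex (f x) (hilbert_transform f x)) (at_right 0)" by blast
    note l = vertical_limit_eqI[OF this]
    show ?case unfolding l(1) using elim by (intro tendsto_mult tendsto_power l(2)) auto
  qed
  have m: "(\<lambda>x. (F (Complex x (?c n)))\<^sup>2 * S (Complex x (?c n))) \<in> borel_measurable borel"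
     "(\<lambda>x. (vertical_limit F x)\<^sup>2 * s x) \<in> borel_measurable borel" for n by measurable
  note U = tendsto_integral_lborel_of_bounded_powr[OF m lim p(1) bd]
  show "integrable lborel (\<lambda>x. (vertical_limit F x)\<^sup>2 * s x)" by (rule U)
  have "(\<integral>x. (F (Complex x (?c n)))\<^sup>2 * S (Complex x (?c n)) \<partial>lborel) = 0" for n
    by (rule integral_F_square_S_horizontal) auto
  then show "(\<integral>x. (vertical_limit F x)\<^sup>2 * s x \<partial>lborel) = 0"
    using U(2) by (simp add: LIMSEQ_const_iff)
qed

end


section \<open>Truncation and passage to all of the weighted space\<close>

definition cut :: "nat \<Rightarrow> (real \<Rightarrow> real) \<Rightarrow> real \<Rightarrow> real" where
  "cut n f t = (if \<bar>t\<bar> \<le> 1 + real n \<and> \<bar>f t\<bar> \<le> 1 + real n then f t else 0)"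

lemma cut_measurable [measurable]:
  assumes [measurable]: "f \<in> borel_measurable borel" shows "cut n f \<in> borel_measurable borel"
  unfolding cut_def by measurable

lemma cut_bounds: "\<bar>cut n f t\<bar> \<le> 1 + real n" "\<bar>t\<bar> > 1 + real n \<Longrightarrow> cut n f t = 0" "\<bar>cut n f t\<bar> \<le> \<bar>f t\<bar>"
  "\<bar>f t - cut n f t\<bar> \<le> \<bar>f t\<bar>"
  by (auto simp: cut_def)

lemma cut_tendsto: "(\<lambda>n. cut n f t) \<longlonglongrightarrow> f t"
proof (rule tendsto_eventually)
  obtain N :: nat where N: "max \<bar>t\<bar> \<bar>f t\<bar> < real N" using reals_Archimedean2 by blast
  show "eventually (\<lambda>n. cut n f t = f t) sequentially"
    using eventually_ge_at_top[of N] by (rule eventually_mono) (use N in \<open>auto simp: cut_def\<close>)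
qed

lemma weighted_square_mono: "(\<And>t. \<bar>f t\<bar> \<le> \<bar>h t\<bar>) \<Longrightarrow> weighted_square f \<le> weighted_square h"
  unfolding weighted_square_def
  by (intro nn_integral_mono ennreal_leI mult_right_mono) (simp_all add: abs_le_square_iff)

lemma weighted_square_cut_tendsto:
  assumes [measurable]: "f \<in> borel_measurable borel" and fin: "weighted_square f < \<infinity>"
  shows "(\<lambda>n. weighted_square (\<lambda>t. f t - cut n f t)) \<longlonglongrightarrow> 0"
proof -
  have "(\<lambda>n. \<integral>\<^sup>+t. ennreal ((f t - cut n f t)\<^sup>2 * norm (s t)) \<partial>lborel) \<longlonglongrightarrow> (\<integral>\<^sup>+(t::real). 0 \<partial>lborel)"
  proof (rule nn_integral_dominated_convergence[where w="\<lambda>t. ennreal ((f t)\<^sup>2 * norm (s t))"])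
    show "AE t in lborel. ennreal ((f t - cut n f t)\<^sup>2 * norm (s t)) \<le> ennreal ((f t)\<^sup>2 * norm (s t))" for n
      using cut_bounds(4)[of f _ n] by (intro AE_I2 ennreal_leI mult_right_mono) (simp_all add: abs_le_square_iff)
    show "(\<integral>\<^sup>+t. ennreal ((f t)\<^sup>2 * norm (s t)) \<partial>lborel) < \<infinity>" using fin by (simp add: weighted_square_def)
    show "AE t in lborel. (\<lambda>n. ennreal ((f t - cut n f t)\<^sup>2 * norm (s t))) \<longlonglongrightarrow> 0"
    proof (rule AE_I2)
      fix t
      have "(\<lambda>n. (f t - cut n f t)\<^sup>2 * norm (s t)) \<longlonglongrightarrow> (f t - f t)\<^sup>2 * norm (s t)"
        by (intro tendsto_intros cut_tendsto)
      then show "(\<lambda>n. ennreal ((f t - cut n f t)\<^sup>2 * norm (s t))) \<longlonglongrightarrow> 0"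
        by (auto intro: tendsto_ennrealI simp flip: ennreal_0)
    qed
  qed measurable
  then show ?thesis by (simp add: weighted_square_def)
qed

lemma cauchy_transform_cut_tendsto:
  assumes f[measurable]: "f \<in> borel_measurable borel" and fin: "weighted_square f < \<infinity>" and z: "Im z > 0"
  shows "(\<lambda>n. cauchy_transform (cut n f) z) \<longlonglongrightarrow> cauchy_transform f z"
  unfolding cauchy_transform_def
proof (rule integral_dominated_convergence)
  note i = integrable_cauchy_kernel[OF f integrable_over_1_plus_abs[OF f fin] z]
  show "integrable lborel (\<lambda>t. norm (f t *\<^sub>R (\<i> / (complex_of_real pi * (z - complex_of_real t)))))"
    using i by (rule integrable_norm)
  show "AE t in lborel. norm (cut n f t *\<^sub>R (\<i> / (complex_of_real pi * (z - complex_of_real t)))) \<le>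
     norm (f t *\<^sub>R (\<i> / (complex_of_real pi * (z - complex_of_real t))))" for n
    unfolding norm_scaleR using cut_bounds(3) by (intro AE_I2 mult_right_mono) auto
  show "AE t in lborel. (\<lambda>n. cut n f t *\<^sub>R (\<i> / (complex_of_real pi * (z - complex_of_real t)))) \<longlonglongrightarrow>
     f t *\<^sub>R (\<i> / (complex_of_real pi * (z - complex_of_real t)))"
    by (intro AE_I2 tendsto_scaleR cut_tendsto tendsto_const)
qed measurable

text \<open>The product of the constants in \<open>Im_F_weighted_le_Re_F\<close> and
  \<open>Re_cauchy_transform_weighted_le\<close>.\<close>

definition K where "K = (2 + 4 * L\<^sup>2) * (1 + L)"

lemma K_nonneg: "K \<ge> 0" using L by (simp add: K_def)

text \<open>The bound for truncated data does not depend on the truncation, and the Cauchy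
  transforms of the truncations converge pointwise, so Fatou's lemma transfers it.\<close>

lemma Im_cauchy_transform_weighted_le:
  assumes f[measurable]: "f \<in> borel_measurable borel" and fin: "weighted_square f < \<infinity>" and c: "0 < c" "c \<le> 1"
  shows "(\<integral>\<^sup>+x. ennreal ((Im (cauchy_transform f (Complex x c)))\<^sup>2 * Re (S (Complex x c))) \<partial>lborel) \<le> ennreal K * weighted_square f"
proof -
  have finc: "weighted_square (cut n f) < \<infinity>" for n
    using weighted_square_mono[of "cut n f" f] cut_bounds(3) fin by (simp add: le_less_trans)
  have mS: "(\<lambda>t. S (Complex t c)) \<in> borel_measurable borel"
    by (rule borel_measurable_upper_horizontal[OF holS c(1)])
  have mF: "(\<lambda>t. cauchy_transform (cut n f) (Complex t c)) \<in> borel_measurable borel" for n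
    by (rule borel_measurable_upper_horizontal[OF holomorphic_cauchy_transform c(1)])
       (intro cut_measurable f integrable_over_1_plus_abs finc)+
  note [measurable] = mS mF
  have each: "(\<integral>\<^sup>+x. ennreal ((Im (cauchy_transform (cut n f) (Complex x c)))\<^sup>2 * Re (S (Complex x c))) \<partial>lborel) \<le> ennreal K * weighted_square f" for n
  proof -
    have "(\<integral>\<^sup>+x. ennreal ((Im (cauchy_transform (cut n f) (Complex x c)))\<^sup>2 * Re (S (Complex x c))) \<partial>lborel) \<le>
      ennreal (2 + 4 * L\<^sup>2) * (\<integral>\<^sup>+x. ennreal ((Re (cauchy_transform (cut n f) (Complex x c)))\<^sup>2 * Re (S (Complex x c))) \<partial>lborel)"
      \<comment> \<open>The truncation level is \<open>1 + real n\<close> so that it is positive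
        from \<open>n = 0\<close> on, as required of \<open>M\<close> and \<open>N\<close>.\<close>
      by (rule Im_F_weighted_le_Re_F[where M="1 + real n" and N="1 + real n"]) (use c in \<open>auto simp: cut_bounds\<close>)
    also have "\<dots> \<le> ennreal (2 + 4 * L\<^sup>2) * (ennreal (1 + L) * weighted_square (cut n f))"
      by (intro mult_left_mono Re_cauchy_transform_weighted_le finc c cut_measurable f) simp
    also have "\<dots> \<le> ennreal (2 + 4 * L\<^sup>2) * (ennreal (1 + L) * weighted_square f)"
      by (intro mult_left_mono weighted_square_mono cut_bounds) auto
    also have "\<dots> = ennreal K * weighted_square f"
      unfolding K_def using L by (subst ennreal_mult) (auto simp: mult.assoc)
    finally show ?thesis .
  qed
  show ?thesis
  proof (rule nn_integral_le_of_AE_tendsto[OF _ _ each tendsto_const])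
    show "AE x in lborel. (\<lambda>n. ennreal ((Im (cauchy_transform (cut n f) (Complex x c)))\<^sup>2 * Re (S (Complex x c)))) \<longlonglongrightarrow>
       ennreal ((Im (cauchy_transform f (Complex x c)))\<^sup>2 * Re (S (Complex x c)))"
      using c by (intro AE_I2 tendsto_ennrealI tendsto_mult tendsto_power tendsto_Im tendsto_const cauchy_transform_cut_tendsto f fin) simp
  qed measurable
qed

definition bv :: "(real \<Rightarrow> real) \<Rightarrow> real \<Rightarrow> complex" where
  "bv f = vertical_limit (cauchy_transform f)"

lemma bv_measurable [measurable]:
  assumes f: "f \<in> borel_measurable borel" and fin: "weighted_square f < \<infinity>"
  shows "bv f \<in> borel_measurable borel"
  unfolding bv_def
  by (rule borel_measurable_vertical_limit[OF holomorphic_cauchy_transform[OF f integrable_over_1_plus_abs[OF f fin]]])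

lemma AE_bv:
  assumes f: "f \<in> borel_measurable borel" and fin: "weighted_square f < \<infinity>"
  shows "AE x in lborel. hilbert_exists_at f x \<and> bv f x = Complex (f x) (hilbert_transform f x) \<and>
     (\<lambda>n. cauchy_transform f (Complex x (1 / (1 + real n)))) \<longlonglongrightarrow> bv f x"
  using AE_hilbert_transform[OF f integrable_over_1_plus_abs[OF f fin]]
proof eventually_elim
  case (elim x)
  then have "((\<lambda>y. cauchy_transform f (Complex x y)) \<longlongrightarrow> Complex (f x) (hilbert_transform f x)) (at_right 0)" by blast
  from vertical_limit_eqI[OF this] elim show ?case by (simp add: bv_def)
qed

definition K' where "K' = 1 + (1 + L) * K"

text \<open>This contains the boundedness of the Hilbert transform on the weighted space: almost
  everywhere \<open>bv f\<close> has the parts \<open>f\<close> and \<open>Hf\<close>. In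
  \<open>K'\<close> the 1 pays for \<open>f\<close>, and \<open>(1 + L) * K\<close> for
  \<open>Hf\<close>, where the factor \<open>1 + L\<close> trades \<open>Re (s x)\<close> for
  \<open>norm (s x)\<close>.\<close>

lemma bv_weighted_le:
  assumes f[measurable]: "f \<in> borel_measurable borel" and fin: "weighted_square f < \<infinity>"
  shows "(\<integral>\<^sup>+x. ennreal ((norm (bv f x))\<^sup>2 * norm (s x)) \<partial>lborel) \<le> ennreal K' * weighted_square f"
proof -
  let ?c = "\<lambda>n. 1 / (1 + real n)"
  have [measurable]: "bv f \<in> borel_measurable borel" by (rule bv_measurable[OF f fin])
  have mS: "(\<lambda>t. S (Complex t (?c n))) \<in> borel_measurable borel"
    and mF: "(\<lambda>t. cauchy_transform f (Complex t (?c n))) \<in> borel_measurable borel" for n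
    by (rule borel_measurable_upper_horizontal[OF holS], simp,
        rule borel_measurable_upper_horizontal[OF holomorphic_cauchy_transform[OF f integrable_over_1_plus_abs[OF f fin]]], simp)
  note [measurable] = mS mF
  have 1: "(\<integral>\<^sup>+x. ennreal ((Im (bv f x))\<^sup>2 * Re (s x)) \<partial>lborel) \<le> ennreal K * weighted_square f"
  proof (rule nn_integral_le_of_AE_tendsto[OF _ _ _ tendsto_const])
    show "AE x in lborel. (\<lambda>n. ennreal ((Im (cauchy_transform f (Complex x (?c n))))\<^sup>2 * Re (S (Complex x (?c n))))) \<longlonglongrightarrow> ennreal ((Im (bv f x))\<^sup>2 * Re (s x))"
      using AE_s AE_bv[OF f fin]
      by eventually_elim (intro tendsto_ennrealI tendsto_mult tendsto_power tendsto_Im tendsto_Re; blast)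
    show "(\<integral>\<^sup>+x. ennreal ((Im (cauchy_transform f (Complex x (?c n))))\<^sup>2 * Re (S (Complex x (?c n)))) \<partial>lborel) \<le> ennreal K * weighted_square f" for n
      by (rule Im_cauchy_transform_weighted_le[OF f fin]) auto
  qed measurable
  have "(\<integral>\<^sup>+x. ennreal ((norm (bv f x))\<^sup>2 * norm (s x)) \<partial>lborel) \<le>
    (\<integral>\<^sup>+x. ennreal ((f x)\<^sup>2 * norm (s x)) + ennreal (1 + L) * ennreal ((Im (bv f x))\<^sup>2 * Re (s x)) \<partial>lborel)"
    using AE_s AE_bv[OF f fin]
  proof (intro nn_integral_mono_AE, eventually_elim)
    case (elim x)
    have Re0: "Re (s x) \<ge> 0" 
    proof -
      have "0 \<le> (1 + L) * Re (s x)" using elim(3) norm_ge_zero[of "s x"] by linarith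
      then show ?thesis using L by (simp add: zero_le_mult_iff)
    qed
    have "(norm (bv f x))\<^sup>2 = (f x)\<^sup>2 + (Im (bv f x))\<^sup>2" using elim(4) by (simp add: cmod_power2)
    then have "(norm (bv f x))\<^sup>2 * norm (s x) = (f x)\<^sup>2 * norm (s x) + (Im (bv f x))\<^sup>2 * norm (s x)"
      by (simp add: distrib_right)
    also have "(Im (bv f x))\<^sup>2 * norm (s x) \<le> (Im (bv f x))\<^sup>2 * ((1 + L) * Re (s x))"
      using elim(3) by (intro mult_left_mono) auto
    finally have "ennreal ((norm (bv f x))\<^sup>2 * norm (s x)) \<le> ennreal ((f x)\<^sup>2 * norm (s x) + (1 + L) * ((Im (bv f x))\<^sup>2 * Re (s x)))"
      by (intro ennreal_leI) (simp add: mult_ac)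
    also have "\<dots> = ennreal ((f x)\<^sup>2 * norm (s x)) + ennreal ((1 + L) * ((Im (bv f x))\<^sup>2 * Re (s x)))"
      by (rule ennreal_plus) (use Re0 L in auto)
    also have "ennreal ((1 + L) * ((Im (bv f x))\<^sup>2 * Re (s x))) = ennreal (1 + L) * ennreal ((Im (bv f x))\<^sup>2 * Re (s x))"
      by (rule ennreal_mult) (use Re0 L in auto)
    finally show ?case .
  qed
  also have "\<dots> = weighted_square f + ennreal (1 + L) * (\<integral>\<^sup>+x. ennreal ((Im (bv f x))\<^sup>2 * Re (s x)) \<partial>lborel)"
    unfolding weighted_square_def by (subst nn_integral_add, measurable, subst nn_integral_cmult, measurable)
  also have "\<dots> \<le> weighted_square f + ennreal (1 + L) * (ennreal K * weighted_square f)"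
    by (intro add_left_mono mult_left_mono 1) simp
  also have "\<dots> = ennreal K' * weighted_square f"
  proof -
    have "ennreal K' = 1 + ennreal (1 + L) * ennreal K"
      unfolding K'_def using L K_nonneg by (simp add: ennreal_mult[symmetric] del: ennreal_plus) (simp add: ennreal_plus[symmetric] ennreal_1[symmetric] del: ennreal_plus ennreal_1)
    then show ?thesis by (simp add: distrib_right mult.assoc)
  qed
  finally show ?thesis .
qed

lemma integrable_bv_weighted:
  assumes f[measurable]: "f \<in> borel_measurable borel" and fin: "weighted_square f < \<infinity>"
  shows "integrable lborel (\<lambda>x. (norm (bv f x))\<^sup>2 * norm (s x))"
  unfolding integrable_iff_bounded
proof
  have [measurable]: "bv f \<in> borel_measurable borel" by (rule bv_measurable[OF f fin])
  show "(\<lambda>x. (norm (bv f x))\<^sup>2 * norm (s x)) \<in> borel_measurable lborel" by measurable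
  have "(\<integral>\<^sup>+x. ennreal (norm ((norm (bv f x))\<^sup>2 * norm (s x))) \<partial>lborel) \<le> ennreal K' * weighted_square f"
    using bv_weighted_le[OF f fin] by simp
  also have "\<dots> < \<infinity>" using fin by (simp add: ennreal_mult_less_top)
  finally show "(\<integral>\<^sup>+x. ennreal (norm ((norm (bv f x))\<^sup>2 * norm (s x))) \<partial>lborel) < \<infinity>" .
qed

text \<open>The integral is a quadratic form in \<open>f\<close> which is continuous by
  \<open>bv_weighted_le\<close> and vanishes on truncated data, which are dense.\<close>

lemma integral_bv_square:
  assumes f[measurable]: "f \<in> borel_measurable borel" and fin: "weighted_square f < \<infinity>"
  shows "(\<integral>x. (bv f x)\<^sup>2 * s x \<partial>lborel) = 0"
proof -
  have mb[measurable]: "bv f \<in> borel_measurable borel" by (rule bv_measurable[OF f fin])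
  have ib: "integrable lborel (\<lambda>x. (bv f x)\<^sup>2 * s x)"
    by (rule Bochner_Integration.integrable_bound[OF integrable_bv_weighted[OF f fin]])
       (auto simp: norm_mult norm_power)
  define J where "J = (\<integral>x. (norm (bv f x))\<^sup>2 * norm (s x) \<partial>lborel)"
  have J: "J \<ge> 0" unfolding J_def by (intro integral_nonneg_AE AE_I2) simp
  define \<delta> where "\<delta> n = enn2real (weighted_square (\<lambda>t. f t - cut n f t))" for n
  have fd: "weighted_square (\<lambda>t. f t - cut n f t) < \<infinity>" for n
    using weighted_square_mono[of "\<lambda>t. f t - cut n f t" f] cut_bounds(4) fin by (simp add: le_less_trans)
  have \<delta>lim: "\<delta> \<longlonglongrightarrow> 0"
    using tendsto_enn2real[OF weighted_square_cut_tendsto[OF f fin, folded ennreal_0]] by (simp add: \<delta>_def[abs_def])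
  \<comment> \<open>The parameter \<open>\<eta>\<close> takes the place of Cauchy--Schwarz for the
    cross term. First \<open>n\<close> tends to infinity with \<open>\<eta>\<close> fixed, then
    \<open>\<eta>\<close> tends to 0.\<close>
  have key: "norm (\<integral>x. (bv f x)\<^sup>2 * s x \<partial>lborel) \<le> \<eta> * J + (1 + 1 / \<eta>) * (K' * \<delta> n)" if \<eta>: "\<eta> > 0" for \<eta> n
  proof -
    have fc: "weighted_square (cut n f) < \<infinity>"
      using weighted_square_mono[of "cut n f" f] cut_bounds(3) fin by (simp add: le_less_trans)
    define d where "d = (\<lambda>t. f t - cut n f t)"
    have dm[measurable]: "d \<in> borel_measurable borel" and cm[measurable]: "cut n f \<in> borel_measurable borel"
      unfolding d_def by measurable
    have fdd: "weighted_square d < \<infinity>" using fd by (simp add: d_def)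
    have nice: "integrable lborel (\<lambda>x. (bv (cut n f) x)\<^sup>2 * s x)" "(\<integral>x. (bv (cut n f) x)\<^sup>2 * s x \<partial>lborel) = 0"
      unfolding bv_def
      by (rule boundary_integral_F_square_S[where M="1 + real n" and N="1 + real n"]; auto simp: cut_bounds)+
    \<comment> \<open>Additivity of boundary values holds where all three vertical limits exist,
      hence almost everywhere.\<close>
    have lin: "AE x in lborel. bv f x = bv (cut n f) x + bv d x"
      using AE_bv[OF f fin] AE_bv[OF cm fc] AE_bv[OF dm fdd]
    proof eventually_elim
      case (elim x)
      have "(\<lambda>m. cauchy_transform f (Complex x (1 / (1 + real m))) - cauchy_transform (cut n f) (Complex x (1 / (1 + real m)))) \<longlonglongrightarrow> bv f x - bv (cut n f) x"
        using elim by (intro tendsto_diff) auto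
      moreover have "cauchy_transform d (Complex x (1 / (1 + real m))) =
         cauchy_transform f (Complex x (1 / (1 + real m))) - cauchy_transform (cut n f) (Complex x (1 / (1 + real m)))" for m
        unfolding d_def by (intro cauchy_transform_diff f cm integrable_over_1_plus_abs fin fc) simp
      ultimately have "(\<lambda>m. cauchy_transform d (Complex x (1 / (1 + real m)))) \<longlonglongrightarrow> bv f x - bv (cut n f) x" by simp
      then have "bv d x = bv f x - bv (cut n f) x" using elim(3) LIMSEQ_unique by blast
      then show ?case by simp
    qed
    have split: "(\<integral>x. (bv f x)\<^sup>2 * s x \<partial>lborel) = (\<integral>x. (bv f x)\<^sup>2 * s x - (bv (cut n f) x)\<^sup>2 * s x \<partial>lborel)"
      using ib nice by simp
    have "norm (\<integral>x. (bv f x)\<^sup>2 * s x \<partial>lborel) \<le> (\<integral>x. \<eta> * ((norm (bv f x))\<^sup>2 * norm (s x)) + (1 + 1 / \<eta>) * ((norm (bv d x))\<^sup>2 * norm (s x)) \<partial>lborel)"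
      unfolding split
    proof (rule order_trans[OF integral_norm_bound], rule integral_mono_AE)
      show "integrable lborel (\<lambda>x. norm ((bv f x)\<^sup>2 * s x - (bv (cut n f) x)\<^sup>2 * s x))"
        using ib nice by (intro integrable_norm Bochner_Integration.integrable_diff)
      show "integrable lborel (\<lambda>x. \<eta> * ((norm (bv f x))\<^sup>2 * norm (s x)) + (1 + 1 / \<eta>) * ((norm (bv d x))\<^sup>2 * norm (s x)))"
        by (intro Bochner_Integration.integrable_add integrable_mult_right integrable_bv_weighted f fin dm fdd)
      show "AE x in lborel. norm ((bv f x)\<^sup>2 * s x - (bv (cut n f) x)\<^sup>2 * s x) \<le>
         \<eta> * ((norm (bv f x))\<^sup>2 * norm (s x)) + (1 + 1 / \<eta>) * ((norm (bv d x))\<^sup>2 * norm (s x))"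
        using lin
      proof eventually_elim
        case (elim x)
        define a where "a = norm (bv f x)"
        define b where "b = norm (bv d x)"
        have "(bv f x)\<^sup>2 * s x - (bv (cut n f) x)\<^sup>2 * s x = (bv d x * (2 * bv f x - bv d x)) * s x"
          unfolding elim by (simp add: power2_eq_square algebra_simps)
        then have "norm ((bv f x)\<^sup>2 * s x - (bv (cut n f) x)\<^sup>2 * s x) = b * norm (2 * bv f x - bv d x) * norm (s x)"
          by (simp add: norm_mult b_def)
        also have "b * norm (2 * bv f x - bv d x) \<le> b * (2 * a + b)"
          using norm_triangle_ineq4[of "2 * bv f x" "bv d x"] by (intro mult_left_mono) (auto simp: a_def b_def norm_mult)
        \<comment> \<open>Rests on
          \<open>2 * a * b \<le> \<eta> * a\<^sup>2 + b\<^sup>2 / \<eta>\<close>.\<close>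
        also have "b * (2 * a + b) \<le> \<eta> * a\<^sup>2 + (1 + 1 / \<eta>) * b\<^sup>2"
        proof -
          have "0 \<le> (\<eta> * a - b)\<^sup>2 / \<eta>" using \<eta> by simp
          also have "\<dots> = \<eta> * a\<^sup>2 - 2 * (a * b) + 1 / \<eta> * b\<^sup>2" using \<eta> by (simp add: power2_eq_square field_simps)
          finally show ?thesis by (simp add: power2_eq_square algebra_simps)
        qed
        finally have "norm ((bv f x)\<^sup>2 * s x - (bv (cut n f) x)\<^sup>2 * s x) \<le> (\<eta> * a\<^sup>2 + (1 + 1 / \<eta>) * b\<^sup>2) * norm (s x)"
          by (simp add: mult_right_mono)
        then show ?case by (simp add: a_def b_def algebra_simps)
      qed
    qed
    also have "\<dots> = \<eta> * J + (1 + 1 / \<eta>) * (\<integral>x. (norm (bv d x))\<^sup>2 * norm (s x) \<partial>lborel)"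
    proof -
      have "(\<integral>x. \<eta> * ((norm (bv f x))\<^sup>2 * norm (s x)) + (1 + 1 / \<eta>) * ((norm (bv d x))\<^sup>2 * norm (s x)) \<partial>lborel) =
        (\<integral>x. \<eta> * ((norm (bv f x))\<^sup>2 * norm (s x)) \<partial>lborel) + (\<integral>x. (1 + 1 / \<eta>) * ((norm (bv d x))\<^sup>2 * norm (s x)) \<partial>lborel)"
        by (rule Bochner_Integration.integral_add; intro integrable_mult_right integrable_bv_weighted f fin dm fdd)
      then show ?thesis unfolding J_def by (simp only: integral_mult_right_zero)
    qed
    finally have le: "norm (\<integral>x. (bv f x)\<^sup>2 * s x \<partial>lborel) \<le> \<eta> * J + (1 + 1 / \<eta>) * (\<integral>x. (norm (bv d x))\<^sup>2 * norm (s x) \<partial>lborel)" .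
    have "(\<integral>x. (norm (bv d x))\<^sup>2 * norm (s x) \<partial>lborel) \<le> K' * \<delta> n"
    proof -
      have K': "K' \<ge> 0" using L K_nonneg by (simp add: K'_def)
      have "ennreal (\<integral>x. (norm (bv d x))\<^sup>2 * norm (s x) \<partial>lborel) = (\<integral>\<^sup>+x. ennreal ((norm (bv d x))\<^sup>2 * norm (s x)) \<partial>lborel)"
        by (intro nn_integral_eq_integral[symmetric] integrable_bv_weighted dm fdd AE_I2) simp
      also have "\<dots> \<le> ennreal K' * weighted_square d" by (rule bv_weighted_le[OF dm fdd])
      also have "weighted_square d = ennreal (\<delta> n)" using fdd by (simp add: \<delta>_def d_def)
      also have "ennreal K' * ennreal (\<delta> n) = ennreal (K' * \<delta> n)" using K' by (simp add: ennreal_mult')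
      finally show ?thesis using K' by (simp add: \<delta>_def)
    qed
    from mult_left_mono[OF this, of "1 + 1 / \<eta>"] \<eta> have "(1 + 1 / \<eta>) * (\<integral>x. (norm (bv d x))\<^sup>2 * norm (s x) \<partial>lborel) \<le> (1 + 1 / \<eta>) * (K' * \<delta> n)"
      by simp
    with le show ?thesis by linarith
  qed
  have key2: "norm (\<integral>x. (bv f x)\<^sup>2 * s x \<partial>lborel) \<le> \<eta> * J" if \<eta>: "\<eta> > 0" for \<eta>
  proof (rule tendsto_lowerbound)
    have "(\<lambda>n. \<eta> * J + (1 + 1 / \<eta>) * (K' * \<delta> n)) \<longlonglongrightarrow> \<eta> * J + (1 + 1 / \<eta>) * (K' * 0)" by (intro tendsto_intros \<delta>lim)
    then show "(\<lambda>n. \<eta> * J + (1 + 1 / \<eta>) * (K' * \<delta> n)) \<longlonglongrightarrow> \<eta> * J" by simp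
  qed (use key[OF \<eta>] in auto)
  have "norm (\<integral>x. (bv f x)\<^sup>2 * s x \<partial>lborel) \<le> e" if "e > 0" for e
  proof -
    have "e / (J + 1) > 0" using that J by simp
    from key2[OF this] have "norm (\<integral>x. (bv f x)\<^sup>2 * s x \<partial>lborel) \<le> e / (J + 1) * J" .
    also have "\<dots> \<le> e" using that J by (simp add: field_simps)
    finally show ?thesis .
  qed
  then have "norm (\<integral>x. (bv f x)\<^sup>2 * s x \<partial>lborel) \<le> 0" by (rule field_le_epsilon[where y=0, simplified])
  then show ?thesis by simp
qed

end

section \<open>Lebesgue measurable data and the two identities\<close>

lemma hilbert_cong_AE:
  assumes [measurable]: "f \<in> borel_measurable lebesgue" "h \<in> borel_measurable lebesgue" and eq: "AE x in lebesgue. f x = h x"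
  shows "hilbert_transform f x = hilbert_transform h x" "hilbert_exists_at f x \<longleftrightarrow> hilbert_exists_at h x"
proof -
  have m: "(\<lambda>y. indicator {y. \<bar>x - y\<bar> > e} y *\<^sub>R (u y / (x - y))) \<in> borel_measurable lebesgue"
    if [measurable]: "u \<in> borel_measurable lebesgue" for u :: "real \<Rightarrow> real" and e
  proof -
    have "(\<lambda>y::real. indicator {y. \<bar>x - y\<bar> > e} y / (x - y)) \<in> borel_measurable lebesgue"
      by (rule measurable_completion) measurable
    then have "(\<lambda>y. indicator {y. \<bar>x - y\<bar> > e} y / (x - y) * u y) \<in> borel_measurable lebesgue" by measurable
    then show ?thesis by (simp add: mult.commute)
  qed
  have t: "truncated_hilbert e f x = truncated_hilbert e h x" for e
    unfolding truncated_hilbert_def set_lebesgue_integral_def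
    by (rule integral_cong_AE[OF m m]) (use eq in \<open>auto elim: eventually_mono\<close>)
  have i: "set_integrable lebesgue {y. \<bar>x - y\<bar> > e} (\<lambda>y. f y / (x - y)) \<longleftrightarrow> set_integrable lebesgue {y. \<bar>x - y\<bar> > e} (\<lambda>y. h y / (x - y))" for e
    unfolding set_integrable_def
    by (rule integrable_cong_AE[OF m m]) (use eq in \<open>auto elim: eventually_mono\<close>)
  show "hilbert_transform f x = hilbert_transform h x" by (simp add: hilbert_transform_def t)
  show "hilbert_exists_at f x \<longleftrightarrow> hilbert_exists_at h x" by (simp add: hilbert_exists_at_def t i)
qed

theorem theorem1p2:
  fixes \<gamma> :: "real \<Rightarrow> real" and \<Phi> :: "complex \<Rightarrow> complex" and f :: "real \<Rightarrow> real"
  assumes "lipschitz_graph_function \<gamma>"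
    and "associated_conformal_map \<gamma> \<Phi>"
    and "in_weighted_L2 (\<lambda>x. inverse (cmod (boundary_deriv \<Phi> x))) f"
  defines "R \<equiv> (\<lambda>x. Re (1 / boundary_deriv \<Phi> x))"
    and "I \<equiv> (\<lambda>x. Im (1 / boundary_deriv \<Phi> x))"
    and "Hf \<equiv> hilbert_transform f"
  shows "(AE x in lebesgue. hilbert_exists_at f x) \<and>
    integrable lebesgue (\<lambda>x. (Hf x)\<^sup>2 * R x) \<and>
    integrable lebesgue (\<lambda>x. (f x)\<^sup>2 * R x) \<and>
    integrable lebesgue (\<lambda>x. f x * Hf x * I x) \<and>
    integrable lebesgue (\<lambda>x. (Hf x)\<^sup>2 * I x) \<and>
    integrable lebesgue (\<lambda>x. (f x)\<^sup>2 * I x) \<and>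
    integrable lebesgue (\<lambda>x. f x * Hf x * R x) \<and>
    (LINT x|lebesgue. (Hf x)\<^sup>2 * R x) =
      (LINT x|lebesgue. (f x)\<^sup>2 * R x) - 2 * (LINT x|lebesgue. f x * Hf x * I x) \<and>
    (LINT x|lebesgue. (Hf x)\<^sup>2 * I x) =
      (LINT x|lebesgue. (f x)\<^sup>2 * I x) + 2 * (LINT x|lebesgue. f x * Hf x * R x)"
proof -
  obtain L0 where "L0-lipschitz_on UNIV \<gamma>" using assms(1) by (auto simp: lipschitz_graph_function_def)
  \<comment> \<open>The Lipschitz constant is raised to at least 1 because the sector argument
    divides by \<open>L\<close>.\<close>
  then have lip: "(max L0 1)-lipschitz_on UNIV \<gamma>" by (rule lipschitz_on_le) simp
  define L where "L = max L0 1"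
  have L: "L > 0" by (simp add: L_def)
  have hol: "\<Phi> holomorphic_on upper_half_plane" using assms(2) by (simp add: associated_conformal_map_def)
  have sec: "0 < Re (1 / deriv \<Phi> z)" "\<bar>Im (1 / deriv \<Phi> z)\<bar> \<le> L * Re (1 / deriv \<Phi> z)" if "Im z > 0" for z
    using sector_derivative[OF lip _ assms(2) that] by (auto simp: L_def)
  obtain p where p: "1 < p" "p * arctan L < pi / 2" using sector_exponent by blast
  have hol': "deriv \<Phi> holomorphic_on upper_half_plane" by (rule holomorphic_deriv[OF hol open_upper_half_plane])
  interpret sector_weight "\<lambda>z. 1 / deriv \<Phi> z" L p
  proof
    show "(\<lambda>z. 1 / deriv \<Phi> z) holomorphic_on upper_half_plane"
      by (intro holomorphic_intros hol') (use sec(1) in force)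
  qed (use sec L p in auto)
  have G: "G = deriv \<Phi>" by (simp add: G_def fun_eq_iff)
  have "AE x in lborel. boundary_deriv \<Phi> x = vertical_limit (deriv \<Phi>) x"
    by (rule AE_boundary_deriv_eq[OF hol, where L=L]) (use sector_inverse[OF sec] in auto)
  then have "AE x in lborel. 1 / boundary_deriv \<Phi> x = s x"
    using AE_s
  proof eventually_elim
    case (elim x)
    then have "boundary_deriv \<Phi> x = g x" by (simp add: g_def G)
    moreover have "g x \<noteq> 0" using elim by auto
    ultimately show ?case using elim by (simp add: field_simps)
  qed
  then have bs: "AE x in lebesgue. 1 / boundary_deriv \<Phi> x = s x" by (rule AE_completion)
  have fm: "f \<in> borel_measurable lebesgue" using assms(3) by (simp add: in_weighted_L2_def)
  \<comment> \<open>The estimates above are for Borel functions. A Borel representative changes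
    \<open>Hf\<close> at no point, since almost everywhere equal functions have the same truncated
    integrals.\<close>
  obtain f' where f'[measurable]: "f' \<in> borel_measurable borel" and ff'0: "AE x in lborel. f x = f' x"
    using completion_ex_borel_measurable_real[OF fm] by auto
  then have ff': "AE x in lebesgue. f x = f' x" by (intro AE_completion)
  have f'm: "f' \<in> borel_measurable lebesgue" by (rule measurable_completion) simp
  have "weighted_square f' = (\<integral>\<^sup>+t. ennreal ((f' t)\<^sup>2 * norm (s t)) \<partial>lebesgue)"
    unfolding weighted_square_def by (simp add: nn_integral_completion)
  also have "\<dots> = (\<integral>\<^sup>+t. ennreal (norm (\<bar>f t\<bar>\<^sup>2 * inverse (cmod (boundary_deriv \<Phi> t)))) \<partial>lebesgue)"
  proof (rule nn_integral_cong_AE)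
    show "AE t in lebesgue. ennreal ((f' t)\<^sup>2 * norm (s t)) = ennreal (norm (\<bar>f t\<bar>\<^sup>2 * inverse (cmod (boundary_deriv \<Phi> t))))"
      using ff' bs
    proof eventually_elim
      case (elim t)
      have "norm (s t) = norm (1 / boundary_deriv \<Phi> t)" by (simp only: elim)
      also have "\<dots> = inverse (cmod (boundary_deriv \<Phi> t))" by (simp add: norm_divide inverse_eq_divide)
      finally show ?case using elim(1) by (simp add: abs_mult)
    qed
  qed
  also have "\<dots> < \<infinity>" using assms(3) by (auto simp: in_weighted_L2_def integrable_iff_bounded)
  finally have fin: "weighted_square f' < \<infinity>" .
  note H = hilbert_cong_AE[OF fm f'm ff']
  have bvm[measurable]: "bv f' \<in> borel_measurable borel" by (rule bv_measurable[OF f' fin])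
  define h where "h x = Im (bv f' x)" for x
  have [measurable]: "h \<in> borel_measurable borel" unfolding h_def by measurable
  have AEbv: "AE x in lebesgue. hilbert_exists_at f' x \<and> bv f' x = Complex (f' x) (hilbert_transform f' x) \<and>
     (\<lambda>n. cauchy_transform f' (Complex x (1 / (1 + real n)))) \<longlonglongrightarrow> bv f' x"
    by (rule AE_completion[OF AE_bv[OF f' fin]])
  have ex: "AE x in lebesgue. hilbert_exists_at f x"
    using AEbv by eventually_elim (simp add: H)
  have eqs: "AE x in lebesgue. f x = f' x \<and> Hf x = h x \<and> R x = Re (s x) \<and> I x = Im (s x)"
    using AEbv ff' bs by eventually_elim (simp add: H Hf_def h_def R_def I_def)
  have bvc: "AE x in lborel. bv f' x = Complex (f' x) (h x)"
    using AE_bv[OF f' fin] by eventually_elim (simp add: h_def)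
  \<comment> \<open>Carries each of the six integrands from Lebesgue to Borel measure at once; each
    is dominated by \<open>\<bar>bv f'\<bar>\<^sup>2 * \<bar>s\<bar>\<close>, which is
    integrable.\<close>
  have main: "integrable lebesgue u \<and> (LINT x|lebesgue. u x) = (\<integral>x. v x \<partial>lborel) \<and> integrable lborel v"
    if vm[measurable]: "v \<in> borel_measurable borel" and uv: "AE x in lebesgue. u x = v x"
      and vb: "AE x in lborel. \<bar>v x\<bar> \<le> (norm (bv f' x))\<^sup>2 * norm (s x)" for u v :: "real \<Rightarrow> real"
  proof -
    have vl: "integrable lborel v"
      by (rule Bochner_Integration.integrable_bound[OF integrable_bv_weighted[OF f' fin]]) (use vb in auto)
    have vm': "v \<in> borel_measurable lebesgue" by (rule measurable_completion) simp
    have um: "u \<in> borel_measurable lebesgue"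
      by (rule borel_measurable_AE[OF vm']) (use uv in \<open>auto elim: eventually_mono\<close>)
    have "integrable lebesgue v" using vl integrable_completion[of v lborel] by simp
    then have "integrable lebesgue u" using integrable_cong_AE[OF um vm' uv] by simp
    moreover have "(LINT x|lebesgue. u x) = (\<integral>x. v x \<partial>lborel)"
      using integral_cong_AE[OF um vm' uv] integral_completion[of v lborel] by simp
    ultimately show ?thesis using vl by blast
  qed
  have ineq: "\<bar>(h x)\<^sup>2 * Re (s x)\<bar> \<le> B \<and> \<bar>(f' x)\<^sup>2 * Re (s x)\<bar> \<le> B \<and> \<bar>f' x * h x * Im (s x)\<bar> \<le> B \<and>
     \<bar>(h x)\<^sup>2 * Im (s x)\<bar> \<le> B \<and> \<bar>(f' x)\<^sup>2 * Im (s x)\<bar> \<le> B \<and> \<bar>f' x * h x * Re (s x)\<bar> \<le> B"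
    if "bv f' x = Complex (f' x) (h x)" "B = (norm (bv f' x))\<^sup>2 * norm (s x)" for x B
  proof -
    have n: "(norm (bv f' x))\<^sup>2 = (f' x)\<^sup>2 + (h x)\<^sup>2" using that by (simp add: cmod_power2)
    have "0 \<le> (\<bar>f' x\<bar> - \<bar>h x\<bar>)\<^sup>2" by simp
    then have "2 * (\<bar>f' x\<bar> * \<bar>h x\<bar>) \<le> (f' x)\<^sup>2 + (h x)\<^sup>2" unfolding power2_diff by simp
    moreover have "0 \<le> \<bar>f' x\<bar> * \<bar>h x\<bar>" by simp
    ultimately have fh: "\<bar>f' x * h x\<bar> \<le> (f' x)\<^sup>2 + (h x)\<^sup>2" unfolding abs_mult by linarith
    have a: "\<bar>(h x)\<^sup>2\<bar> \<le> (f' x)\<^sup>2 + (h x)\<^sup>2" "\<bar>(f' x)\<^sup>2\<bar> \<le> (f' x)\<^sup>2 + (h x)\<^sup>2" by auto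
    show ?thesis unfolding that(2) n abs_mult[of "(h x)\<^sup>2"] abs_mult[of "(f' x)\<^sup>2"] abs_mult[of "f' x * h x"]
      using a fh abs_Re_le_cmod[of "s x"] abs_Im_le_cmod[of "s x"]
      by (intro conjI mult_mono) auto
  qed
  have M1: "integrable lebesgue (\<lambda>x. (Hf x)\<^sup>2 * R x) \<and> (LINT x|lebesgue. (Hf x)\<^sup>2 * R x) = (\<integral>x. (h x)\<^sup>2 * Re (s x) \<partial>lborel) \<and> integrable lborel (\<lambda>x. (h x)\<^sup>2 * Re (s x))"
    by (rule main, measurable, rule eventually_mono[OF eqs], simp, rule eventually_mono[OF bvc], use ineq[OF _ refl] in blast)
  have M2: "integrable lebesgue (\<lambda>x. (f x)\<^sup>2 * R x) \<and> (LINT x|lebesgue. (f x)\<^sup>2 * R x) = (\<integral>x. (f' x)\<^sup>2 * Re (s x) \<partial>lborel) \<and> integrable lborel (\<lambda>x. (f' x)\<^sup>2 * Re (s x))"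
    by (rule main, measurable, rule eventually_mono[OF eqs], simp, rule eventually_mono[OF bvc], use ineq[OF _ refl] in blast)
  have M3: "integrable lebesgue (\<lambda>x. f x * Hf x * I x) \<and> (LINT x|lebesgue. f x * Hf x * I x) = (\<integral>x. f' x * h x * Im (s x) \<partial>lborel) \<and> integrable lborel (\<lambda>x. f' x * h x * Im (s x))"
    by (rule main, measurable, rule eventually_mono[OF eqs], simp, rule eventually_mono[OF bvc], use ineq[OF _ refl] in blast)
  have M4: "integrable lebesgue (\<lambda>x. (Hf x)\<^sup>2 * I x) \<and> (LINT x|lebesgue. (Hf x)\<^sup>2 * I x) = (\<integral>x. (h x)\<^sup>2 * Im (s x) \<partial>lborel) \<and> integrable lborel (\<lambda>x. (h x)\<^sup>2 * Im (s x))"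
    by (rule main, measurable, rule eventually_mono[OF eqs], simp, rule eventually_mono[OF bvc], use ineq[OF _ refl] in blast)
  have M5: "integrable lebesgue (\<lambda>x. (f x)\<^sup>2 * I x) \<and> (LINT x|lebesgue. (f x)\<^sup>2 * I x) = (\<integral>x. (f' x)\<^sup>2 * Im (s x) \<partial>lborel) \<and> integrable lborel (\<lambda>x. (f' x)\<^sup>2 * Im (s x))"
    by (rule main, measurable, rule eventually_mono[OF eqs], simp, rule eventually_mono[OF bvc], use ineq[OF _ refl] in blast)
  have M6: "integrable lebesgue (\<lambda>x. f x * Hf x * R x) \<and> (LINT x|lebesgue. f x * Hf x * R x) = (\<integral>x. f' x * h x * Re (s x) \<partial>lborel) \<and> integrable lborel (\<lambda>x. f' x * h x * Re (s x))"
    by (rule main, measurable, rule eventually_mono[OF eqs], simp, rule eventually_mono[OF bvc], use ineq[OF _ refl] in blast)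
  have ib: "integrable lborel (\<lambda>x. (bv f' x)\<^sup>2 * s x)"
    by (rule Bochner_Integration.integrable_bound[OF integrable_bv_weighted[OF f' fin]])
       (auto simp: norm_mult norm_power)
  \<comment> \<open>Expanding \<open>(f' + \<i> * h)\<^sup>2 * s\<close> gives the first identity
    from the real part and, further down, the second from the imaginary part.\<close>
  have "0 = (\<integral>x. Re ((bv f' x)\<^sup>2 * s x) \<partial>lborel)"
    using integral_Re[OF ib] integral_bv_square[OF f' fin] by simp
  also have "\<dots> = (\<integral>x. (f' x)\<^sup>2 * Re (s x) - (h x)\<^sup>2 * Re (s x) - 2 * (f' x * h x * Im (s x)) \<partial>lborel)"
    by (rule integral_cong_AE, measurable, rule eventually_mono[OF bvc], simp add: power2_eq_square algebra_simps)
  also have "\<dots> = (\<integral>x. (f' x)\<^sup>2 * Re (s x) \<partial>lborel) - (\<integral>x. (h x)\<^sup>2 * Re (s x) \<partial>lborel) - 2 * (\<integral>x. f' x * h x * Im (s x) \<partial>lborel)"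
    using M1 M2 M3 by simp
  finally have E1: "(\<integral>x. (h x)\<^sup>2 * Re (s x) \<partial>lborel) = (\<integral>x. (f' x)\<^sup>2 * Re (s x) \<partial>lborel) - 2 * (\<integral>x. f' x * h x * Im (s x) \<partial>lborel)"
    by simp
  have "0 = (\<integral>x. Im ((bv f' x)\<^sup>2 * s x) \<partial>lborel)"
    using integral_Im[OF ib] integral_bv_square[OF f' fin] by simp
  also have "\<dots> = (\<integral>x. (f' x)\<^sup>2 * Im (s x) - (h x)\<^sup>2 * Im (s x) + 2 * (f' x * h x * Re (s x)) \<partial>lborel)"
    by (rule integral_cong_AE, measurable, rule eventually_mono[OF bvc], simp add: power2_eq_square algebra_simps)
  also have "\<dots> = (\<integral>x. (f' x)\<^sup>2 * Im (s x) \<partial>lborel) - (\<integral>x. (h x)\<^sup>2 * Im (s x) \<partial>lborel) + 2 * (\<integral>x. f' x * h x * Re (s x) \<partial>lborel)"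
    using M4 M5 M6 by simp
  finally have E2: "(\<integral>x. (h x)\<^sup>2 * Im (s x) \<partial>lborel) = (\<integral>x. (f' x)\<^sup>2 * Im (s x) \<partial>lborel) + 2 * (\<integral>x. f' x * h x * Re (s x) \<partial>lborel)"
    by simp
  show ?thesis using ex M1 M2 M3 M4 M5 M6 E1 E2 by simp
qed

end
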